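(* The correspondence $\omega\in K_\beta^{\mathrm{ln}}(\alpha^t)\mapsto\psi_\omega\in\mathcal{W}_\beta^{\mathrm{ln}}(\tilde\mu)$ defined by $$\psi_\omega(\iota_n^{**}(\delta_{(z,\gamma)}))=\frac{\dim(z)}{\dim_\beta(z)}\,\omega(z)\,\gamma^\beta,\qquad (z,\gamma)\in\widetilde{\mathfrak{Z}}_n,\quad n=0,1,\dots$$ is an affine-isomorphism. In particular, each $\psi\in\mathcal{W}_\beta^{\mathrm{ln}}(\tilde\mu)$ gives a unique $\omega_\psi\in K_\beta^{\mathrm{ln}}(\alpha^t)$ in such a way that $$\omega_\psi(a)=\sum_{z\in\mathfrak{Z}_n}\psi(\iota_n^{**}(\delta_{(z,1)}))\,\frac{\mathrm{Tr}(\rho_z^{-\beta}za)}{\dim(z)},\qquad a\in A_n,\quad n=0,1,\dots,$$ and any element of $K_\beta^{\mathrm{ln}}(\alpha^t)$ arises in this way.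
   Context: Setting. $A_0=\mathbb{C}1$, and $A_n$ ($n\ge1$) are atomic $W^*$-algebras with separable preduals, with unital normal embeddings $A_n\hookrightarrow A_{n+1}$ ($n\ge0$); $A=\varinjlim A_n$ ($C^*$-inductive limit). $\mathfrak{Z}_n$ is the (countable) set of minimal projections of the center $\mathcal{Z}(A_n)$, $\mathfrak{Z}=\bigsqcup_{n\ge0}\mathfrak{Z}_n$ (so $\mathfrak{Z}_0=\{1\}$), and $zA_n=B(\mathcal{H}_z)$ for $z\in\mathfrak{Z}_n$. It is assumed that $\dim(z):=\dim\mathcal{H}_z<\infty$ for all $z$. $\alpha:\mathbb{R}\curvearrowright A$ is a flow with $\alpha^t(A_n)=A_n$, whose restriction $\alpha_n^t$ to each $A_n$ is continuous in the $u$-topology ($t\mapsto\varphi\circ\alpha_n^t$ norm continuous for each $\varphi$ in the predual). Then $\alpha_n^t$ fixes $\mathcal{Z}(A_n)$ pointwise, and for each $z\in\mathfrak{Z}_n$ there is a unique positive invertible $\rho_z\in zA_n=B(\mathcal{H}_z)$ with $\alpha_n^t=\mathrm{Ad}\,\rho_z^{it}$ on $zA_n$ and $\mathrm{Tr}(\rho_z)=\mathrm{Tr}(\rho_z^{-1})$ ($\mathrm{Tr}$ the non-normalized trace). $\beta\in\mathbb{R}$ is fixed and $\dim_\beta(z)=\mathrm{Tr}(\rho_z^{-\beta})$. $K_\beta^{\mathrm{ln}}(\alpha^t)$: the convex set of locally normal $(\alpha^t,\beta)$-KMS states, i.e. states $\omega$ on $A$ whose restriction to each $A_n$ is normal and satisfies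 $\omega(ab)=\omega(b\,\alpha_n^{i\beta}(a))$ for all $\alpha_n^t$-analytic $a\in A_n$ and all $b\in A_n$. Extended graph. $\Gamma$ is the countable subgroup of $(0,\infty)$ (multiplicative) generated by all eigenvalues of all $\rho_z$; $\rho_z=\sum_{\gamma\in\Gamma}\gamma\,p_z(\gamma)$ is the spectral decomposition. For $(z,z')\in\mathfrak{Z}_{n+1}\times\mathfrak{Z}_n$ let $m(z,z')$ be the multiplicity of $z'A_n$ in $zA_{n+1}$ ($m(z,z')>0$ iff $zz'\ne0$), and if $m(z,z')>0$ put $q_{(z,z')}(\gamma)=\sum_{\gamma'\in\Gamma}p_z(\gamma\gamma')p_{z'}(\gamma')\in zA_{n+1}$. $\widetilde{\mathfrak{Z}}_n=\mathfrak{Z}_n\times\Gamma$, $\widetilde{\mathfrak{Z}}=\bigsqcup_n\widetilde{\mathfrak{Z}}_n$, and for $((z,\gamma),(z',\gamma'))\in\widetilde{\mathfrak{Z}}_{n+1}\times\widetilde{\mathfrak{Z}}_n$, $\tilde\mu((z,\gamma),(z',\gamma'))=\mathrm{Tr}(q_{(z,z')}(\gamma^{-1}\gamma'))/\dim(z)$ if $m(z,z')>0$ and $=0$ otherwise. $T_\gamma(z,\gamma')=(z,\gamma\gamma')$ is the translation action of $\Gamma$ on $\widetilde{\mathfrak{Z}}$. The group $\mathfrak{D}$. Let $\widetilde{\prod}_{(z,\gamma)\in\widetilde{\mathfrak{Z}}_n}\frac{\mathbb{Z}}{\dim(z)}$ be the additive group of bounded functions $f:\widetilde{\mathfrak{Z}}_n\to\mathbb{Q}$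 with $f(z,\gamma)\in\frac{1}{\dim(z)}\mathbb{Z}$ for all $(z,\gamma)$, and let $[\,\cdot\,]_+$ denote the cone of its pointwise non-negative elements. Connecting maps: $\iota_{n+1,n}^{**}(f)(z,\gamma)=\sum_{(z',\gamma')\in\widetilde{\mathfrak{Z}}_n}\tilde\mu((z,\gamma),(z',\gamma'))f(z',\gamma')$. $\mathfrak{D}$ is the inductive limit of these groups, $\iota_n^{**}:\widetilde{\prod}_{(z,\gamma)\in\widetilde{\mathfrak{Z}}_n}\frac{\mathbb{Z}}{\dim(z)}\to\mathfrak{D}$ the canonical homomorphism, and $\mathfrak{D}_+=\bigcup_n\iota_n^{**}\big([\widetilde{\prod}_{(z,\gamma)\in\widetilde{\mathfrak{Z}}_n}\frac{\mathbb{Z}}{\dim(z)}]_+\big)$. (The paper identifies $(\mathfrak{D},\mathfrak{D}_+)$ with $(K_0(\widetilde{A}),K_0(\widetilde{A})_+)$ of the crossed-product extension $\widetilde{A}$ of $A$, whose dual $\Gamma$-action $\widetilde\alpha^\gamma$ induces the automorphisms below.) $(\widetilde\alpha^\gamma)^{**}$ is the automorphism of $\mathfrak{D}$ with $(\widetilde\alpha^\gamma)^{**}(\iota_n^{**}(f))=\iota_n^{**}(f\circ T_\gamma^{-1})$. $\delta_{(z,\gamma)}$ is the Dirac function at $(z,\gamma)$. $\mathcal{W}_\beta^{\mathrm{ln}}(\tilde\mu)$ is the set of additive maps $\psi:\mathfrak{D}_+\to[0,\infty]$ such that (i) $\psi\circ(\widetilde\alpha^\gamma)^{**}=\gamma^\beta\psi$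 for all $\gamma\in\Gamma$; (ii) for each $n$, if $f_k\nearrow f$ (a sequence, $k\to\infty$) in $[\widetilde{\prod}_{(z,\gamma)\in\widetilde{\mathfrak{Z}}_n}\frac{\mathbb{Z}}{\dim(z)}]_+$ pointwise on $\widetilde{\mathfrak{Z}}_n$, then $\psi(\iota_n^{**}(f_k))\nearrow\psi(\iota_n^{**}(f))$; (iii) $\psi(\iota_0^{**}(\delta_{(1,1)}))=1$. *)

theory Defs
  imports
    "HOL-Analysis.Infinite_Sum"
    "HOL-Library.Extended_Nonnegative_Real"
    "HOL-Library.FuncSet"
    "Jordan_Normal_Form.Char_Poly"
    "Jordan_Normal_Form.Schur_Decomposition"
begin

section \<open>C*-algebras\<close>

text \<open>The ambient unital (nonzero) C*-algebra is a type. The real Banach algebra structure comes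
  from the distribution; complex scalars and the involution are added.\<close>

class cstar_algebra = real_normed_algebra_1 + banach +
  fixes scaleC :: "complex \<Rightarrow> 'a \<Rightarrow> 'a"
    and star :: "'a \<Rightarrow> 'a"
  assumes scaleC_of_real: "scaleC (complex_of_real r) x = scaleR r x"
    and scaleC_add_right: "scaleC c (x + y) = scaleC c x + scaleC c y"
    and scaleC_add_left: "scaleC (c + d) x = scaleC c x + scaleC d x"
    and scaleC_scaleC: "scaleC c (scaleC d x) = scaleC (c * d) x"
    and mult_scaleC_left: "scaleC c x * y = scaleC c (x * y)"
    and mult_scaleC_right: "x * scaleC c y = scaleC c (x * y)"
    and norm_scaleC: "norm (scaleC c x) = cmod c * norm x"
    and star_star: "star (star x) = x"
    and star_add: "star (x + y) = star x + star y"
    and star_scaleC: "star (scaleC c x) = scaleC (cnj c) (star x)"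
    and star_mult: "star (x * y) = star y * star x"
    and norm_star_mult_self: "norm (star x * x) = (norm x)\<^sup>2"

definition cstar_subalgebra :: "'a::cstar_algebra set \<Rightarrow> bool" where
  "cstar_subalgebra M \<longleftrightarrow>
     closed M \<and> 1 \<in> M \<and>
     (\<forall>x\<in>M. \<forall>y\<in>M. x + y \<in> M \<and> x * y \<in> M) \<and>
     (\<forall>x\<in>M. star x \<in> M \<and> (\<forall>c. scaleC c x \<in> M))"

definition projections :: "'a::cstar_algebra set \<Rightarrow> 'a set" where
  "projections M = {p \<in> M. p * p = p \<and> star p = p}"

text \<open>For projections, \<open>q \<le> p\<close> means \<open>q * p = q\<close>.\<close>

definition minimal_projections :: "'a::cstar_algebra set \<Rightarrow> 'a set" where
  "minimal_projections M =
     {p \<in> projections M. p \<noteq> 0 \<and> (\<forall>q\<in>projections M. q * p = q \<longrightarrow> q = 0 \<or> q = p)}"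

definition center :: "'a::cstar_algebra set \<Rightarrow> 'a set" where
  "center M = {x \<in> M. \<forall>y\<in>M. x * y = y * x}"

definition corner :: "'a::cstar_algebra \<Rightarrow> 'a set \<Rightarrow> 'a set" where
  "corner z M = (\<lambda>x. z * x) ` M"

definition star_automorphism :: "('a::cstar_algebra \<Rightarrow> 'a) \<Rightarrow> bool" where
  "star_automorphism g \<longleftrightarrow>
     bij g \<and> (\<forall>x y. g (x + y) = g x + g y) \<and> (\<forall>c x. g (scaleC c x) = scaleC c (g x)) \<and>
     (\<forall>x y. g (x * y) = g x * g y) \<and> (\<forall>x. g (star x) = star (g x))"

definition state :: "('a::cstar_algebra \<Rightarrow> complex) \<Rightarrow> bool" where
  "state \<omega> \<longleftrightarrow>
     (\<forall>x y. \<omega> (x + y) = \<omega> x + \<omega> y) \<and> (\<forall>c x. \<omega> (scaleC c x) = c * \<omega> x) \<and>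
     (\<forall>x. Im (\<omega> (star x * x)) = 0 \<and> 0 \<le> Re (\<omega> (star x * x))) \<and>
     \<omega> 1 = 1"


section \<open>W*-algebras\<close>

text \<open>Functionals on a subalgebra \<open>M\<close> are functions on the ambient type that vanish off \<open>M\<close>,
  so that equality of functionals is equality of functions.\<close>

definition restr :: "'a set \<Rightarrow> ('a \<Rightarrow> complex) \<Rightarrow> 'a \<Rightarrow> complex" where
  "restr M \<phi> = (\<lambda>x. if x \<in> M then \<phi> x else 0)"

definition dual_space :: "'a::cstar_algebra set \<Rightarrow> ('a \<Rightarrow> complex) set" where
  "dual_space M =
     {\<phi>. (\<forall>x. x \<notin> M \<longrightarrow> \<phi> x = 0) \<and>
         (\<forall>x\<in>M. \<forall>y\<in>M. \<phi> (x + y) = \<phi> x + \<phi> y) \<and>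
         (\<forall>c. \<forall>x\<in>M. \<phi> (scaleC c x) = c * \<phi> x) \<and>
         (\<exists>K. \<forall>x\<in>M. cmod (\<phi> x) \<le> K * norm x)}"

definition dual_norm :: "'a::cstar_algebra set \<Rightarrow> ('a \<Rightarrow> complex) \<Rightarrow> real" where
  "dual_norm M \<phi> = (SUP x\<in>{x \<in> M. norm x \<le> 1}. cmod (\<phi> x))"

text \<open>Sakai's definition: a W*-algebra is a C*-algebra that is a dual Banach space. The predual is
  realized as a norm closed subspace \<open>F\<close> of the dual of \<open>M\<close> such that evaluation identifies \<open>M\<close>
  isometrically with the dual of \<open>F\<close>; the elements of \<open>F\<close> are the normal functionals.\<close>

definition is_predual :: "'a::cstar_algebra set \<Rightarrow> ('a \<Rightarrow> complex) set \<Rightarrow> bool" where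
  "is_predual M F \<longleftrightarrow>
     F \<subseteq> dual_space M \<and> (\<lambda>_. 0) \<in> F \<and>
     (\<forall>\<phi>\<in>F. \<forall>\<psi>\<in>F. \<forall>c. (\<lambda>x. c * \<phi> x + \<psi> x) \<in> F) \<and>
     (\<forall>\<phi>\<in>dual_space M. (\<forall>e>0. \<exists>\<psi>\<in>F. dual_norm M (\<lambda>x. \<phi> x - \<psi> x) < e) \<longrightarrow> \<phi> \<in> F) \<and>
     (\<forall>x\<in>M. norm x = (SUP \<phi>\<in>{\<phi> \<in> F. dual_norm M \<phi> \<le> 1}. cmod (\<phi> x))) \<and>
     (\<forall>\<Phi>. (\<forall>\<phi>\<in>F. \<forall>\<psi>\<in>F. \<forall>c. \<Phi> (\<lambda>x. c * \<phi> x + \<psi> x) = c * \<Phi> \<phi> + \<Phi> \<psi>) \<and>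
          (\<exists>K. \<forall>\<phi>\<in>F. cmod (\<Phi> \<phi>) \<le> K * dual_norm M \<phi>)
        \<longrightarrow> (\<exists>x\<in>M. \<forall>\<phi>\<in>F. \<Phi> \<phi> = \<phi> x))"

definition wstar_algebra :: "'a::cstar_algebra set \<Rightarrow> ('a \<Rightarrow> complex) set \<Rightarrow> bool" where
  "wstar_algebra M F \<longleftrightarrow> cstar_subalgebra M \<and> is_predual M F"

definition separable_predual :: "'a::cstar_algebra set \<Rightarrow> ('a \<Rightarrow> complex) set \<Rightarrow> bool" where
  "separable_predual M F \<longleftrightarrow>
     (\<exists>D\<subseteq>F. countable D \<and> (\<forall>\<phi>\<in>F. \<forall>e>0. \<exists>\<psi>\<in>D. dual_norm M (\<lambda>x. \<phi> x - \<psi> x) < e))"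

text \<open>Atomic means: the W*-direct sum of type I factors. Internally, the minimal projections of the
  center sum up to \<open>1\<close> in the weak topology induced by the predual, and the factor cut down by each
  of them has a minimal projection.\<close>

definition atomic_wstar_algebra :: "'a::cstar_algebra set \<Rightarrow> ('a \<Rightarrow> complex) set \<Rightarrow> bool" where
  "atomic_wstar_algebra M F \<longleftrightarrow>
     wstar_algebra M F \<and>
     (\<forall>\<phi>\<in>F. (\<phi> has_sum \<phi> 1) (minimal_projections (center M))) \<and>
     (\<forall>z\<in>minimal_projections (center M). \<exists>e\<in>minimal_projections M. e * z = e)"

definition mat_trace :: "complex mat \<Rightarrow> complex" where
  "mat_trace X = (\<Sum>i<dim_row X. X $$ (i, i))"

definition matrix_representation ::
    "'a::cstar_algebra \<Rightarrow> 'a set \<Rightarrow> nat \<Rightarrow> ('a \<Rightarrow> complex mat) \<Rightarrow> bool" where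
  "matrix_representation z M d \<pi> \<longleftrightarrow>
     bij_betw \<pi> (corner z M) (carrier_mat d d) \<and>
     (\<forall>x\<in>corner z M. \<forall>y\<in>corner z M. \<pi> (x + y) = \<pi> x + \<pi> y \<and> \<pi> (x * y) = \<pi> x * \<pi> y) \<and>
     (\<forall>x\<in>corner z M. \<pi> (star x) = mat_adjoint (\<pi> x) \<and> (\<forall>c. \<pi> (scaleC c x) = c \<cdot>\<^sub>m \<pi> x))"


section \<open>Inductive systems of atomic W*-algebras with a flow\<close>

text \<open>The index \<open>n\<close> is carried along with \<open>z\<close> everywhere, because one and the same element
  of the limit algebra may be a minimal central projection at several levels.\<close>

record 'a flow_system =
  alg :: "nat \<Rightarrow> 'a set"                            \<comment> \<open>the subalgebra \<open>A\<^sub>n\<close>\<close>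
  predual :: "nat \<Rightarrow> ('a \<Rightarrow> complex) set"           \<comment> \<open>the predual of \<open>A\<^sub>n\<close>\<close>
  hdim :: "nat \<Rightarrow> 'a \<Rightarrow> nat"                        \<comment> \<open>the dimension of \<open>H\<^sub>z\<close>\<close>
  rep :: "nat \<Rightarrow> 'a \<Rightarrow> 'a \<Rightarrow> complex mat"            \<comment> \<open>the identification of \<open>zA\<^sub>n\<close> with \<open>B(H\<^sub>z)\<close>\<close>
  flow :: "real \<Rightarrow> 'a \<Rightarrow> 'a"
  dens :: "nat \<Rightarrow> 'a \<Rightarrow> 'a"                         \<comment> \<open>the operator \<open>\<rho>\<^sub>z\<close> in \<open>zA\<^sub>n\<close>\<close>

definition Zmin :: "('a::cstar_algebra) flow_system \<Rightarrow> nat \<Rightarrow> 'a set" where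
  "Zmin S n = minimal_projections (center (alg S n))"

text \<open>The embeddings are inclusions; normality says that normal functionals restrict to normal
  functionals. The C*-inductive limit is the ambient algebra, in which the union is dense.\<close>

definition inductive_system :: "('a::cstar_algebra) flow_system \<Rightarrow> bool" where
  "inductive_system S \<longleftrightarrow>
     alg S 0 = range (\<lambda>c. scaleC c 1) \<and>
     (\<forall>n. atomic_wstar_algebra (alg S n) (predual S n) \<and>
          separable_predual (alg S n) (predual S n)) \<and>
     (\<forall>n. alg S n \<subseteq> alg S (Suc n)) \<and>
     (\<forall>n. \<forall>\<phi>\<in>predual S (Suc n). restr (alg S n) \<phi> \<in> predual S n) \<and>
     closure (\<Union>n. alg S n) = UNIV \<and>
     (\<forall>n. \<forall>z\<in>Zmin S n. matrix_representation z (alg S n) (hdim S n z) (rep S n z))"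

text \<open>No norm continuity of the flow is required, only continuity in the u-topology on each level.\<close>

definition flow_on_system :: "('a::cstar_algebra) flow_system \<Rightarrow> bool" where
  "flow_on_system S \<longleftrightarrow>
     (\<forall>t. star_automorphism (flow S t)) \<and>
     (\<forall>s t x. flow S (s + t) x = flow S s (flow S t x)) \<and>
     (\<forall>t n. flow S t ` alg S n = alg S n) \<and>
     (\<forall>n. \<forall>\<phi>\<in>predual S n. \<forall>t\<^sub>0.
        ((\<lambda>t. dual_norm (alg S n) (\<lambda>x. \<phi> (flow S t x) - \<phi> (flow S t\<^sub>0 x))) \<longlongrightarrow> 0) (at t\<^sub>0))"

text \<open>The non-normalized trace of \<open>x \<in> zA\<^sub>n\<close>.\<close>

definition Tr :: "('a::cstar_algebra) flow_system \<Rightarrow> nat \<Rightarrow> 'a \<Rightarrow> 'a \<Rightarrow> complex" where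
  "Tr S n z x = mat_trace (rep S n z x)"

definition eigs :: "('a::cstar_algebra) flow_system \<Rightarrow> nat \<Rightarrow> 'a \<Rightarrow> real set" where
  "eigs S n z = {\<gamma>. eigenvalue (rep S n z (dens S n z)) (complex_of_real \<gamma>)}"

text \<open>The spectral projection \<open>p\<^sub>z(\<gamma>)\<close>: the largest projection \<open>p\<close> in \<open>zA\<^sub>n\<close> with \<open>\<rho>\<^sub>z p = \<gamma> p\<close>,
  i.e. the orthogonal projection onto the kernel of \<open>\<rho>\<^sub>z - \<gamma>\<close> (\<open>0\<close> if \<open>\<gamma>\<close> is not an eigenvalue).\<close>

definition spec_proj :: "('a::cstar_algebra) flow_system \<Rightarrow> nat \<Rightarrow> 'a \<Rightarrow> real \<Rightarrow> 'a" where
  "spec_proj S n z \<gamma> =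
     (THE p. p \<in> projections (corner z (alg S n)) \<and> dens S n z * p = scaleC (complex_of_real \<gamma>) p \<and>
             (\<forall>y\<in>corner z (alg S n).
                dens S n z * y = scaleC (complex_of_real \<gamma>) y \<longrightarrow> p * y = y))"

text \<open>The power \<open>\<rho>\<^sub>z\<^sup>w\<close> with complex exponent, by functional calculus (the eigenvalues are
  positive).\<close>

definition dens_powr :: "('a::cstar_algebra) flow_system \<Rightarrow> nat \<Rightarrow> 'a \<Rightarrow> complex \<Rightarrow> 'a" where
  "dens_powr S n z w =
     (\<Sum>\<gamma>\<in>eigs S n z. scaleC (exp (w * complex_of_real (ln \<gamma>))) (spec_proj S n z \<gamma>))"

text \<open>The properties that determine the family \<open>\<rho>\<^sub>z\<close> uniquely.\<close>

definition flow_density :: "('a::cstar_algebra) flow_system \<Rightarrow> bool" where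
  "flow_density S \<longleftrightarrow> (\<forall>n. \<forall>z\<in>Zmin S n.
     (\<exists>b\<in>corner z (alg S n). dens S n z = star b * b) \<and>
     (\<exists>r\<in>corner z (alg S n). dens S n z * r = z \<and> r * dens S n z = z \<and>
        Tr S n z (dens S n z) = Tr S n z r) \<and>
     (\<forall>t. \<forall>x\<in>corner z (alg S n).
        flow S t x =
          dens_powr S n z (\<i> * complex_of_real t) * x * dens_powr S n z (- \<i> * complex_of_real t)))"

definition dim_beta :: "('a::cstar_algebra) flow_system \<Rightarrow> real \<Rightarrow> nat \<Rightarrow> 'a \<Rightarrow> real" where
  "dim_beta S \<beta> n z = Re (Tr S n z (dens_powr S n z (- complex_of_real \<beta>)))"


section \<open>Locally normal KMS states\<close>

text \<open>\<open>G\<close> is the entire extension of the orbit map of the analytic element \<open>a \<in> A\<^sub>n\<close>, so that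
  \<open>G (\<i> * \<beta>)\<close> is the value of the analytically continued flow at \<open>a\<close>.\<close>

definition analytic_extension ::
    "('a::cstar_algebra) flow_system \<Rightarrow> nat \<Rightarrow> 'a \<Rightarrow> (complex \<Rightarrow> 'a) \<Rightarrow> bool" where
  "analytic_extension S n a G \<longleftrightarrow>
     range G \<subseteq> alg S n \<and>
     (\<forall>w. \<exists>D. (G has_derivative (\<lambda>h. scaleC h D)) (at w)) \<and>
     (\<forall>t. G (complex_of_real t) = flow S t a)"

definition KMS_ln :: "('a::cstar_algebra) flow_system \<Rightarrow> real \<Rightarrow> ('a \<Rightarrow> complex) set" where
  "KMS_ln S \<beta> =
     {\<omega>. state \<omega> \<and>
         (\<forall>n. restr (alg S n) \<omega> \<in> predual S n) \<and>
         (\<forall>n. \<forall>a\<in>alg S n. \<forall>G. analytic_extension S n a G \<longrightarrow>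
            (\<forall>b\<in>alg S n. \<omega> (a * b) = \<omega> (b * G (\<i> * complex_of_real \<beta>))))}"


section \<open>The extended graph\<close>

inductive_set Gam :: "('a::cstar_algebra) flow_system \<Rightarrow> real set" for S where
  Gam_eig: "z \<in> Zmin S n \<Longrightarrow> \<gamma> \<in> eigs S n z \<Longrightarrow> \<gamma> \<in> Gam S"
| Gam_one: "1 \<in> Gam S"
| Gam_mult: "\<gamma> \<in> Gam S \<Longrightarrow> \<gamma>' \<in> Gam S \<Longrightarrow> \<gamma> * \<gamma>' \<in> Gam S"
| Gam_inverse: "\<gamma> \<in> Gam S \<Longrightarrow> inverse \<gamma> \<in> Gam S"

definition Zext :: "('a::cstar_algebra) flow_system \<Rightarrow> nat \<Rightarrow> ('a \<times> real) set" where
  "Zext S n = Zmin S n \<times> Gam S"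

text \<open>Here \<open>z\<close> is at level \<open>n + 1\<close> and \<open>z'\<close> at level \<open>n\<close>. All infinite sums in this section have
  only finitely many nonzero terms.\<close>

definition qproj :: "('a::cstar_algebra) flow_system \<Rightarrow> nat \<Rightarrow> 'a \<Rightarrow> 'a \<Rightarrow> real \<Rightarrow> 'a" where
  "qproj S n z z' \<gamma> =
     (\<Sum>\<^sub>\<infinity>\<gamma>'\<in>Gam S. spec_proj S (Suc n) z (\<gamma> * \<gamma>') * spec_proj S n z' \<gamma>')"

text \<open>The multiplicity of \<open>z'A\<^sub>n\<close> in \<open>zA\<^sub>n\<^sub>+\<^sub>1\<close> is positive iff \<open>z * z' \<noteq> 0\<close>.\<close>

definition mu :: "('a::cstar_algebra) flow_system \<Rightarrow> nat \<Rightarrow> 'a \<times> real \<Rightarrow> 'a \<times> real \<Rightarrow> real" where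
  "mu S n = (\<lambda>(z, \<gamma>) (z', \<gamma>').
     if z * z' \<noteq> 0
     then Re (Tr S (Suc n) z (qproj S n z z' (inverse \<gamma> * \<gamma>'))) / real (hdim S (Suc n) z)
     else 0)"


section \<open>The inductive limit group\<close>

text \<open>The values \<open>k / dim(z)\<close> are rational; functions vanish off the vertex set of their level.\<close>

definition Grp :: "('a::cstar_algebra) flow_system \<Rightarrow> nat \<Rightarrow> ('a \<times> real \<Rightarrow> real) set" where
  "Grp S n =
     {f. (\<forall>v. v \<notin> Zext S n \<longrightarrow> f v = 0) \<and> (\<exists>K. \<forall>v. \<bar>f v\<bar> \<le> K) \<and>
         (\<forall>(z, \<gamma>)\<in>Zext S n. \<exists>k::int. f (z, \<gamma>) = of_int k / real (hdim S n z))}"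

definition Grp_pos :: "('a::cstar_algebra) flow_system \<Rightarrow> nat \<Rightarrow> ('a \<times> real \<Rightarrow> real) set" where
  "Grp_pos S n = {f \<in> Grp S n. \<forall>v. 0 \<le> f v}"

definition conn ::
    "('a::cstar_algebra) flow_system \<Rightarrow> nat \<Rightarrow> ('a \<times> real \<Rightarrow> real) \<Rightarrow> 'a \<times> real \<Rightarrow> real" where
  "conn S n f = (\<lambda>v. if v \<in> Zext S (Suc n) then \<Sum>\<^sub>\<infinity>v'\<in>Zext S n. mu S n v v' * f v' else 0)"

primrec conn_iter ::
    "('a::cstar_algebra) flow_system \<Rightarrow> nat \<Rightarrow> nat \<Rightarrow> ('a \<times> real \<Rightarrow> real) \<Rightarrow> 'a \<times> real \<Rightarrow> real" where
  "conn_iter S n 0 f = f"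
| "conn_iter S n (Suc k) f = conn S (n + k) (conn_iter S n k f)"

definition limrel ::
    "('a::cstar_algebra) flow_system \<Rightarrow>
     ((nat \<times> ('a \<times> real \<Rightarrow> real)) \<times> (nat \<times> ('a \<times> real \<Rightarrow> real))) set" where
  "limrel S =
     {((n, f), (m, g)). f \<in> Grp S n \<and> g \<in> Grp S m \<and>
        (\<exists>k l. n + k = m + l \<and> conn_iter S n k f = conn_iter S m l g)}"

type_synonym 'a limelt = "(nat \<times> ('a \<times> real \<Rightarrow> real)) set"

definition Dlim :: "('a::cstar_algebra) flow_system \<Rightarrow> 'a limelt set" where
  "Dlim S = (SIGMA n:UNIV. Grp S n) // limrel S"

definition iota ::
    "('a::cstar_algebra) flow_system \<Rightarrow> nat \<Rightarrow> ('a \<times> real \<Rightarrow> real) \<Rightarrow> 'a limelt" where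
  "iota S n f = limrel S `` {(n, f)}"

definition Dplus :: "('a::cstar_algebra) flow_system \<Rightarrow> 'a limelt set" where
  "Dplus S = (\<Union>n. iota S n ` Grp_pos S n)"

text \<open>Addition and the \<open>\<Gamma>\<close>-action are defined on representatives; the unions below are over
  one and the same class.\<close>

definition Dadd :: "('a::cstar_algebra) flow_system \<Rightarrow> 'a limelt \<Rightarrow> 'a limelt \<Rightarrow> 'a limelt" where
  "Dadd S X Y = \<Union>{iota S n (\<lambda>v. f v + g v) |n f g. (n, f) \<in> X \<and> (n, g) \<in> Y}"

text \<open>\<open>translate \<gamma> f\<close> is \<open>f \<circ> T\<^sub>\<gamma>\<^sup>-\<^sup>1\<close>.\<close>

definition translate :: "real \<Rightarrow> ('a \<times> real \<Rightarrow> real) \<Rightarrow> 'a \<times> real \<Rightarrow> real" where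
  "translate \<gamma> f = (\<lambda>(z, \<gamma>'). f (z, inverse \<gamma> * \<gamma>'))"

definition Dact :: "('a::cstar_algebra) flow_system \<Rightarrow> real \<Rightarrow> 'a limelt \<Rightarrow> 'a limelt" where
  "Dact S \<gamma> X = \<Union>{iota S n (translate \<gamma> f) |n f. (n, f) \<in> X}"

definition dirac :: "'a \<times> real \<Rightarrow> 'a \<times> real \<Rightarrow> real" where
  "dirac v = (\<lambda>v'. if v' = v then 1 else 0)"

definition W_ln :: "('a::cstar_algebra) flow_system \<Rightarrow> real \<Rightarrow> ('a limelt \<Rightarrow> ennreal) set" where
  "W_ln S \<beta> =
     {\<psi> \<in> Dplus S \<rightarrow>\<^sub>E UNIV.
        (\<forall>X\<in>Dplus S. \<forall>Y\<in>Dplus S. \<psi> (Dadd S X Y) = \<psi> X + \<psi> Y) \<and>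
        (\<forall>\<gamma>\<in>Gam S. \<forall>X\<in>Dplus S. \<psi> (Dact S \<gamma> X) = ennreal (\<gamma> powr \<beta>) * \<psi> X) \<and>
        (\<forall>n f F. (\<forall>k. F k \<in> Grp_pos S n) \<and> f \<in> Grp_pos S n \<and>
           incseq F \<and> (\<forall>v\<in>Zext S n. (\<lambda>k. F k v) \<longlonglongrightarrow> f v) \<longrightarrow>
           incseq (\<lambda>k. \<psi> (iota S n (F k))) \<and>
           (\<lambda>k. \<psi> (iota S n (F k))) \<longlonglongrightarrow> \<psi> (iota S n f)) \<and>
        \<psi> (iota S 0 (dirac (1, 1))) = 1}"


section \<open>The correspondence\<close>

definition corresponds ::
    "('a::cstar_algebra) flow_system \<Rightarrow> real \<Rightarrow> ('a \<Rightarrow> complex) \<Rightarrow> ('a limelt \<Rightarrow> ennreal) \<Rightarrow> bool" where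
  "corresponds S \<beta> \<omega> \<psi> \<longleftrightarrow>
     (\<forall>n. \<forall>(z, \<gamma>)\<in>Zext S n.
        \<psi> (iota S n (dirac (z, \<gamma>))) =
          ennreal (real (hdim S n z) / dim_beta S \<beta> n z * Re (\<omega> z) * \<gamma> powr \<beta>))"

definition psi_of ::
    "('a::cstar_algebra) flow_system \<Rightarrow> real \<Rightarrow> ('a \<Rightarrow> complex) \<Rightarrow> 'a limelt \<Rightarrow> ennreal" where
  "psi_of S \<beta> \<omega> = (THE \<psi>. \<psi> \<in> W_ln S \<beta> \<and> corresponds S \<beta> \<omega> \<psi>)"

definition trace_formula ::
    "('a::cstar_algebra) flow_system \<Rightarrow> real \<Rightarrow> ('a limelt \<Rightarrow> ennreal) \<Rightarrow> ('a \<Rightarrow> complex) \<Rightarrow> bool" where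
  "trace_formula S \<beta> \<psi> \<omega> \<longleftrightarrow>
     (\<forall>n. \<forall>a\<in>alg S n.
        ((\<lambda>z. complex_of_real (enn2real (\<psi> (iota S n (dirac (z, 1))))) *
              (Tr S n z (dens_powr S n z (- complex_of_real \<beta>) * z * a) / of_nat (hdim S n z)))
         has_sum \<omega> a) (Zmin S n))"

end

theory Submission
  imports Defs "HOL-Complex_Analysis.Complex_Analysis"
begin

text \<open>A functional on \<open>zA\<^sub>n\<close> that satisfies the KMS condition becomes tracial after multiplication
  by \<open>\<rho>\<^sub>z\<^bsup>\<beta>\<^esup>\<close>, so it is a multiple of \<open>Tr (\<rho>\<^sub>z\<^bsup>-\<beta>\<^esup> \<cdot>)\<close>; by normality a locally normal KMS state is
  given by its values on the minimal central projections of all levels. Let \<open>z'\<close> lie one level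
  below \<open>z\<close>. Both densities implement the flow on \<open>zz'A\<^sub>n\<close>, hence the projections
  \<open>q\<^sub>\<eta> = \<Sum>\<^sub>\<gamma> p\<^sub>z(\<eta>\<gamma>) p\<^sub>z\<^sub>'(\<gamma>)\<close> commute with \<open>z'A\<^sub>n\<close>, and \<open>Tr (\<rho>\<^sub>z\<^bsup>-\<beta>\<^esup> \<cdot>)\<close> restricts to \<open>z'A\<^sub>n\<close> as the multiple
  of \<open>Tr (\<rho>\<^sub>z\<^sub>'\<^bsup>-\<beta>\<^esup> \<cdot>)\<close> with factor \<open>\<Sum>\<^sub>\<eta> \<eta>\<^bsup>-\<beta>\<^esup> Tr (q\<^sub>\<eta>) / dim(z')\<close>. Compatibility of the values along the
  levels therefore is harmonicity of a function on the extended graph, and the elements of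
  \<open>W_ln\<close> are exactly the integrals against the harmonic functions with the given scaling under \<open>\<Gamma>\<close>.

  For the converse construction one needs that the functionals living on one \<open>zA\<^sub>n\<close> are normal.
  In the abstract predual this follows from \<open>\<parallel>\<phi>\<parallel> = \<parallel>\<phi>(z\<cdot>)\<parallel> + \<parallel>\<phi>((1-z)\<cdot>)\<parallel>\<close>: a \<open>\<phi>\<close> in its unit ball that
  almost attains the norm of some \<open>x \<in> zA\<^sub>n\<close> is almost supported on the finite-dimensional \<open>zA\<^sub>n\<close>,
  and limits of such \<open>\<phi>\<close> separate the points of \<open>zA\<^sub>n\<close>.\<close>

section \<open>Positive functionals on C*-algebras\<close>

text \<open>Elements of \<open>W_ln\<close> may take the value infinity, and only the normalization
  at level 0 limits them. The construction of a state from a weight therefore stays in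
  \<open>ennreal\<close> at first: harmonicity and Tonelli carry the total mass 1 from each level to
  the next, and this makes every value at a Dirac function finite, so that complex sums make sense
  afterwards. The variable in \<open>\<Gamma>\<close> disappears because scaling fixes a weight
  along each fibre up to one constant; summing the edge weights against \<open>\<gamma>\<close> to
  the power \<open>\<beta>\<close> over a fibre yields the value of the upper KMS functional at the
  lower central projection. Harmonicity controls only these central values; the passage to all
  elements uses that an upper functional restricts to a multiple of the lower one. The KMS condition
  is tested on arbitrary analytic elements. For a given state the explicit entire orbits on a corner
  suffice; for a constructed state an arbitrary extension is compared with the explicit one by the
  identity theorem, coefficient by coefficient.\<close>

lemma scaleC_one [simp]: "scaleC 1 (x::'a::cstar_algebra) = x"
  using scaleC_of_real[of 1 x] by simp

lemma scaleC_zero_left [simp]: "scaleC 0 (x::'a::cstar_algebra) = 0"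
  using scaleC_of_real[of 0 x] by simp

lemma scaleC_zero_right [simp]: "scaleC c (0::'a::cstar_algebra) = 0"
  using scaleC_add_right[of c 0 "0::'a"] by simp

lemma scaleC_minus_one: "scaleC (- 1) (x::'a::cstar_algebra) = - x"
  using scaleC_of_real[of "-1" x] by simp

lemma scaleC_minus_left: "scaleC (- c) (x::'a::cstar_algebra) = - scaleC c x"
  using scaleC_scaleC[of "-1" c x] by (simp add: scaleC_minus_one)

lemma scaleC_minus_right: "scaleC c (- x::'a::cstar_algebra) = - scaleC c x"
  using scaleC_scaleC[of c "-1" x] by (simp add: scaleC_minus_one scaleC_minus_left)

lemma scaleC_diff_right: "scaleC c (x - y::'a::cstar_algebra) = scaleC c x - scaleC c y"
  using scaleC_add_right[of c x "- y"] by (simp add: scaleC_minus_right)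

lemma scaleC_diff_left: "scaleC (c - d) (x::'a::cstar_algebra) = scaleC c x - scaleC d x"
  using scaleC_add_left[of c "- d" x] by (simp add: scaleC_minus_left)

lemma scaleC_sum_right: "scaleC c (\<Sum>i\<in>I. f i) = (\<Sum>i\<in>I. scaleC c (f i::'a::cstar_algebra))"
  by (induction I rule: infinite_finite_induct) (auto simp: scaleC_add_right)

lemma scaleC_eq_0_iff [simp]: "scaleC c (x::'a::cstar_algebra) = 0 \<longleftrightarrow> c = 0 \<or> x = 0"
  by (metis norm_scaleC mult_eq_0_iff norm_eq_zero)

lemma star_zero [simp]: "star (0::'a::cstar_algebra) = 0"
  using star_add[of "0::'a" 0] by simp

lemma star_minus: "star (- x::'a::cstar_algebra) = - star x"
  using star_scaleC[of "-1" x] by (simp add: scaleC_minus_one)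

lemma star_diff: "star (x - y::'a::cstar_algebra) = star x - star y"
  using star_add[of x "- y"] by (simp add: star_minus)

lemma star_one [simp]: "star (1::'a::cstar_algebra) = 1"
  by (metis star_star star_mult mult_1_right mult_1_left)

lemma star_sum: "star (\<Sum>i\<in>I. f i) = (\<Sum>i\<in>I. star (f i::'a::cstar_algebra))"
  by (induction I rule: infinite_finite_induct) (auto simp: star_add)

lemma norm_star [simp]: "norm (star x) = norm (x::'a::cstar_algebra)"
proof -
  have le: "norm y \<le> norm (star y)" for y :: 'a
  proof (cases "y = 0")
    case False
    have "norm y * norm y \<le> norm (star y) * norm y"
      using norm_star_mult_self[of y] norm_mult_ineq[of "star y" y] by (simp add: power2_eq_square)
    then show ?thesis using False by simp
  qed simp
  show ?thesis using le[of x] le[of "star x"] by (simp add: star_star)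
qed

lemma star_mult_self_eq_0_iff [simp]: "star x * x = 0 \<longleftrightarrow> x = (0::'a::cstar_algebra)"
  using norm_star_mult_self[of x] by auto

lemma bounded_linear_scaleC_left: "bounded_linear (\<lambda>c. scaleC c (x::'a::cstar_algebra))"
proof
  fix b c :: complex and r :: real
  show "scaleC (b + c) x = scaleC b x + scaleC c x" by (rule scaleC_add_left)
  show "scaleC (r *\<^sub>R b) x = r *\<^sub>R scaleC b x"
    by (simp add: scaleR_conv_of_real scaleC_scaleC[symmetric] scaleC_of_real)
  show "\<exists>K. \<forall>c. norm (scaleC c x) \<le> norm c * K"
    by (auto simp: norm_scaleC)
qed

lemma bounded_linear_star: "bounded_linear (star :: 'a::cstar_algebra \<Rightarrow> 'a)"
proof
  fix x y :: 'a and r :: real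
  show "star (x + y) = star x + star y" by (rule star_add)
  show "star (r *\<^sub>R x) = r *\<^sub>R star x"
    using star_scaleC[of "complex_of_real r" x] by (simp add: scaleC_of_real)
  show "\<exists>K. \<forall>x::'a. norm (star x) \<le> norm x * K" by (auto intro: exI[of _ 1])
qed

text \<open>Weaker than \<open>cstar_subalgebra\<close>, since neither closedness nor the unit of
  the ambient algebra is demanded; this covers corners, whose unit is \<open>z\<close>.\<close>

definition star_closed :: "'a::cstar_algebra set \<Rightarrow> bool" where
  "star_closed M \<longleftrightarrow> 0 \<in> M \<and> (\<forall>x\<in>M. \<forall>y\<in>M. x + y \<in> M \<and> x * y \<in> M) \<and>
     (\<forall>x\<in>M. star x \<in> M \<and> (\<forall>c. scaleC c x \<in> M))"

lemma star_closedD: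
  assumes "star_closed M"
  shows "0 \<in> M" "x \<in> M \<Longrightarrow> y \<in> M \<Longrightarrow> x + y \<in> M" "x \<in> M \<Longrightarrow> y \<in> M \<Longrightarrow> x * y \<in> M"
    "x \<in> M \<Longrightarrow> star x \<in> M" "x \<in> M \<Longrightarrow> scaleC c x \<in> M"
    "x \<in> M \<Longrightarrow> - x \<in> M" "x \<in> M \<Longrightarrow> y \<in> M \<Longrightarrow> x - y \<in> M"
    "(\<And>i. i \<in> I \<Longrightarrow> g i \<in> M) \<Longrightarrow> sum g I \<in> M"
proof -
  note * = assms[unfolded star_closed_def]
  show "0 \<in> M" "x \<in> M \<Longrightarrow> y \<in> M \<Longrightarrow> x + y \<in> M" "x \<in> M \<Longrightarrow> y \<in> M \<Longrightarrow> x * y \<in> M"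
    "x \<in> M \<Longrightarrow> star x \<in> M" "x \<in> M \<Longrightarrow> scaleC c x \<in> M" using * by auto
  show m: "- x \<in> M" if "x \<in> M" for x using * that scaleC_minus_one[of x] by metis
  show "x \<in> M \<Longrightarrow> y \<in> M \<Longrightarrow> x - y \<in> M" using * m[of y] by (metis diff_conv_add_uminus)
  show "(\<And>i. i \<in> I \<Longrightarrow> g i \<in> M) \<Longrightarrow> sum g I \<in> M"
    using * by (induction I rule: infinite_finite_induct) auto
qed

lemma star_closed_UNIV [simp]: "star_closed (UNIV :: 'a::cstar_algebra set)"
  by (simp add: star_closed_def)

lemma cstar_subalgebra_star_closed: "cstar_subalgebra M \<Longrightarrow> star_closed M"
  unfolding cstar_subalgebra_def star_closed_def
  by (metis scaleC_zero_left)

text \<open>No bound and no normalization are part of the notion: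
  \<open>positive_functional_bound\<close> derives the bound from positivity, with the value at 1 as
  the constant.\<close>

definition positive_functional :: "'a::cstar_algebra set \<Rightarrow> ('a \<Rightarrow> complex) \<Rightarrow> bool" where
  "positive_functional M f \<longleftrightarrow>
     (\<forall>x\<in>M. \<forall>y\<in>M. f (x + y) = f x + f y) \<and> (\<forall>c. \<forall>x\<in>M. f (scaleC c x) = c * f x) \<and>
     (\<forall>x\<in>M. Im (f (star x * x)) = 0 \<and> 0 \<le> Re (f (star x * x)))"

lemma positive_functionalD:
  assumes "positive_functional M f"
  shows "x \<in> M \<Longrightarrow> y \<in> M \<Longrightarrow> f (x + y) = f x + f y" "x \<in> M \<Longrightarrow> f (scaleC c x) = c * f x"
    "x \<in> M \<Longrightarrow> Im (f (star x * x)) = 0" "x \<in> M \<Longrightarrow> 0 \<le> Re (f (star x * x))"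
  using assms by (auto simp: positive_functional_def)

lemma positive_functional_diff:
  assumes "positive_functional M f" "star_closed M" "x \<in> M" "y \<in> M"
  shows "f (x - y) = f x - f y"
  using positive_functionalD(1)[OF assms(1,3), of "- y"] positive_functionalD(2)[OF assms(1,4), of "-1"]
    star_closedD(6)[OF assms(2,4)] by (simp add: scaleC_minus_one)

lemma positive_functional_zero:
  assumes "positive_functional M f" "star_closed M"
  shows "f 0 = 0"
  using positive_functional_diff[OF assms, of 0 0] star_closedD(1)[OF assms(2)] by simp

lemma positive_functional_sum:
  assumes "positive_functional M f" "star_closed M" "\<And>i. i \<in> I \<Longrightarrow> g i \<in> M"
  shows "f (\<Sum>i\<in>I. g i) = (\<Sum>i\<in>I. f (g i))"
  using assms(3)
proof (induction I rule: infinite_finite_induct)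
  case (insert i I)
  then show ?case
    using positive_functionalD(1)[OF assms(1)] star_closedD(8)[OF assms(2), of I g] by simp
qed (auto simp: positive_functional_zero[OF assms(1,2)])

text \<open>Polarization: a real value at \<open>x + y\<close> makes the imaginary parts of the two
  cross terms cancel, and a real value at \<open>x + \<i> y\<close> makes their real parts
  agree.\<close>

lemma positive_functional_hermitian:
  assumes f: "positive_functional M f" and M: "star_closed M" and x: "x \<in> M" and y: "y \<in> M"
  shows "f (star y * x) = cnj (f (star x * y))"
proof -
  note cl = star_closedD[OF M] and fD = positive_functionalD[OF f]
  have ex: "f (star (x + scaleC s y) * (x + scaleC s y)) =
      f (star x * x) + s * f (star x * y) + cnj s * f (star y * x) + cnj s * s * f (star y * y)" for s
  proof -
    have "star (x + scaleC s y) * (x + scaleC s y) =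
      star x * x + scaleC s (star x * y) + scaleC (cnj s) (star y * x) + scaleC (cnj s * s) (star y * y)"
      by (simp add: star_add star_scaleC algebra_simps mult_scaleC_left mult_scaleC_right scaleC_scaleC
          scaleC_add_right)
    then show ?thesis using x y by (simp add: fD(1,2) cl)
  qed
  have im: "Im (f (star w * w)) = 0" if "w \<in> M" for w using fD(3)[OF that] .
  have "Im (f (star x * y) + f (star y * x)) = 0"
    using im[of "x + scaleC 1 y"] ex[of 1] im[OF x] im[OF y] x y cl(2)[OF x y] by simp
  moreover have "Re (f (star x * y)) = Re (f (star y * x))"
    using im[of "x + scaleC \<i> y"] ex[of \<i>] im[OF x] im[OF y] cl(2)[OF x cl(5)[OF y]] by simp
  ultimately show ?thesis by (simp add: complex_eq_iff)
qed

lemma positive_functional_Cauchy_Schwarz: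
  assumes f: "positive_functional M f" and M: "star_closed M" and x: "x \<in> M" and y: "y \<in> M"
  shows "(cmod (f (star y * x)))\<^sup>2 \<le> Re (f (star x * x)) * Re (f (star y * y))"
proof -
  note cl = star_closedD[OF M] and fD = positive_functionalD[OF f]
  define a b c where "a = Re (f (star x * x))" and "b = Re (f (star y * y))"
    and "c = f (star y * x)"
  have fc: "f (star x * y) = cnj c"
    unfolding c_def by (rule positive_functional_hermitian[OF f M y x])
  have fx: "f (star x * x) = a" and fy: "f (star y * y) = b"
    using fD(3)[OF x] fD(3)[OF y] by (auto simp: complex_eq_iff a_def b_def)
  have pos: "0 \<le> a - 2 * t * (cmod c)\<^sup>2 + t\<^sup>2 * (cmod c)\<^sup>2 * b" for t :: real
  proof -
    \<comment> \<open>This phase makes both cross terms real and equal, so that positivity becomes a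
      quadratic inequality in the real parameter \<open>t\<close>.\<close>
    define s where "s = - complex_of_real t * c"
    have "star (x + scaleC s y) * (x + scaleC s y) =
      star x * x + scaleC s (star x * y) + scaleC (cnj s) (star y * x) + scaleC (cnj s * s) (star y * y)"
      by (simp add: star_add star_scaleC algebra_simps mult_scaleC_left mult_scaleC_right scaleC_scaleC
          scaleC_add_right)
    then have "f (star (x + scaleC s y) * (x + scaleC s y)) = a + s * cnj c + cnj s * c + cnj s * s * b"
      using x y by (simp add: fD(1,2) cl fx fy fc c_def[symmetric])
    also have "\<dots> = a - 2 * t * (c * cnj c) + (complex_of_real t)\<^sup>2 * (c * cnj c) * b"
      by (simp add: s_def algebra_simps power2_eq_square)
    also have "\<dots> = complex_of_real (a - 2 * t * (cmod c)\<^sup>2 + t\<^sup>2 * (cmod c)\<^sup>2 * b)"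
      by (simp add: complex_norm_square[symmetric])
    finally show ?thesis
      using fD(4)[OF cl(2)[OF x cl(5)[OF y, of s]]] by simp
  qed
  have b0: "0 \<le> b" and a0: "0 \<le> a" using fD(4) x y by (auto simp: a_def b_def)
  have "(cmod c)\<^sup>2 \<le> a * b"
  proof (cases "b = 0")
    case True
    show ?thesis
    proof (rule ccontr)
      assume "\<not> ?thesis"
      then have c: "(cmod c)\<^sup>2 > 0" using True by simp
      \<comment> \<open>For \<open>b = 0\<close> the inequality is affine in \<open>t\<close>; this
        choice of \<open>t\<close> gives the negative value \<open>- a - 2\<close>.\<close>
      have "a - 2 * ((a + 1) / (cmod c)\<^sup>2) * (cmod c)\<^sup>2 \<ge> 0"
        using pos[of "(a + 1) / (cmod c)\<^sup>2"] True by simp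
      then show False using c a0 by simp
    qed
  next
    case False
    then have "0 \<le> a - (cmod c)\<^sup>2 / b" using pos[of "1 / b"] by (simp add: field_simps power2_eq_square)
    then show ?thesis using False b0 by (simp add: field_simps)
  qed
  then show ?thesis by (simp add: a_def b_def c_def)
qed

text \<open>\<open>y = 1 - s\<close> solves \<open>y = (h + y\<^sup>2) / 2\<close>, a contraction on a small ball.\<close>

lemma sqrt_one_minus:
  fixes M :: "'a::cstar_algebra set"
  assumes M: "cstar_subalgebra M" and h: "h \<in> M" "star h = h" "norm h < 1"
  shows "\<exists>s\<in>M. star s = s \<and> s * s = 1 - h"
proof -
  note cl = star_closedD[OF cstar_subalgebra_star_closed[OF M]]
  have scR: "r *\<^sub>R x \<in> M" if "x \<in> M" for r x using cl(5)[OF that, of "complex_of_real r"] by (simp add: scaleC_of_real)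
  \<comment> \<open>The smaller root of \<open>2 r - r^2 = norm h\<close>: with it \<open>g\<close>
    maps the ball of radius \<open>r\<close> into itself and has Lipschitz constant
    \<open>r < 1\<close>.\<close>
  define r where "r = 1 - sqrt (1 - norm h)"
  have r: "0 \<le> r" "r < 1" using h by (auto simp: r_def)
  have hr: "norm h = 2 * r - r\<^sup>2"
    using h(3) by (simp add: r_def power2_eq_square algebra_simps)
  define B where "B = {y \<in> M. star y = y \<and> norm y \<le> r}"
  define g where "g = (\<lambda>y. (1/2) *\<^sub>R (h + y * y))"
  have "closed B"
  proof -
    have "closed {y::'a. star y = y}"
      by (intro closed_Collect_eq continuous_intros linear_continuous_on bounded_linear_star)
    moreover have "closed {y::'a. norm y \<le> r}" by (intro closed_Collect_le continuous_intros)
    moreover have "B = M \<inter> {y. star y = y} \<inter> {y. norm y \<le> r}" by (auto simp: B_def)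
    ultimately show ?thesis using M by (auto simp: cstar_subalgebra_def)
  qed
  then have comp: "complete B" by (simp add: complete_eq_closed)
  have ne: "B \<noteq> {}" using r cl(1) by (auto simp: B_def intro!: exI[of _ 0])
  have gB: "g ` B \<subseteq> B"
  proof
    fix w assume "w \<in> g ` B"
    then obtain y where y: "y \<in> M" "star y = y" "norm y \<le> r" "w = g y" by (auto simp: B_def)
    have "norm (y * y) \<le> r * r"
      by (rule order_trans[OF norm_mult_ineq]) (use y r in \<open>auto intro: mult_mono\<close>)
    then have "norm (h + y * y) \<le> 2 * r"
      using norm_triangle_ineq[of h "y * y"] hr by (simp add: power2_eq_square)
    then have "norm w \<le> r" by (simp add: y g_def)
    moreover have "star w = w"
      using bounded_linear.linear[OF bounded_linear_star, THEN linear_scale, of "1/2" "h + y * y"]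
      by (simp add: y g_def star_add star_mult h)
    moreover have "w \<in> M" using y h cl by (simp add: g_def scR)
    ultimately show "w \<in> B" by (simp add: B_def)
  qed
  have lip: "dist (g x) (g y) \<le> r * dist x y" if "x \<in> B" "y \<in> B" for x y
  proof -
    have "x * x - y * y = x * (x - y) + (x - y) * y" by (simp add: algebra_simps)
    then have "norm (x * x - y * y) \<le> norm (x * (x - y)) + norm ((x - y) * y)"
      by (simp only: norm_triangle_ineq)
    also have "\<dots> \<le> norm x * norm (x - y) + norm (x - y) * norm y"
      by (intro add_mono norm_mult_ineq)
    also have "\<dots> \<le> r * norm (x - y) + norm (x - y) * r"
      using that by (intro add_mono mult_mono) (auto simp: B_def r)
    finally have "norm (x * x - y * y) \<le> 2 * (r * norm (x - y))" by simp
    moreover have "g x - g y = (1/2) *\<^sub>R (x * x - y * y)" by (simp add: g_def algebra_simps)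
    ultimately show ?thesis by (simp add: dist_norm)
  qed
  have "\<exists>!y\<in>B. g y = y"
    by (rule Banach_fix[OF comp ne r gB]) (use lip in auto)
  then obtain y where y: "y \<in> B" "g y = y" by auto
  have "h + y * y = 2 *\<^sub>R y" using arg_cong[OF y(2), of "\<lambda>u. 2 *\<^sub>R u"] by (simp add: g_def)
  then have "(1 - y) * (1 - y) = 1 - h" by (simp add: algebra_simps scaleR_2)
  moreover have "1 - y \<in> M" using y M cl by (auto simp: B_def cstar_subalgebra_def)
  moreover have "star (1 - y) = 1 - y" using y by (simp add: B_def star_diff)
  ultimately show ?thesis by blast
qed

text \<open>For self-adjoint \<open>h\<close> of norm below 1 the element \<open>1 - h\<close> is a
  square of a self-adjoint one, which bounds \<open>f h\<close> by \<open>f 1\<close>. Scaling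
  covers all self-adjoint elements, and Cauchy-Schwarz against 1 reduces \<open>x\<close> to
  \<open>star x * x\<close>.\<close>

lemma positive_functional_bound:
  fixes M :: "'a::cstar_algebra set"
  assumes f: "positive_functional M f" and M: "cstar_subalgebra M" and x: "x \<in> M"
  shows "cmod (f x) \<le> Re (f 1) * norm x"
proof -
  have M': "star_closed M" by (rule cstar_subalgebra_star_closed[OF M])
  note cl = star_closedD[OF M'] and fD = positive_functionalD[OF f]
  have one: "1 \<in> M" using M by (simp add: cstar_subalgebra_def)
  have f1: "Re (f 1) \<ge> 0" using fD(4)[OF one] by simp
  have lt: "Re (f h) \<le> Re (f 1)" if h: "h \<in> M" "star h = h" "norm h < 1" for h
  proof -
    obtain s where s: "s \<in> M" "star s = s" "s * s = 1 - h" using sqrt_one_minus[OF M h] by auto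
    have "0 \<le> Re (f (1 - h))" using fD(4)[OF s(1)] s by simp
    then show ?thesis using positive_functional_diff[OF f M' one h(1)] by simp
  qed
  have sa: "Re (f h) \<le> Re (f 1) * norm h" if h: "h \<in> M" "star h = h" for h
  proof (rule field_le_epsilon)
    fix e :: real assume e: "e > 0"
    \<comment> \<open>Slightly more than \<open>norm h\<close>, so that \<open>h / k\<close> lies in
      the open unit ball; the summand 1 keeps the denominator positive when \<open>f 1 = 0\<close>,
      and the excess costs at most \<open>e\<close>.\<close>
    define k where "k = norm h + e / (Re (f 1) + 1)"
    have ek: "e / (Re (f 1) + 1) > 0" using e f1 by (intro divide_pos_pos) auto
    have k: "k > norm h" "k > 0" using ek norm_ge_zero[of h] unfolding k_def by linarith+
    have "Re (f (scaleC (1 / complex_of_real k) h)) \<le> Re (f 1)"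
    proof (rule lt)
      show "star (scaleC (1 / complex_of_real k) h) = scaleC (1 / complex_of_real k) h"
        by (simp add: star_scaleC h)
      show "norm (scaleC (1 / complex_of_real k) h) < 1" using k by (simp add: norm_scaleC norm_divide)
    qed (use cl h in auto)
    then have "Re (f h) / k \<le> Re (f 1)" using fD(2)[OF h(1)] by (simp add: Re_divide_of_real)
    then have "Re (f h) \<le> Re (f 1) * k" using k by (simp add: field_simps)
    also have "\<dots> = Re (f 1) * norm h + e * (Re (f 1) / (Re (f 1) + 1))"
      by (simp add: k_def algebra_simps)
    also have "\<dots> \<le> Re (f 1) * norm h + e * 1"
      using e f1 by (intro add_left_mono mult_left_mono) (auto simp: field_simps)
    finally show "Re (f h) \<le> Re (f 1) * norm h + e" by simp
  qed
  have "(cmod (f x))\<^sup>2 \<le> Re (f (star x * x)) * Re (f 1)"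
    using positive_functional_Cauchy_Schwarz[OF f M' x one] by simp
  also have "\<dots> \<le> (Re (f 1) * norm (star x * x)) * Re (f 1)"
    using x f1 cl by (intro mult_right_mono sa) (auto simp: star_mult star_star)
  also have "\<dots> = (Re (f 1) * norm x)\<^sup>2"
    by (simp add: norm_star_mult_self power2_eq_square)
  finally show ?thesis using f1 by (auto intro: power2_le_imp_le)
qed

section \<open>Complex matrices\<close>

lemma mat_trace_mult_comm:
  fixes A B :: "complex mat"
  assumes "A \<in> carrier_mat n m" "B \<in> carrier_mat m n"
  shows "mat_trace (A * B) = mat_trace (B * A)"
proof -
  have "mat_trace (A * B) = (\<Sum>i<n. \<Sum>k<m. A $$ (i, k) * B $$ (k, i))"
    using assms by (auto simp: mat_trace_def scalar_prod_def atLeast0LessThan intro!: sum.cong)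
  also have "\<dots> = (\<Sum>k<m. \<Sum>i<n. B $$ (k, i) * A $$ (i, k))"
    by (subst sum.swap) (simp add: mult.commute)
  also have "\<dots> = mat_trace (B * A)"
    using assms by (auto simp: mat_trace_def scalar_prod_def atLeast0LessThan intro!: sum.cong)
  finally show ?thesis .
qed

lemma schur_triangularization:
  fixes A :: "complex mat"
  assumes A: "A \<in> carrier_mat n n"
  obtains T P Q where "similar_mat_wit A T P Q" "upper_triangular T"
proof -
  obtain es where "char_poly A = (\<Prod>e\<leftarrow>es. [:- e, 1:])" using char_poly_factorized[OF A] by auto
  from schur_decomposition[OF A this] show ?thesis
    using that by (cases "schur_decomposition A es") auto
qed

lemma upper_triangular_mult_diag:
  fixes T :: "complex mat"
  assumes T: "T \<in> carrier_mat n n" "upper_triangular T" and i: "i < n"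
  shows "(T * T) $$ (i, i) = T $$ (i, i) * T $$ (i, i)"
proof -
  have "(T * T) $$ (i, i) = (\<Sum>k<n. T $$ (i, k) * T $$ (k, i))"
    using T i by (auto simp: scalar_prod_def atLeast0LessThan intro!: sum.cong)
  also have "\<dots> = (\<Sum>k<n. if k = i then T $$ (i, i) * T $$ (i, i) else 0)"
  proof (rule sum.cong)
    fix k assume "k \<in> {..<n}"
    then show "T $$ (i, k) * T $$ (k, i) = (if k = i then T $$ (i, i) * T $$ (i, i) else 0)"
      using upper_triangularD[OF T(2), of k i] upper_triangularD[OF T(2), of i k] T(1) i
      by (cases "k < i"; cases "i < k") auto
  qed simp
  also have "\<dots> = T $$ (i, i) * T $$ (i, i)" using i by simp
  finally show ?thesis .
qed

text \<open>The triangular form of an idempotent is idempotent, so its diagonal entries are 0 or 1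
  and the trace counts the ones. The integrality of the connecting maps rests on this.\<close>

lemma mat_trace_idempotent:
  fixes A :: "complex mat"
  assumes A: "A \<in> carrier_mat n n" and idem: "A * A = A"
  shows "\<exists>k::nat. mat_trace A = of_nat k"
proof -
  obtain T P Q where sim: "similar_mat_wit A T P Q" and ut: "upper_triangular T"
    by (rule schur_triangularization[OF A])
  note w = similar_mat_witD2[OF A sim]
  have T: "T = Q * A * P" and TT: "T * T = T"
  proof -
    have "Q * A * P = (Q * P) * T * (Q * P)"
      using w(4-7) unfolding w(3) by (simp add: assoc_mult_mat[of _ n n _ n _ n])
    then show T: "T = Q * A * P" using w by simp
    have "T * T = Q * (A * (P * Q) * A) * P"
      unfolding T using w(4-7) A by (simp add: assoc_mult_mat[of _ n n _ n _ n])
    then show "T * T = T" using w(1) A idem T by simp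
  qed
  have "mat_trace A = mat_trace (P * (T * Q))"
    using w by (metis assoc_mult_mat)
  also have "\<dots> = mat_trace ((T * Q) * P)"
    by (rule mat_trace_mult_comm) (use w in auto)
  also have "(T * Q) * P = T" using w by (simp add: assoc_mult_mat[of _ n n _ n _ n])
  finally have tr: "mat_trace A = (\<Sum>i<n. T $$ (i, i))" using w by (simp add: mat_trace_def)
  have "T $$ (i, i) = of_nat (if T $$ (i, i) = 1 then 1 else 0)" if "i < n" for i
    using upper_triangular_mult_diag[OF w(5) ut that] TT by auto
  then have "mat_trace A = (\<Sum>i<n. of_nat (if T $$ (i, i) = 1 then 1 else 0))"
    unfolding tr by (intro sum.cong) auto
  also have "\<dots> = of_nat (\<Sum>i<n. if T $$ (i, i) = 1 then 1 else 0)" by (simp only: of_nat_sum)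
  finally show ?thesis by blast
qed

section \<open>Annihilating products of linear factors (Cayley-Hamilton)\<close>

definition linear_factors :: "complex mat \<Rightarrow> complex list \<Rightarrow> complex mat" where
  "linear_factors A ls = foldl (\<lambda>X l. X * (A + (- l) \<cdot>\<^sub>m 1\<^sub>m (dim_row A))) (1\<^sub>m (dim_row A)) ls"

lemma linear_factors_simps:
  "linear_factors A [] = 1\<^sub>m (dim_row A)"
  "linear_factors A (ls @ [l]) = linear_factors A ls * (A + (- l) \<cdot>\<^sub>m 1\<^sub>m (dim_row A))"
  by (auto simp: linear_factors_def)

lemma linear_factors_carrier: "A \<in> carrier_mat n n \<Longrightarrow> linear_factors A ls \<in> carrier_mat n n"
  by (induction ls rule: rev_induct) (auto simp: linear_factors_simps)

text \<open>The factor \<open>T - T_kk\<close> maps the span of the first \<open>k + 1\<close> basis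
  vectors into the span of the first \<open>k\<close>, so each further factor makes one more column
  of the product vanish.\<close>

lemma linear_factors_upper_triangular:
  fixes T :: "complex mat"
  assumes T: "T \<in> carrier_mat n n" "upper_triangular T"
  shows "k \<le> n \<Longrightarrow> i < n \<Longrightarrow> j < k \<Longrightarrow>
    linear_factors T (map (\<lambda>m. T $$ (m, m)) [0..<k]) $$ (i, j) = 0"
proof (induction k arbitrary: i j)
  case (Suc k)
  define L where "L = linear_factors T (map (\<lambda>m. T $$ (m, m)) [0..<k])"
  have L: "L \<in> carrier_mat n n" unfolding L_def by (rule linear_factors_carrier[OF T(1)])
  define U where "U = T + (- T $$ (k, k)) \<cdot>\<^sub>m 1\<^sub>m n"
  have U: "U \<in> carrier_mat n n" using T by (simp add: U_def)
  have Uij: "U $$ (l, j) = 0" if "l < n" "l \<ge> k" for l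
  proof (cases "l = j")
    case True
    then have "j = k" using that Suc.prems by simp
    then show ?thesis using True that T(1) by (simp add: U_def)
  next
    case False
    then have "j < l" using that Suc.prems by simp
    then show ?thesis using that upper_triangularD[OF T(2), of j l] T(1) by (simp add: U_def)
  qed
  have "linear_factors T (map (\<lambda>m. T $$ (m, m)) [0..<Suc k]) $$ (i, j) = (L * U) $$ (i, j)"
    using T by (simp add: linear_factors_simps L_def U_def)
  also have "\<dots> = (\<Sum>l<n. L $$ (i, l) * U $$ (l, j))"
    using L U Suc.prems by (auto simp: scalar_prod_def atLeast0LessThan intro!: sum.cong)
  also have "\<dots> = 0"
  proof (intro sum.neutral ballI)
    fix l assume l: "l \<in> {..<n}"
    show "L $$ (i, l) * U $$ (l, j) = 0"
    proof (cases "l < k")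
      case True
      then show ?thesis using Suc.IH[of i l] Suc.prems by (simp add: L_def)
    qed (use Uij[of l] l in auto)
  qed
  finally show ?case .
qed simp

lemma linear_factors_similar:
  fixes A :: "complex mat"
  assumes A: "A \<in> carrier_mat n n" and sim: "similar_mat_wit A T P Q"
  shows "linear_factors A ls = P * linear_factors T ls * Q"
proof -
  note w = similar_mat_witD2[OF A sim]
  show ?thesis
  proof (induction ls rule: rev_induct)
    case Nil
    then show ?case using w by (simp add: linear_factors_simps)
  next
    case (snoc l ls)
    have L: "linear_factors T ls \<in> carrier_mat n n" by (rule linear_factors_carrier[OF w(5)])
    have e: "A + (- l) \<cdot>\<^sub>m 1\<^sub>m n = P * (T + (- l) \<cdot>\<^sub>m 1\<^sub>m n) * Q"
    proof -
      have "P * (T + (- l) \<cdot>\<^sub>m 1\<^sub>m n) * Q = (P * T + (- l) \<cdot>\<^sub>m P) * Q"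
        using w by (subst mult_add_distrib_mat[of _ n n _ n])
          (auto simp: mult_smult_distrib[of _ n n _ n])
      also have "\<dots> = P * T * Q + (- l) \<cdot>\<^sub>m (P * Q)"
        using w(4-7) by (subst add_mult_distrib_mat[of _ n n _ _ n])
          (auto simp: mult_smult_assoc_mat[of _ n n _ n])
      finally show ?thesis using w by simp
    qed
    define L' U where "L' = linear_factors T ls" and "U = T + (- l) \<cdot>\<^sub>m 1\<^sub>m n"
    have LU: "L' \<in> carrier_mat n n" "U \<in> carrier_mat n n" using L w by (auto simp: L'_def U_def)
    have "linear_factors A (ls @ [l]) = P * L' * Q * (P * U * Q)"
      using w A snoc.IH e by (simp add: linear_factors_simps L'_def U_def)
    also have "\<dots> = P * L' * (Q * P) * (U * Q)"
      using w(4-7) LU by (simp add: assoc_mult_mat[of _ n n _ n _ n])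
    also have "\<dots> = P * (L' * U) * Q"
      using w LU by (simp add: assoc_mult_mat[of _ n n _ n _ n])
    finally show ?case using w by (simp add: linear_factors_simps L'_def U_def)
  qed
qed

lemma linear_factors_eq_zero:
  fixes A :: "complex mat"
  assumes A: "A \<in> carrier_mat n n"
  shows "\<exists>ls. linear_factors A ls = 0\<^sub>m n n"
proof -
  obtain T P Q where sim: "similar_mat_wit A T P Q" and ut: "upper_triangular T"
    by (rule schur_triangularization[OF A])
  note w = similar_mat_witD2[OF A sim]
  define ls where "ls = map (\<lambda>m. T $$ (m, m)) [0..<n]"
  have "linear_factors T ls = 0\<^sub>m n n"
    using linear_factors_upper_triangular[OF w(5) ut, of n] linear_factors_carrier[OF w(5), of ls]
    by (intro eq_matI) (auto simp: ls_def)
  then have "linear_factors A ls = 0\<^sub>m n n"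
    using linear_factors_similar[OF A sim, of ls] w by simp
  then show ?thesis ..
qed

section \<open>A full matrix corner\<close>

text \<open>One summand by itself, detached from any inductive system, so that the results can be
  used on two levels at once in \<open>corner_pair\<close>.\<close>

locale matrix_corner =
  fixes M :: "'a::cstar_algebra set" and z :: 'a and d :: nat and \<pi> :: "'a \<Rightarrow> complex mat"
  assumes M: "cstar_subalgebra M" and zM: "z \<in> M" and zz: "z * z = z" and zs: "star z = z"
    and zc: "\<And>x. x \<in> M \<Longrightarrow> x * z = z * x" and z0: "z \<noteq> 0"
    and rep: "matrix_representation z M d \<pi>"
begin

abbreviation "zMz \<equiv> corner z M"

lemmas Mcl = star_closedD[OF cstar_subalgebra_star_closed[OF M]]

lemma mem_corner: "x \<in> zMz \<longleftrightarrow> x \<in> M \<and> z * x = x"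
proof
  assume "x \<in> zMz"
  then show "x \<in> M \<and> z * x = x"
    using zM Mcl(3) by (auto simp: corner_def mult.assoc[symmetric] zz)
next
  assume "x \<in> M \<and> z * x = x"
  then show "x \<in> zMz" by (metis corner_def image_eqI)
qed

lemma corner_zero: "z * x = x" "x * z = x" if "x \<in> zMz" for x
  using that mem_corner zc by auto

lemma z_mult_corner: "x \<in> M \<Longrightarrow> z * x \<in> zMz" by (auto simp: corner_def)

lemma z_corner: "z \<in> zMz" using zM zz by (simp add: mem_corner)

lemma corner_closed: "star_closed zMz"
  unfolding star_closed_def
proof (intro conjI ballI allI)
  show "0 \<in> zMz" by (simp add: mem_corner Mcl)
  fix x assume x: "x \<in> zMz"
  show "star x \<in> zMz"
    using x zs zc[of "star x"] star_mult[of z x] by (auto simp: mem_corner Mcl)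
  show "scaleC c x \<in> zMz" for c using x by (auto simp: mem_corner Mcl mult_scaleC_right)
  fix y assume y: "y \<in> zMz"
  show "x + y \<in> zMz" using x y by (auto simp: mem_corner Mcl distrib_left)
  show "x * y \<in> zMz" using x y by (auto simp: mem_corner Mcl mult.assoc[symmetric])
qed

lemmas ccl = star_closedD[OF corner_closed]

lemma corner_ideal: "x \<in> zMz \<Longrightarrow> y \<in> M \<Longrightarrow> x * y \<in> zMz" "x \<in> zMz \<Longrightarrow> y \<in> M \<Longrightarrow> y * x \<in> zMz"
proof -
  assume x: "x \<in> zMz" and y: "y \<in> M"
  then show "x * y \<in> zMz" by (auto simp: mem_corner Mcl mult.assoc[symmetric])
  have "z * (y * x) = y * (z * x)" using y zc by (metis mult.assoc)
  then show "y * x \<in> zMz" using x y by (auto simp: mem_corner Mcl)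
qed

definition co :: "'a \<Rightarrow> nat \<Rightarrow> nat \<Rightarrow> complex" where
  "co x i j = \<pi> x $$ (i, j)"

definition tr :: "'a \<Rightarrow> complex" where
  "tr x = mat_trace (\<pi> x)"

lemma rep_carrier: "x \<in> zMz \<Longrightarrow> \<pi> x \<in> carrier_mat d d"
  using rep by (auto simp: matrix_representation_def bij_betw_def)

lemma rep_dims: "x \<in> zMz \<Longrightarrow> dim_row (\<pi> x) = d" "x \<in> zMz \<Longrightarrow> dim_col (\<pi> x) = d"
  using rep_carrier by auto

lemma rep_inj: "inj_on \<pi> zMz"
  using rep by (auto simp: matrix_representation_def bij_betw_def)

lemma rep_add: "x \<in> zMz \<Longrightarrow> y \<in> zMz \<Longrightarrow> \<pi> (x + y) = \<pi> x + \<pi> y"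
  and rep_mult: "x \<in> zMz \<Longrightarrow> y \<in> zMz \<Longrightarrow> \<pi> (x * y) = \<pi> x * \<pi> y"
  and rep_star: "x \<in> zMz \<Longrightarrow> \<pi> (star x) = mat_adjoint (\<pi> x)"
  and rep_scaleC: "x \<in> zMz \<Longrightarrow> \<pi> (scaleC c x) = c \<cdot>\<^sub>m \<pi> x"
  using rep by (auto simp: matrix_representation_def)

lemma co_add: "x \<in> zMz \<Longrightarrow> y \<in> zMz \<Longrightarrow> i < d \<Longrightarrow> j < d \<Longrightarrow> co (x + y) i j = co x i j + co y i j"
  by (simp add: co_def rep_add rep_dims)

lemma co_scaleC: "x \<in> zMz \<Longrightarrow> i < d \<Longrightarrow> j < d \<Longrightarrow> co (scaleC c x) i j = c * co x i j"
  by (simp add: co_def rep_scaleC rep_dims)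

lemma co_zero: "i < d \<Longrightarrow> j < d \<Longrightarrow> co 0 i j = 0"
  using co_scaleC[of 0 i j 0] ccl(1) by simp

lemma co_sum: "(\<And>k. k \<in> I \<Longrightarrow> g k \<in> zMz) \<Longrightarrow> i < d \<Longrightarrow> j < d \<Longrightarrow>
    co (\<Sum>k\<in>I. g k) i j = (\<Sum>k\<in>I. co (g k) i j)"
  by (induction I rule: infinite_finite_induct) (auto simp: co_zero co_add ccl)

lemma co_mult: "x \<in> zMz \<Longrightarrow> y \<in> zMz \<Longrightarrow> i < d \<Longrightarrow> j < d \<Longrightarrow>
    co (x * y) i j = (\<Sum>k<d. co x i k * co y k j)"
  by (auto simp: co_def rep_mult rep_dims scalar_prod_def atLeast0LessThan intro!: sum.cong)

lemma co_star: "x \<in> zMz \<Longrightarrow> i < d \<Longrightarrow> j < d \<Longrightarrow> co (star x) i j = cnj (co x j i)"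
  by (simp add: co_def rep_star rep_dims mat_adjoint_def mat_of_rows_def)

lemma co_eqI:
  assumes "x \<in> zMz" "y \<in> zMz" "\<And>i j. i < d \<Longrightarrow> j < d \<Longrightarrow> co x i j = co y i j"
  shows "x = y"
proof -
  have "\<pi> x = \<pi> y" using assms by (intro eq_matI) (auto simp: rep_dims co_def)
  then show ?thesis using rep_inj assms by (auto simp: inj_on_def)
qed

lemma co_surj: "\<exists>x\<in>zMz. \<forall>i<d. \<forall>j<d. co x i j = h i j"
proof -
  have "Matrix.mat d d (\<lambda>(i, j). h i j) \<in> \<pi> ` zMz"
    using rep by (simp add: matrix_representation_def bij_betw_def)
  then obtain x where x: "x \<in> zMz" "Matrix.mat d d (\<lambda>(i, j). h i j) = \<pi> x" by auto
  then have "\<forall>i<d. \<forall>j<d. co x i j = h i j" by (simp add: co_def flip: x(2))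
  then show ?thesis using x by blast
qed

lemma d_pos: "d > 0"
proof (rule ccontr)
  assume "\<not> d > 0"
  then have "z = 0" using co_eqI[OF z_corner ccl(1)] by auto
  then show False using z0 by simp
qed

definition unit :: "nat \<Rightarrow> nat \<Rightarrow> 'a" where
  "unit i j = (SOME x. x \<in> zMz \<and> (\<forall>k<d. \<forall>l<d. co x k l = (if k = i \<and> l = j then 1 else 0)))"

lemma unit: "unit i j \<in> zMz" "k < d \<Longrightarrow> l < d \<Longrightarrow> co (unit i j) k l = (if k = i \<and> l = j then 1 else 0)"
proof -
  have "\<exists>x. x \<in> zMz \<and> (\<forall>k<d. \<forall>l<d. co x k l = (if k = i \<and> l = j then 1 else 0))"
    using co_surj[of "\<lambda>k l. if k = i \<and> l = j then 1 else 0"] by blast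
  from someI_ex[OF this] show "unit i j \<in> zMz"
    "k < d \<Longrightarrow> l < d \<Longrightarrow> co (unit i j) k l = (if k = i \<and> l = j then 1 else 0)"
    by (auto simp: unit_def)
qed

lemma unit_mult:
  assumes "i < d" "j < d" "k < d" "l < d"
  shows "unit i j * unit k l = (if j = k then unit i l else 0)"
proof (rule co_eqI)
  show "unit i j * unit k l \<in> zMz" "(if j = k then unit i l else 0) \<in> zMz"
    by (auto simp: unit ccl)
  fix a b assume ab: "a < d" "b < d"
  have "co (unit i j * unit k l) a b =
      (\<Sum>m<d. (if a = i \<and> m = j then 1 else 0) * (if m = k \<and> b = l then 1 else 0))"
    using ab by (simp add: co_mult unit)
  also have "\<dots> = (\<Sum>m<d. if m = j then (if a = i \<and> j = k \<and> b = l then 1 else 0) else 0)"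
    by (rule sum.cong) auto
  also have "\<dots> = (if a = i \<and> j = k \<and> b = l then 1 else 0)" using assms by simp
  finally show "co (unit i j * unit k l) a b = co (if j = k then unit i l else 0) a b"
    using ab by (simp add: unit co_zero)
qed

lemma expansion:
  assumes x: "x \<in> zMz"
  shows "x = (\<Sum>i<d. \<Sum>j<d. scaleC (co x i j) (unit i j))"
proof (rule co_eqI[OF x])
  show "(\<Sum>i<d. \<Sum>j<d. scaleC (co x i j) (unit i j)) \<in> zMz"
    by (intro ccl(8) ccl(5) unit)
  fix a b assume ab: "a < d" "b < d"
  have "co (\<Sum>i<d. \<Sum>j<d. scaleC (co x i j) (unit i j)) a b =
      (\<Sum>i<d. \<Sum>j<d. co x i j * (if a = i \<and> b = j then 1 else 0))"
    using ab by (simp add: co_sum co_scaleC unit ccl)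
  also have "\<dots> = (\<Sum>i<d. if a = i then co x i b else 0)"
    using ab by (intro sum.cong) (auto simp: if_distrib cong: if_cong)
  also have "\<dots> = co x a b" using ab by simp
  finally show "co x a b = co (\<Sum>i<d. \<Sum>j<d. scaleC (co x i j) (unit i j)) a b" by simp
qed

text \<open>\<open>matrix_representation\<close> does not say that \<open>z\<close> goes to the
  identity matrix. It follows because the preimage \<open>u\<close> of that matrix satisfies both
  \<open>z * u = z\<close> and \<open>z * u = u\<close>.\<close>

lemma co_z: "i < d \<Longrightarrow> j < d \<Longrightarrow> co z i j = (if i = j then 1 else 0)"
proof -
  obtain u where u: "u \<in> zMz" "\<forall>i<d. \<forall>j<d. co u i j = (if i = j then 1 else 0)"
    using co_surj[of "\<lambda>i j. if i = j then 1 else 0"] by blast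
  have "z * u = z"
  proof (rule co_eqI)
    fix i j assume "i < d" "j < d"
    then show "co (z * u) i j = co z i j"
      using u by (simp add: co_mult z_corner if_distrib[of "\<lambda>t. _ * t"] cong: if_cong)
  qed (use u z_corner ccl in auto)
  then have "z = u" using corner_zero u by auto
  then show "i < d \<Longrightarrow> j < d \<Longrightarrow> co z i j = (if i = j then 1 else 0)" using u by auto
qed

lemma tr_eq: "x \<in> zMz \<Longrightarrow> tr x = (\<Sum>i<d. co x i i)"
  by (simp add: tr_def mat_trace_def co_def rep_dims)

lemma tr_add: "x \<in> zMz \<Longrightarrow> y \<in> zMz \<Longrightarrow> tr (x + y) = tr x + tr y"
  by (simp add: tr_eq ccl co_add sum.distrib)

lemma tr_scaleC: "x \<in> zMz \<Longrightarrow> tr (scaleC c x) = c * tr x"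
  by (simp add: tr_eq ccl co_scaleC sum_distrib_left)

lemma tr_zero: "tr 0 = 0"
  by (simp add: tr_eq ccl co_zero)

lemma tr_sum: "(\<And>k. k \<in> I \<Longrightarrow> g k \<in> zMz) \<Longrightarrow> tr (\<Sum>k\<in>I. g k) = (\<Sum>k\<in>I. tr (g k))"
  by (induction I rule: infinite_finite_induct) (auto simp: tr_zero tr_add ccl)

lemma tr_comm: "x \<in> zMz \<Longrightarrow> y \<in> zMz \<Longrightarrow> tr (x * y) = tr (y * x)"
  unfolding tr_def by (simp add: rep_mult mat_trace_mult_comm[of _ d d] rep_carrier)

lemma tr_z: "tr z = of_nat d"
  by (simp add: tr_eq z_corner co_z)

lemma tr_unit: "i < d \<Longrightarrow> tr (unit i i) = 1"
  by (simp add: tr_eq unit)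

lemma tr_star_self:
  assumes x: "x \<in> zMz"
  shows "tr (star x * x) = complex_of_real (\<Sum>i<d. \<Sum>k<d. (cmod (co x k i))\<^sup>2)"
  using x by (simp add: tr_eq ccl co_mult co_star mult.commute[of "cnj _"] flip: complex_norm_square)

lemma tr_star_pos: "x \<in> zMz \<Longrightarrow> Im (tr (star x * x)) = 0" "x \<in> zMz \<Longrightarrow> 0 \<le> Re (tr (star x * x))"
  by (auto simp: tr_star_self intro!: sum_nonneg)

lemma tr_star_self_eq_0:
  assumes "x \<in> zMz" "tr (star x * x) = 0"
  shows "x = 0"
proof (rule co_eqI)
  fix i j assume ij: "i < d" "j < d"
  have "(\<Sum>i<d. \<Sum>k<d. (cmod (co x k i))\<^sup>2) = 0"
    using assms tr_star_self by (metis of_real_eq_0_iff)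
  then have "(cmod (co x i j))\<^sup>2 = 0"
    using ij by (simp add: sum_nonneg_eq_0_iff sum_nonneg)
  then show "co x i j = co 0 i j" using ij by (simp add: co_zero)
qed (use assms ccl in auto)

lemma tr_idempotent: "x \<in> zMz \<Longrightarrow> x * x = x \<Longrightarrow> \<exists>k::nat. tr x = of_nat k"
  unfolding tr_def using mat_trace_idempotent[OF rep_carrier] rep_mult by metis

text \<open>The trace property kills the off-diagonal matrix units and identifies all diagonal ones,
  which leaves a single constant.\<close>

lemma tracial_unique:
  assumes add: "\<And>x y. x \<in> zMz \<Longrightarrow> y \<in> zMz \<Longrightarrow> g (x + y) = g x + g y"
    and scale: "\<And>c x. x \<in> zMz \<Longrightarrow> g (scaleC c x) = c * (g x :: complex)"
    and comm: "\<And>x y. x \<in> zMz \<Longrightarrow> y \<in> zMz \<Longrightarrow> g (x * y) = g (y * x)"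
    and x: "x \<in> zMz"
  shows "g x = g z / of_nat d * tr x"
proof -
  have g0: "g 0 = 0" using scale[of 0 0] ccl(1) by simp
  have gsum: "g (\<Sum>i\<in>I. h i) = (\<Sum>i\<in>I. g (h i))" if "\<And>i. i \<in> I \<Longrightarrow> h i \<in> zMz"
    for I :: "nat set" and h
    using that by (induction I rule: infinite_finite_induct) (auto simp: g0 add ccl)
  define c0 where "c0 = g (unit 0 0)"
  have gu: "g (unit i j) = (if i = j then c0 else 0)" if ij: "i < d" "j < d" for i j
  proof (cases "i = j")
    case True
    have "g (unit i 0 * unit 0 i) = g (unit 0 i * unit i 0)" by (rule comm) (auto simp: unit)
    then show ?thesis using True ij d_pos by (simp add: unit_mult c0_def)
  next
    case False
    have "g (unit i i * unit i j) = g (unit i j * unit i i)" by (rule comm) (auto simp: unit)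
    then show ?thesis using False ij by (simp add: unit_mult g0)
  qed
  have gx: "g x = c0 * tr x" if x: "x \<in> zMz" for x
  proof -
    have "g x = (\<Sum>i<d. \<Sum>j<d. co x i j * g (unit i j))"
      by (subst expansion[OF x]) (simp add: gsum scale ccl unit)
    also have "\<dots> = (\<Sum>i<d. \<Sum>j<d. if i = j then co x i i * c0 else 0)"
      by (intro sum.cong) (auto simp: gu)
    also have "\<dots> = (\<Sum>i<d. co x i i * c0)" by simp
    finally show ?thesis using x by (simp add: tr_eq sum_distrib_left mult.commute)
  qed
  show ?thesis using gx[OF x] gx[OF z_corner] d_pos by (simp add: tr_z)
qed

text \<open>The vanishing product is read in the algebra, with \<open>z\<close> in place of the
  identity matrix; \<open>eigen_decomposition\<close> uses up its factors one at a time.\<close>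

lemma linear_factors_annihilate:
  assumes a: "a \<in> zMz"
  shows "\<exists>ls. foldl (\<lambda>x l. x * (a + scaleC (- l) z)) z ls = 0"
proof -
  have repz: "\<pi> z = 1\<^sub>m d" using co_z by (intro eq_matI) (auto simp: co_def rep_dims z_corner)
  have *: "foldl (\<lambda>x l. x * (a + scaleC (- l) z)) z ls \<in> zMz \<and>
     \<pi> (foldl (\<lambda>x l. x * (a + scaleC (- l) z)) z ls) = linear_factors (\<pi> a) ls" for ls
  proof (induction ls rule: rev_induct)
    case (snoc l ls)
    then show ?case using a z_corner rep_dims[OF a]
      by (simp add: linear_factors_simps ccl rep_mult rep_add rep_scaleC repz)
  qed (simp add: linear_factors_simps repz z_corner rep_dims a)
  obtain ls where "linear_factors (\<pi> a) ls = 0\<^sub>m d d"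
    using linear_factors_eq_zero[OF rep_carrier[OF a]] by auto
  moreover have "\<pi> 0 = 0\<^sub>m d d"
    using co_zero by (intro eq_matI) (auto simp: co_def rep_dims ccl)
  ultimately have "foldl (\<lambda>x l. x * (a + scaleC (- l) z)) z ls = 0"
    using *[of ls] rep_inj ccl(1) unfolding inj_on_def by metis
  then show ?thesis ..
qed

end

section \<open>Normality of functionals on matrix corners\<close>

text \<open>Elimination of one coordinate per step. It is applied to the coefficient families of
  normal functionals on a corner, where an annihilating vector is an element of the corner that no
  such functional sees.\<close>

lemma subspace_full_or_annihilated:
  fixes V :: "('i \<Rightarrow> complex) set"
  assumes "finite I" and "(\<lambda>_. 0) \<in> V" and "\<And>c u v. u \<in> V \<Longrightarrow> v \<in> V \<Longrightarrow> (\<lambda>i. c * u i + v i) \<in> V"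
    and "\<And>v i. v \<in> V \<Longrightarrow> i \<notin> I \<Longrightarrow> v i = 0"
  shows "(\<forall>v. (\<forall>i. i \<notin> I \<longrightarrow> v i = 0) \<longrightarrow> v \<in> V) \<or>
    (\<exists>x. (\<exists>i\<in>I. x i \<noteq> 0) \<and> (\<forall>v\<in>V. (\<Sum>i\<in>I. v i * x i) = 0))"
  using assms
proof (induction I arbitrary: V rule: finite_induct)
  case empty
  then show ?case by (metis empty_iff ext)
next
  case (insert a I)
  define V0 where "V0 = {v \<in> V. v a = 0}"
  have IH: "(\<forall>v. (\<forall>i. i \<notin> I \<longrightarrow> v i = 0) \<longrightarrow> v \<in> V0) \<or>
    (\<exists>x. (\<exists>i\<in>I. x i \<noteq> 0) \<and> (\<forall>v\<in>V0. (\<Sum>i\<in>I. v i * x i) = 0))"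
  proof (rule insert.IH)
    show "v i = 0" if "v \<in> V0" "i \<notin> I" for v i
      using that insert.prems(3)[of v i] by (auto simp: V0_def)
  qed (use insert.prems in \<open>auto simp: V0_def\<close>)
  show ?case
  proof (cases "\<forall>v\<in>V. v a = 0")
    case True
    define x where "x = (\<lambda>i. if i = a then 1 else 0 :: complex)"
    have "(\<Sum>i\<in>insert a I. v i * x i) = 0" if "v \<in> V" for v
      using True that by (intro sum.neutral) (auto simp: x_def)
    then show ?thesis by (intro disjI2 exI[of _ x]) (auto simp: x_def)
  next
    case False
    then obtain u0 where u0: "u0 \<in> V" "u0 a \<noteq> 0" by auto
    \<comment> \<open>Normalized pivot; the summand 0 matches the shape of the closure
      assumption.\<close>
    define u where "u = (\<lambda>i. (1 / u0 a) * u0 i + 0)"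
    have u: "u \<in> V" "u a = 1"
      using insert.prems(2)[OF u0(1) insert.prems(1), of "1 / u0 a"] u0 by (auto simp: u_def)
    have sub: "(\<lambda>i. - v a * u i + v i) \<in> V0" if "v \<in> V" for v
      using insert.prems(2)[OF u(1) that, of "- v a"] u by (auto simp: V0_def)
    from IH show ?thesis
    proof
      assume full: "\<forall>v. (\<forall>i. i \<notin> I \<longrightarrow> v i = 0) \<longrightarrow> v \<in> V0"
      have "v \<in> V" if "\<forall>i. i \<notin> insert a I \<longrightarrow> v i = 0" for v
      proof -
        have "(\<lambda>i. - v a * u i + v i) \<in> V0"
          using that insert.prems(3)[OF u(1)] u(2) full by (metis (no_types, lifting) add.right_inverse
            add_minus_cancel insert_iff mult.right_neutral mult_minus_left mult_zero_right add.left_inverse add_0)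
        then have "(\<lambda>i. v a * u i + (- v a * u i + v i)) \<in> V"
          using insert.prems(2)[OF u(1), of "\<lambda>i. - v a * u i + v i" "v a"] by (auto simp: V0_def)
        then show ?thesis by simp
      qed
      then show ?thesis by blast
    next
      assume "\<exists>x. (\<exists>i\<in>I. x i \<noteq> 0) \<and> (\<forall>v\<in>V0. (\<Sum>i\<in>I. v i * x i) = 0)"
      then obtain x where x: "\<exists>i\<in>I. x i \<noteq> 0" "\<And>v. v \<in> V0 \<Longrightarrow> (\<Sum>i\<in>I. v i * x i) = 0" by auto
      \<comment> \<open>The entry at \<open>a\<close> is chosen so that \<open>y\<close> also
        annihilates the pivot \<open>u\<close>.\<close>
      define y where "y = x(a := - (\<Sum>i\<in>I. u i * x i))"
      have "(\<Sum>i\<in>insert a I. v i * y i) = 0" if v: "v \<in> V" for v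
      proof -
        have "(\<Sum>i\<in>I. v i * y i) = (\<Sum>i\<in>I. v i * x i)"
          using insert.hyps by (intro sum.cong) (auto simp: y_def)
        moreover have "(\<Sum>i\<in>I. (- v a * u i + v i) * x i) =
            - v a * (\<Sum>i\<in>I. u i * x i) + (\<Sum>i\<in>I. v i * x i)"
          by (simp add: sum_distrib_left algebra_simps sum_subtractf sum_negf)
        ultimately show ?thesis
          using x(2)[OF sub[OF v]] insert.hyps by (simp add: y_def)
      qed
      moreover have "\<exists>i\<in>insert a I. y i \<noteq> 0" using x(1) insert.hyps by (auto simp: y_def)
      ultimately show ?thesis by blast
    qed
  qed
qed

lemma finite_family_convergent_subsequence:
  fixes c :: "nat \<Rightarrow> 'i \<Rightarrow> complex"
  assumes "finite I" and "\<And>i. i \<in> I \<Longrightarrow> bounded (range (\<lambda>k. c k i))"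
  shows "\<exists>r h. strict_mono (r :: nat \<Rightarrow> nat) \<and> (\<forall>i\<in>I. (\<lambda>k. c (r k) i) \<longlonglongrightarrow> h i)"
  using assms
proof (induction I rule: finite_induct)
  case empty
  show ?case using strict_mono_id by (auto simp: id_def)
next
  case (insert a I)
  then obtain r h where r: "strict_mono (r :: nat \<Rightarrow> nat)" "\<forall>i\<in>I. (\<lambda>k. c (r k) i) \<longlonglongrightarrow> h i" by auto
  have "bounded (range (\<lambda>k. c (r k) a))"
    by (rule bounded_subset[OF insert.prems[of a]]) auto
  then obtain l q where q: "strict_mono (q :: nat \<Rightarrow> nat)" "((\<lambda>k. c (r k) a) \<circ> q) \<longlonglongrightarrow> l"
    using bounded_imp_convergent_subsequence by blast
  have "(\<lambda>k. c (r (q k)) i) \<longlonglongrightarrow> h i" if "i \<in> I" for i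
    using LIMSEQ_subseq_LIMSEQ[OF r(2)[rule_format, OF that] q(1)] by (simp add: o_def)
  then have "\<forall>i\<in>insert a I. (\<lambda>k. c ((r \<circ> q) k) i) \<longlonglongrightarrow> (h(a := l)) i"
    using q insert.hyps by (auto simp: o_def)
  moreover have "strict_mono (r \<circ> q)" using r(1) q(1) by (simp add: strict_mono_o)
  ultimately show ?case by blast
qed

lemma dual_norm_upper:
  assumes "\<phi> \<in> dual_space M" "x \<in> M" "norm x \<le> 1"
  shows "cmod (\<phi> x) \<le> dual_norm M \<phi>"
proof -
  have "\<exists>K. \<forall>x\<in>M. cmod (\<phi> x) \<le> K * norm x" using assms(1) by (simp add: dual_space_def)
  then obtain K where K: "\<And>x. x \<in> M \<Longrightarrow> cmod (\<phi> x) \<le> K * norm x" by blast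
  have "bdd_above ((\<lambda>x. cmod (\<phi> x)) ` {x \<in> M. norm x \<le> 1})"
  proof (rule bdd_aboveI2)
    fix x assume "x \<in> {x \<in> M. norm x \<le> 1}"
    then have "cmod (\<phi> x) \<le> K * norm x" "norm x \<le> 1" using K by auto
    moreover have "K * norm x \<le> \<bar>K\<bar> * norm x" by (intro mult_right_mono) auto
    moreover have "\<bar>K\<bar> * norm x \<le> \<bar>K\<bar>" using \<open>norm x \<le> 1\<close> by (intro mult_left_le) auto
    ultimately show "cmod (\<phi> x) \<le> \<bar>K\<bar>" by linarith
  qed
  then show ?thesis unfolding dual_norm_def using assms by (intro cSUP_upper) auto
qed

lemma dual_norm_least:
  assumes "0 \<in> M" "\<And>x. x \<in> M \<Longrightarrow> norm x \<le> 1 \<Longrightarrow> cmod (\<phi> x) \<le> c"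
  shows "dual_norm M \<phi> \<le> c"
  unfolding dual_norm_def using assms by (intro cSUP_least) (auto intro: exI[of _ 0])

text \<open>The C*-identity for a self-adjoint element squares the norm, hence the exponents
  \<open>2 ^ k\<close>.\<close>

lemma norm_power_self_adjoint:
  fixes w :: "'a::cstar_algebra"
  assumes "star w = w"
  shows "norm (w ^ (2 ^ k)) = norm w ^ (2 ^ k)"
proof (induction k)
  case (Suc k)
  have st: "star (w ^ m) = w ^ m" for m
    by (induction m) (auto simp: star_mult assms power_commutes)
  have "norm (w ^ (2 ^ Suc k)) = norm (star (w ^ (2 ^ k)) * w ^ (2 ^ k))"
    by (simp add: st power_add[symmetric] mult_2)
  also have "\<dots> = norm w ^ (2 ^ Suc k)"
    unfolding norm_star_mult_self Suc.IH by (simp add: power_mult[symmetric] mult.commute)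
  finally show ?case .
qed simp

text \<open>With \<open>s * t = 0\<close> the powers of \<open>s + t\<close> split into powers of
  \<open>s\<close> and of \<open>t\<close>, so their norms never exceed 2. If \<open>s + t\<close>
  had norm above 1, its powers along \<open>2 ^ N\<close> would grow without bound.\<close>

lemma norm_orthogonal_le_1:
  fixes a b :: "'a::cstar_algebra"
  assumes ab: "star a * b = 0" "a * star b = 0" and n: "norm a \<le> 1" "norm b \<le> 1"
  shows "norm (a + b) \<le> 1"
proof -
  define s t where "s = star a * a" and "t = star b * b"
  have ba: "star b * a = 0" using arg_cong[OF ab(1), of star] by (simp add: star_mult star_star)
  have "s * t = star a * (a * star b) * b" by (simp add: s_def t_def mult.assoc)
  then have st1: "s * t = 0" using ab(2) by simp
  have "t * s = star (s * t)" by (simp add: s_def t_def star_mult star_star)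
  then have st2: "t * s = 0" using st1 by simp
  note st = st1 st2
  have nst: "norm s \<le> 1" "norm t \<le> 1"
    using n by (auto simp: s_def t_def norm_star_mult_self power_le_one)
  have pow: "(s + t) ^ Suc m = s ^ Suc m + t ^ Suc m" for m
  proof (induction m)
    case (Suc m)
    have "t * s ^ Suc m = 0" "s * t ^ Suc m = 0" using st by (auto simp: mult.assoc[symmetric])
    then show ?case using Suc by (simp add: distrib_left distrib_right)
  qed simp
  have e: "star (a + b) * (a + b) = s + t"
    using ab ba by (simp add: star_add distrib_left distrib_right s_def t_def)
  have "norm (s + t) \<le> 1"
  proof (rule ccontr)
    assume gt: "\<not> ?thesis"
    \<comment> \<open>\<open>N\<close> itself need not be a power of two; the exponent is raised to
      \<open>2 ^ N\<close>, which is at least \<open>N\<close> and to which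
      \<open>norm_power_self_adjoint\<close> applies.\<close>
    then obtain N where N: "2 < norm (s + t) ^ N" using real_arch_pow[of "norm (s + t)" 2] by auto
    have le: "N \<le> 2 ^ N" by (simp add: less_imp_le)
    obtain m where m: "2 ^ N = Suc m" using not0_implies_Suc[of "2 ^ N"] by auto
    have "norm (s + t) ^ N \<le> norm (s + t) ^ (2 ^ N)"
      using gt le by (intro power_increasing) auto
    also have "\<dots> = norm ((s + t) ^ (2 ^ N))"
      by (rule norm_power_self_adjoint[symmetric]) (simp add: s_def t_def star_add star_mult star_star)
    also have "\<dots> = norm (s ^ Suc m + t ^ Suc m)" by (simp only: m pow)
    also have "\<dots> \<le> norm s ^ Suc m + norm t ^ Suc m"
      by (intro norm_triangle_le add_mono norm_power_ineq)
    also have "\<dots> \<le> 1 + 1" using nst by (intro add_mono power_le_one) auto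
    finally show False using N by simp
  qed
  then have "(norm (a + b))\<^sup>2 \<le> 1" using norm_star_mult_self[of "a + b"] e by simp
  then show ?thesis by (simp add: power2_le_iff_abs_le abs_square_le_1)
qed

section \<open>Functionals that factor through a corner\<close>

context matrix_corner
begin

lemma norm_z: "norm z = 1"
  using norm_star_mult_self[of z] z0 by (simp add: zs zz power2_eq_square)

lemma norm_z_mult: "norm (z * x) \<le> norm x"
  using norm_mult_ineq[of z x] by (simp add: norm_z)

lemma positive_functional_corner:
  assumes "positive_functional zMz f"
  shows "positive_functional M (\<lambda>x. f (z * x))"
  unfolding positive_functional_def
proof (intro conjI ballI allI)
  note fD = positive_functionalD[OF assms]
  fix x assume x: "x \<in> M"
  have "z * (star x * x) = star (z * x) * (z * x)"
    using x zc[of "star x"] zc[of x] Mcl by (metis mult.assoc star_mult zs zz)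
  then show "Im (f (z * (star x * x))) = 0" "0 \<le> Re (f (z * (star x * x)))"
    using fD(3,4)[OF z_mult_corner[OF x]] by auto
  show "f (z * scaleC c x) = c * f (z * x)" for c
    using fD(2)[OF z_mult_corner[OF x]] by (simp add: mult_scaleC_right)
  fix y assume "y \<in> M"
  then show "f (z * (x + y)) = f (z * x) + f (z * y)"
    using fD(1) z_mult_corner x by (simp add: distrib_left)
qed

text \<open>The diagonal coefficient at \<open>j\<close> is a positive functional with value 1 at
  \<open>z\<close>, and at \<open>star y * y\<close> it is the squared norm of column
  \<open>j\<close>, which dominates every entry of that column.\<close>

lemma co_bound:
  assumes x: "x \<in> M" and ij: "i < d" "j < d"
  shows "cmod (co (z * x) i j) \<le> norm x"
proof -
  have pos: "positive_functional zMz (\<lambda>x. co x j j)"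
    unfolding positive_functional_def
  proof (intro conjI ballI allI)
    fix x assume x: "x \<in> zMz"
    have "co (star x * x) j j = complex_of_real (\<Sum>k<d. (cmod (co x k j))\<^sup>2)"
      using x ij by (simp add: ccl co_mult co_star mult.commute[of "cnj _"] flip: complex_norm_square)
    then show "Im (co (star x * x) j j) = 0" "0 \<le> Re (co (star x * x) j j)"
      by (auto intro!: sum_nonneg)
  qed (use ij in \<open>auto simp: co_add co_scaleC\<close>)
  note pos' = positive_functional_corner[OF pos]
  define y where "y = z * x"
  have y: "y \<in> zMz" using x by (simp add: y_def z_mult_corner)
  have "(cmod (co y i j))\<^sup>2 \<le> (\<Sum>k<d. (cmod (co y k j))\<^sup>2)"
    using ij by (intro member_le_sum) auto
  also have "\<dots> = Re (co (z * (star y * y)) j j)"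
    using y ij corner_zero ccl
    by (simp add: co_mult co_star mult.commute[of "cnj _"] flip: complex_norm_square)
  also have "\<dots> \<le> cmod (co (z * (star y * y)) j j)" by (rule complex_Re_le_cmod)
  also have "\<dots> \<le> Re (co (z * 1) j j) * norm (star y * y)"
    using positive_functional_bound[OF pos' M, of "star y * y"] y ccl mem_corner by auto
  also have "\<dots> = (norm y)\<^sup>2" using ij by (simp add: co_z norm_star_mult_self)
  finally have "cmod (co y i j) \<le> norm y" by (rule power2_le_imp_le) simp
  then show ?thesis using norm_z_mult[of x] by (simp add: y_def)
qed

text \<open>The general linear functional on \<open>M\<close> that depends on \<open>z * x\<close>
  alone, given by one coefficient per matrix position; the value 0 off \<open>M\<close> is the
  convention of \<open>dual_space\<close>.\<close>

definition corner_functional :: "(nat \<times> nat \<Rightarrow> complex) \<Rightarrow> 'a \<Rightarrow> complex" where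
  "corner_functional h x = (if x \<in> M then \<Sum>p\<in>{..<d}\<times>{..<d}. h p * co (z * x) (fst p) (snd p) else 0)"

lemma corner_functional_dual: "corner_functional h \<in> dual_space M"
  unfolding dual_space_def
proof (intro CollectI conjI ballI allI impI)
  fix x assume x: "x \<in> M"
  show "corner_functional h (scaleC c x) = c * corner_functional h x" for c
    using x by (auto simp: corner_functional_def Mcl mult_scaleC_right co_scaleC z_mult_corner
        sum_distrib_left intro!: sum.cong)
  fix y assume y: "y \<in> M"
  show "corner_functional h (x + y) = corner_functional h x + corner_functional h y"
  proof -
    have "(\<Sum>p\<in>{..<d}\<times>{..<d}. h p * co (z * (x + y)) (fst p) (snd p)) =
        (\<Sum>p\<in>{..<d}\<times>{..<d}. h p * co (z * x) (fst p) (snd p) + h p * co (z * y) (fst p) (snd p))"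
      using x y by (intro sum.cong) (auto simp: distrib_left co_add z_mult_corner)
    then show ?thesis using x y by (simp add: corner_functional_def Mcl sum.distrib)
  qed
next
  have "cmod (corner_functional h x) \<le> (\<Sum>p\<in>{..<d}\<times>{..<d}. cmod (h p)) * norm x" if x: "x \<in> M" for x
  proof -
    have "cmod (corner_functional h x) \<le> (\<Sum>p\<in>{..<d}\<times>{..<d}. cmod (h p * co (z * x) (fst p) (snd p)))"
      using x by (simp add: corner_functional_def sum_norm_le)
    also have "\<dots> \<le> (\<Sum>p\<in>{..<d}\<times>{..<d}. cmod (h p) * norm x)"
      using co_bound[OF x] by (intro sum_mono) (auto simp: norm_mult intro!: mult_left_mono)
    finally show ?thesis by (simp add: sum_distrib_right)
  qed
  then show "\<exists>K. \<forall>x\<in>M. cmod (corner_functional h x) \<le> K * norm x" by blast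
qed (simp add: corner_functional_def)

lemma linear_corner_functional:
  assumes add: "\<And>x y. x \<in> zMz \<Longrightarrow> y \<in> zMz \<Longrightarrow> f (x + y) = f x + f y"
    and scale: "\<And>c x. x \<in> zMz \<Longrightarrow> f (scaleC c x) = c * (f x :: complex)"
    and x: "x \<in> M"
  shows "corner_functional (\<lambda>p. f (unit (fst p) (snd p))) x = f (z * x)"
proof -
  have f0: "f 0 = 0" using scale[of 0 0] ccl(1) by simp
  have fsum: "f (\<Sum>i\<in>I. h i) = (\<Sum>i\<in>I. f (h i))" if "\<And>i. i \<in> I \<Longrightarrow> h i \<in> zMz"
    for I :: "nat set" and h
    using that by (induction I rule: infinite_finite_induct) (auto simp: f0 add ccl)
  have "f (z * x) = (\<Sum>i<d. \<Sum>j<d. co (z * x) i j * f (unit i j))"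
    by (subst expansion[OF z_mult_corner[OF x]]) (simp add: fsum scale ccl unit)
  then show ?thesis using x
    by (simp add: corner_functional_def sum.cartesian_product case_prod_unfold mult.commute)
qed

end

text \<open>A functional in the unit ball of the predual that almost attains the norm of \<open>x \<in> zM\<close> is
  small on \<open>(1 - z)M\<close>; a limit of such functionals lives on \<open>zM\<close> and is nonzero at \<open>x\<close>.\<close>

locale predual_corner = matrix_corner +
  fixes F :: "('a \<Rightarrow> complex) set"
  assumes F: "is_predual M F"
begin

lemma F_props: "F \<subseteq> dual_space M" "(\<lambda>_. 0) \<in> F"
  "\<phi> \<in> F \<Longrightarrow> \<psi> \<in> F \<Longrightarrow> (\<lambda>x. c * \<phi> x + \<psi> x) \<in> F"
  "\<phi> \<in> dual_space M \<Longrightarrow> (\<And>e. e > 0 \<Longrightarrow> \<exists>\<psi>\<in>F. dual_norm M (\<lambda>x. \<phi> x - \<psi> x) < e) \<Longrightarrow> \<phi> \<in> F"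
  "x \<in> M \<Longrightarrow> norm x = (SUP \<phi>\<in>{\<phi> \<in> F. dual_norm M \<phi> \<le> 1}. cmod (\<phi> x))"
  using F unfolding is_predual_def by blast+

lemma FD:
  assumes "\<phi> \<in> F"
  shows "x \<in> M \<Longrightarrow> y \<in> M \<Longrightarrow> \<phi> (x + y) = \<phi> x + \<phi> y" "x \<in> M \<Longrightarrow> \<phi> (scaleC c x) = c * \<phi> x"
    "x \<in> M \<Longrightarrow> norm x \<le> 1 \<Longrightarrow> cmod (\<phi> x) \<le> dual_norm M \<phi>"
proof -
  have \<phi>: "\<phi> \<in> dual_space M" using assms F_props(1) by auto
  then show "x \<in> M \<Longrightarrow> y \<in> M \<Longrightarrow> \<phi> (x + y) = \<phi> x + \<phi> y" "x \<in> M \<Longrightarrow> \<phi> (scaleC c x) = c * \<phi> x"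
    by (auto simp: dual_space_def)
  show "x \<in> M \<Longrightarrow> norm x \<le> 1 \<Longrightarrow> cmod (\<phi> x) \<le> dual_norm M \<phi>" by (rule dual_norm_upper[OF \<phi>])
qed

text \<open>\<open>x\<close> and \<open>y\<close> lie in complementary summands, so after a change
  of phase their sum still has norm at most 1, while \<open>\<phi>\<close> takes there the value
  \<open>cmod (\<phi> x) + cmod (\<phi> y)\<close>.\<close>

lemma small_off_corner:
  assumes \<phi>: "\<phi> \<in> F" "dual_norm M \<phi> \<le> 1" and x: "x \<in> zMz" "norm x \<le> 1" "1 - e < cmod (\<phi> x)"
    and y: "y \<in> M" "z * y = 0" "norm y \<le> 1"
  shows "cmod (\<phi> y) \<le> e"
proof -
  \<comment> \<open>Phases that rotate both values of \<open>\<phi>\<close> onto the nonnegative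
    real axis; a phase is 0 where the value is 0.\<close>
  define u v where "u = cnj (sgn (\<phi> x))" and "v = cnj (sgn (\<phi> y))"
  have u: "u * \<phi> x = cmod (\<phi> x)" and v: "v * \<phi> y = cmod (\<phi> y)"
    by (simp_all add: u_def v_def sgn_eq field_simps flip: complex_norm_square)
      (auto simp: power2_eq_square)
  have nuv: "cmod u \<le> 1" "cmod v \<le> 1" by (auto simp: u_def v_def norm_sgn)
  have xM: "x \<in> M" using x mem_corner by auto
  define a b where "a = scaleC u x" and "b = scaleC v y"
  have ab: "a \<in> M" "b \<in> M" using xM y by (auto simp: a_def b_def Mcl)
  have xz: "x = x * z" "x = z * x" using corner_zero[OF x(1)] by auto
  have "star x * y = star (z * x) * y" using xz(2) by simp
  also have "\<dots> = star x * (z * y)" by (simp add: star_mult zs mult.assoc)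
  finally have 1: "star x * y = 0" using y by simp
  have "x * star y = x * star (z * y)"
  proof -
    have "x * star y = x * z * star y" using xz(1) by simp
    also have "\<dots> = x * star (y * z)" by (simp add: star_mult zs mult.assoc)
    finally show ?thesis using zc[OF y(1)] by simp
  qed
  then have 2: "x * star y = 0" using y by simp
  have "norm (a + b) \<le> 1"
  proof (rule norm_orthogonal_le_1)
    show "star a * b = 0" "a * star b = 0"
      using 1 2 by (simp_all add: a_def b_def star_scaleC mult_scaleC_left mult_scaleC_right)
    show "norm a \<le> 1" "norm b \<le> 1"
      using nuv x y by (auto simp: a_def b_def norm_scaleC intro!: mult_le_one)
  qed
  then have "cmod (\<phi> (a + b)) \<le> 1" using FD(3)[OF \<phi>(1), of "a + b"] \<phi>(2) ab Mcl by auto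
  moreover have "\<phi> (a + b) = complex_of_real (cmod (\<phi> x) + cmod (\<phi> y))"
    using FD(1,2)[OF \<phi>(1)] ab xM y u v by (simp add: a_def b_def)
  ultimately have "cmod (\<phi> x) + cmod (\<phi> y) \<le> 1" by (metis abs_of_nonneg add_nonneg_nonneg norm_ge_zero norm_of_real)
  then show ?thesis using x(3) by linarith
qed

lemma corner_functional_in_predual_nonzero:
  assumes x: "x \<in> zMz" "norm x = 1"
  shows "\<exists>h. (\<forall>p. p \<notin> {..<d}\<times>{..<d} \<longrightarrow> h p = 0) \<and> corner_functional h \<in> F \<and> corner_functional h x \<noteq> 0"
proof -
  have xM: "x \<in> M" using x mem_corner by auto
  have "\<exists>\<phi>. \<phi> \<in> F \<and> dual_norm M \<phi> \<le> 1 \<and> 1 - 1 / real (Suc k) < cmod (\<phi> x)" for k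
  proof -
    have "1 - 1 / real (Suc k) < (SUP \<phi>\<in>{\<phi> \<in> F. dual_norm M \<phi> \<le> 1}. cmod (\<phi> x))"
      using F_props(5)[OF xM] x by simp
    moreover have "dual_norm M (\<lambda>_. 0) \<le> 1" using Mcl(1) by (intro dual_norm_least) auto
    moreover have "bdd_above ((\<lambda>\<phi>. cmod (\<phi> x)) ` {\<phi> \<in> F. dual_norm M \<phi> \<le> 1})"
      using FD(3)[OF _ xM] x by (intro bdd_aboveI2[of _ _ 1]) fastforce
    ultimately show ?thesis using F_props(2) less_cSUP_iff
      by (metis (mono_tags, lifting) empty_iff mem_Collect_eq)
  qed
  then obtain \<phi> where \<phi>: "\<And>k. \<phi> k \<in> F" "\<And>k. dual_norm M (\<phi> k) \<le> 1"
    "\<And>k. 1 - 1 / real (Suc k) < cmod (\<phi> k x)" by metis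
  define I where "I = {..<d}\<times>{..<d}"
  define c where "c = (\<lambda>k p. \<phi> k (unit (fst p) (snd p)))"
  have uM: "unit i j \<in> M" for i j using unit mem_corner by auto
  have "\<exists>r h. strict_mono (r :: nat \<Rightarrow> nat) \<and> (\<forall>p\<in>I. (\<lambda>k. c (r k) p) \<longlonglongrightarrow> h p)"
  proof (rule finite_family_convergent_subsequence)
    show "finite I" by (simp add: I_def)
    fix p assume "p \<in> I"
    have "cmod (c k p) \<le> norm (unit (fst p) (snd p))" for k
    proof (cases "unit (fst p) (snd p) = 0")
      case True
      then show ?thesis using FD(2)[OF \<phi>(1)[of k], of 0 0] Mcl(1) by (simp add: c_def)
    next
      case False
      define w where "w = norm (unit (fst p) (snd p))"
      have w: "w > 0" using False by (simp add: w_def)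
      have "cmod (\<phi> k (scaleC (1 / complex_of_real w) (unit (fst p) (snd p)))) \<le> 1"
        using w FD(3)[OF \<phi>(1)[of k], of "scaleC (1 / complex_of_real w) (unit (fst p) (snd p))"] \<phi>(2)[of k]
        by (force simp: Mcl uM norm_scaleC norm_divide w_def)
      then show ?thesis using w FD(2)[OF \<phi>(1)[of k] uM]
        by (simp add: c_def norm_mult norm_divide field_simps flip: w_def)
    qed
    then show "bounded (range (\<lambda>k. c k p))" by (auto simp: bounded_iff)
  qed
  then obtain r h0 where r: "strict_mono (r :: nat \<Rightarrow> nat)" and h0: "\<forall>p\<in>I. (\<lambda>k. c (r k) p) \<longlonglongrightarrow> h0 p" by auto
  define h where "h = (\<lambda>p. if p \<in> I then h0 p else 0)"
  have h: "(\<lambda>k. c (r k) p) \<longlonglongrightarrow> h p" if "p \<in> I" for p using h0 that by (simp add: h_def)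
  have cf: "\<phi> k (z * y) = corner_functional (c k) y" if "y \<in> M" for k y
    using linear_corner_functional[of "\<phi> k" y] FD[OF \<phi>(1)[of k]] mem_corner that
    by (simp add: c_def)
  have lim: "(\<lambda>k. \<phi> (r k) x) \<longlonglongrightarrow> corner_functional h x"
  proof -
    have "(\<lambda>k. corner_functional (c (r k)) x) \<longlonglongrightarrow> corner_functional h x"
      using h xM unfolding corner_functional_def I_def[symmetric] by (auto intro!: tendsto_intros)
    then show ?thesis using cf[OF xM] x corner_zero by simp
  qed
  have sub0: "(\<lambda>k. 1 / real (Suc (r k))) \<longlonglongrightarrow> 0"
    using LIMSEQ_subseq_LIMSEQ[OF LIMSEQ_Suc[OF lim_1_over_n] r] by (simp add: o_def)
  have "cmod (corner_functional h x) \<ge> 1"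
  proof (rule LIMSEQ_le)
    show "(\<lambda>k. 1 - 1 / real (Suc (r k))) \<longlonglongrightarrow> 1" using tendsto_diff[OF tendsto_const sub0, of 1] by simp
    show "(\<lambda>k. cmod (\<phi> (r k) x)) \<longlonglongrightarrow> cmod (corner_functional h x)" by (intro tendsto_norm lim)
    show "\<exists>N. \<forall>n\<ge>N. 1 - 1 / real (Suc (r n)) \<le> cmod (\<phi> (r n) x)" using \<phi>(3) less_imp_le by blast
  qed
  moreover have "corner_functional h \<in> F"
  proof (rule F_props(4)[OF corner_functional_dual])
    fix e :: real assume e: "e > 0"
    \<comment> \<open>Error bound for the distance of the limit functional to
      \<open>\<phi> (r k)\<close>: the sum accounts for the coefficients on the corner, the second
      term for the part of the unit ball off the corner.\<close>
    have "(\<lambda>k. (\<Sum>p\<in>I. cmod (h p - c (r k) p)) + 2 * (1 / real (Suc (r k)))) \<longlonglongrightarrow>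
        (\<Sum>p\<in>I. cmod (h p - h p)) + 2 * 0"
      by (intro tendsto_intros h sub0)
    then have "\<forall>\<^sub>F k in sequentially. (\<Sum>p\<in>I. cmod (h p - c (r k) p)) + 2 * (1 / real (Suc (r k))) < e"
      using e by (intro order_tendstoD(2)) auto
    then obtain k where k: "(\<Sum>p\<in>I. cmod (h p - c (r k) p)) + 2 * (1 / real (Suc (r k))) < e"
      by (auto dest: eventually_happens)
    have "dual_norm M (\<lambda>y. corner_functional h y - \<phi> (r k) y) \<le>
        (\<Sum>p\<in>I. cmod (h p - c (r k) p)) + 2 * (1 / real (Suc (r k)))"
    proof (rule dual_norm_least)
      show "0 \<in> M" by (rule Mcl)
      fix y assume y: "y \<in> M" "norm y \<le> 1"
      \<comment> \<open>\<open>y - z * y\<close> has norm at most 2, so halving brings it into the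
        unit ball for \<open>small_off_corner\<close>; this is the factor 2 in the bound.\<close>
      define w where "w = scaleC (1/2) (y - z * y)"
      have w: "w \<in> M" "z * w = 0"
        using y zM Mcl by (simp_all add: w_def mult_scaleC_right right_diff_distrib mult.assoc[symmetric] zz)
      have "norm (y - z * y) \<le> 2" using norm_triangle_ineq4[of y "z * y"] norm_z_mult[of y] y by simp
      then have nw: "norm w \<le> 1" by (simp add: w_def norm_scaleC)
      have "cmod (\<phi> (r k) w) \<le> 1 / real (Suc (r k))"
        by (rule small_off_corner[OF \<phi>(1,2) x(1) _ \<phi>(3) w nw]) (use x in auto)
      moreover have "y = z * y + scaleC 2 w" by (simp add: w_def scaleC_scaleC)
      then have "\<phi> (r k) y = \<phi> (r k) (z * y) + 2 * \<phi> (r k) w"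
        using FD(1,2)[OF \<phi>(1)[of "r k"]] y zM w Mcl by metis
      moreover have "cmod (corner_functional h y - corner_functional (c (r k)) y) \<le> (\<Sum>p\<in>I. cmod (h p - c (r k) p))"
      proof -
        have "corner_functional h y - corner_functional (c (r k)) y =
            (\<Sum>p\<in>I. (h p - c (r k) p) * co (z * y) (fst p) (snd p))"
          using y by (simp add: corner_functional_def I_def sum_subtractf left_diff_distrib)
        also have "cmod \<dots> \<le> (\<Sum>p\<in>I. cmod (h p - c (r k) p) * 1)"
          using order_trans[OF co_bound[OF y(1)] y(2)]
          by (intro sum_norm_le) (auto simp: norm_mult I_def intro!: mult_left_le)
        finally show ?thesis by simp
      qed
      ultimately show "cmod (corner_functional h y - \<phi> (r k) y) \<le>
          (\<Sum>p\<in>I. cmod (h p - c (r k) p)) + 2 * (1 / real (Suc (r k)))"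
        using cf[OF y(1), of "r k"]
          norm_triangle_ineq4[of "corner_functional h y - corner_functional (c (r k)) y" "2 * \<phi> (r k) w"]
        by (simp add: norm_mult algebra_simps)
    qed
    then show "\<exists>\<psi>\<in>F. dual_norm M (\<lambda>x. corner_functional h x - \<psi> x) < e"
      using k \<phi>(1) by (intro bexI[of _ "\<phi> (r k)"]) auto
  qed
  ultimately show ?thesis by (intro exI[of _ h]) (auto simp: h_def I_def)
qed

text \<open>If the coefficient families of normal functionals were a proper subspace, some nonzero
  element of the corner would be annihilated by all of them; normalized to norm 1, it contradicts
  \<open>corner_functional_in_predual_nonzero\<close>.\<close>

lemma corner_functional_in_predual:
  assumes "\<And>p. p \<notin> {..<d}\<times>{..<d} \<Longrightarrow> h p = 0"
  shows "corner_functional h \<in> F"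
proof -
  define I where "I = {..<d}\<times>{..<d}"
  define V where "V = {h. (\<forall>p. p \<notin> I \<longrightarrow> h p = 0) \<and> corner_functional h \<in> F}"
  have lin: "corner_functional (\<lambda>p. c * g p + h p) = (\<lambda>x. c * corner_functional g x + corner_functional h x)" for c g h
    by (auto simp: corner_functional_def sum.distrib sum_distrib_left distrib_right mult.assoc)
  have "(\<forall>v. (\<forall>i. i \<notin> I \<longrightarrow> v i = 0) \<longrightarrow> v \<in> V) \<or>
    (\<exists>x. (\<exists>i\<in>I. x i \<noteq> 0) \<and> (\<forall>v\<in>V. (\<Sum>i\<in>I. v i * x i) = 0))"
  proof (rule subspace_full_or_annihilated)
    have "corner_functional (\<lambda>_. 0) = (\<lambda>_. 0)" by (auto simp: corner_functional_def)
    then show "(\<lambda>_. 0) \<in> V" using F_props(2) by (simp add: V_def)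
  qed (auto simp: V_def I_def lin F_props(3))
  moreover have False if x: "\<exists>i\<in>I. x i \<noteq> 0" "\<And>v. v \<in> V \<Longrightarrow> (\<Sum>i\<in>I. v i * x i) = 0" for x
  proof -
    obtain y where y: "y \<in> zMz" "\<forall>i<d. \<forall>j<d. co y i j = x (i, j)"
      using co_surj[of "\<lambda>i j. x (i, j)"] by auto
    have y0: "norm y > 0" using x(1) y co_zero by (auto simp: I_def)
    define w where "w = scaleC (1 / complex_of_real (norm y)) y"
    have w: "w \<in> zMz" "norm w = 1" using y y0 ccl by (auto simp: w_def norm_scaleC norm_divide)
    obtain h where h: "\<forall>p. p \<notin> I \<longrightarrow> h p = 0" "corner_functional h \<in> F" "corner_functional h w \<noteq> 0"
      using corner_functional_in_predual_nonzero[OF w] unfolding I_def by auto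
    have "w \<in> M" "z * w = w" using w mem_corner by auto
    then have "corner_functional h w = (\<Sum>p\<in>I. h p * (x p / complex_of_real (norm y)))"
      using y unfolding corner_functional_def I_def[symmetric]
      by (auto simp: w_def co_scaleC I_def intro!: sum.cong)
    also have "\<dots> = (\<Sum>p\<in>I. h p * x p) / complex_of_real (norm y)"
      by (simp add: sum_divide_distrib)
    also have "\<dots> = 0" using x(2)[of h] h by (simp add: V_def)
    finally show False using h by simp
  qed
  ultimately have "h \<in> V" using assms unfolding I_def by blast
  then show ?thesis by (simp add: V_def)
qed

lemma linear_functional_in_predual:
  assumes "\<And>x y. x \<in> zMz \<Longrightarrow> y \<in> zMz \<Longrightarrow> f (x + y) = f x + f y"
    and "\<And>c x. x \<in> zMz \<Longrightarrow> f (scaleC c x) = c * (f x :: complex)"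
  shows "restr M (\<lambda>x. f (z * x)) \<in> F"
proof -
  define h where "h = (\<lambda>p. if p \<in> {..<d}\<times>{..<d} then f (unit (fst p) (snd p)) else 0)"
  have "corner_functional h = corner_functional (\<lambda>p. f (unit (fst p) (snd p)))"
    by (auto simp: corner_functional_def h_def intro!: sum.cong)
  also have "\<dots> = restr M (\<lambda>x. f (z * x))"
    using linear_corner_functional[of f] assms by (intro ext) (auto simp: restr_def corner_functional_def)
  finally show ?thesis using corner_functional_in_predual[of h] by (simp add: h_def)
qed

end

section \<open>Spectral calculus of an invertible positive element of a matrix corner\<close>

locale density_corner = matrix_corner +
  fixes a :: 'a
  assumes a_pos: "\<exists>b\<in>corner z M. a = star b * b"
    and a_inv: "\<exists>r\<in>corner z M. a * r = z \<and> r * a = z"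
begin

lemma a_corner: "a \<in> zMz" using a_pos ccl by auto

lemma a_star: "star a = a" using a_pos by (auto simp: star_mult star_star)

section \<open>Eigenvectors of a self-adjoint element\<close>

definition shift :: "complex \<Rightarrow> 'a \<Rightarrow> 'a" where
  "shift l y = a * y - scaleC l y"

lemma shift_corner: "y \<in> zMz \<Longrightarrow> shift l y \<in> zMz"
  by (simp add: shift_def a_corner ccl)

lemma shift_diff: "shift l (x - y) = shift l x - shift l y"
  by (simp add: shift_def right_diff_distrib scaleC_diff_right)

lemma shift_sum: "shift l (\<Sum>i\<in>I. f i) = (\<Sum>i\<in>I. shift l (f i))"
  by (simp add: shift_def sum_distrib_left scaleC_sum_right sum_subtractf)

lemma shift_eigen:
  assumes "a * x = scaleC m x" "m \<noteq> l"
  shows "shift l (scaleC (1 / (m - l)) x) = x"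
proof -
  have "shift l (scaleC (1 / (m - l)) x) = scaleC (1 / (m - l) * m) x - scaleC (l * (1 / (m - l))) x"
    using assms(1) by (simp add: shift_def mult_scaleC_right scaleC_scaleC)
  also have "\<dots> = scaleC (1 / (m - l) * m - l * (1 / (m - l))) x" by (simp only: scaleC_diff_left)
  also have "1 / (m - l) * m - l * (1 / (m - l)) = (m - l) * (1 / (m - l))"
    by (subst left_diff_distrib) (simp only: mult.commute)
  also have "\<dots> = 1" using assms(2) by simp
  finally show ?thesis by simp
qed

text \<open>Self-adjointness lets \<open>star y * (a * y)\<close> be read as
  \<open>star (a * y) * y\<close>, so an eigenvalue equals its conjugate unless
  \<open>star y * y = 0\<close>.\<close>

lemma shift_nonreal:
  assumes "shift l y = 0" "cnj l \<noteq> l"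
  shows "y = 0"
proof -
  have ay: "a * y = scaleC l y" using assms(1) by (simp add: shift_def)
  have "scaleC l (star y * y) = star y * (a * y)" by (simp add: ay mult_scaleC_right)
  also have "\<dots> = star (a * y) * y" by (simp add: star_mult a_star mult.assoc)
  also have "\<dots> = scaleC (cnj l) (star y * y)" by (simp add: ay star_scaleC mult_scaleC_left)
  finally have "scaleC (cnj l - l) (star y * y) = 0" by (simp add: scaleC_diff_left)
  then show ?thesis using assms(2) by simp
qed

text \<open>There are no Jordan blocks: for \<open>u = (a - l) y\<close> with real \<open>l\<close>,
  moving one factor across the star gives \<open>star u * u = star y * (a - l) u\<close>.\<close>

lemma shift_shift:
  assumes "shift (complex_of_real l) (shift (complex_of_real l) y) = 0"
  shows "shift (complex_of_real l) y = 0"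
proof -
  let ?l = "complex_of_real l"
  define u where "u = shift ?l y"
  have "star u * u = star y * (a * u) - scaleC ?l (star y * u)"
    by (simp add: u_def shift_def star_diff star_mult a_star star_scaleC left_diff_distrib
        mult_scaleC_left mult.assoc)
  also have "\<dots> = star y * shift ?l u" by (simp add: shift_def right_diff_distrib mult_scaleC_right)
  also have "\<dots> = 0" using assms by (simp add: u_def)
  finally show ?thesis by (simp add: u_def)
qed

text \<open>The factor nearest to \<open>y\<close> is peeled off: the induction hypothesis
  decomposes \<open>(a - l) y\<close> into eigenvectors, and those with eigenvalue \<open>m\<close>
  other than \<open>l\<close> are divided by \<open>m - l\<close>. What remains of \<open>y\<close>
  is killed by \<open>(a - l)^2\<close>, hence by \<open>a - l\<close>, and is the component at
  \<open>l\<close>.\<close>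

lemma eigen_decomposition:
  assumes "y \<in> zMz" "foldl (\<lambda>x l. x * (a + scaleC (- l) z)) z ls * y = 0"
  shows "\<exists>L x. finite (L :: real set) \<and> (\<forall>l\<in>L. x l \<in> zMz \<and> a * x l = scaleC (complex_of_real l) (x l)) \<and>
    y = (\<Sum>l\<in>L. x l)"
  using assms
proof (induction ls arbitrary: y rule: rev_induct)
  case Nil
  then have "y = 0" by (simp add: corner_zero)
  then show ?case by (intro exI[of _ "{}"]) auto
next
  case (snoc l ls)
  have "(a + scaleC (- l) z) * y = shift l y"
    using corner_zero[OF snoc.prems(1)]
    by (simp add: shift_def left_diff_distrib mult_scaleC_left scaleC_minus_left)
  then have "foldl (\<lambda>x l. x * (a + scaleC (- l) z)) z ls * shift l y = 0"
    using snoc.prems(2) by (simp add: mult.assoc)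
  from snoc.IH[OF shift_corner[OF snoc.prems(1)] this] obtain L x where
    L: "finite L" and x: "\<And>m. m \<in> L \<Longrightarrow> x m \<in> zMz"
      "\<And>m. m \<in> L \<Longrightarrow> a * x m = scaleC (complex_of_real m) (x m)"
    and sy: "shift l y = (\<Sum>m\<in>L. x m)" by blast
  define x' where "x' = (\<lambda>m. scaleC (1 / (complex_of_real m - l)) (x m))"
  have x': "x' m \<in> zMz" "a * x' m = scaleC (complex_of_real m) (x' m)" if "m \<in> L" for m
    using x[OF that] by (auto simp: x'_def ccl mult_scaleC_right scaleC_scaleC mult.commute)
  have sx': "shift l (x' m) = x m" if "m \<in> L" "complex_of_real m \<noteq> l" for m
    unfolding x'_def by (rule shift_eigen[OF x(2)[OF that(1)] that(2)])
  show ?case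
  proof (cases "cnj l = l")
    case False
    then have ne: "complex_of_real m \<noteq> l" for m by auto
    have "shift l (y - (\<Sum>m\<in>L. x' m)) = 0"
      using sx' ne by (simp add: shift_diff shift_sum sy)
    then have "y = (\<Sum>m\<in>L. x' m)" using shift_nonreal False by fastforce
    then show ?thesis using L x' by blast
  next
    case True
    then obtain k where k: "l = complex_of_real k" by (metis Reals_cnj_iff Reals_cases)
    define L' where "L' = L - {k}"
    \<comment> \<open>Its image under \<open>shift l\<close> is the component \<open>x k\<close> or
      0, which a second shift kills.\<close>
    define y' where "y' = y - (\<Sum>m\<in>L'. x' m)"
    have y': "y' \<in> zMz" unfolding y'_def using snoc.prems(1) x' by (intro ccl) (auto simp: L'_def)
    have "shift l y' = (\<Sum>m\<in>L. x m) - (\<Sum>m\<in>L'. x m)"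
      unfolding y'_def shift_diff shift_sum sy
      using sx' by (auto simp: L'_def k intro!: sum.cong)
    also have "\<dots> = (if k \<in> L then x k else 0)"
      using L by (auto simp: L'_def sum_diff1)
    finally have "shift l (shift l y') = 0"
      using x(2)[of k] by (auto simp: shift_def k)
    then have "shift l y' = 0" unfolding k by (rule shift_shift)
    then have ay': "a * y' = scaleC (complex_of_real k) y'" by (simp add: shift_def k)
    have "y = (\<Sum>m\<in>insert k L'. (x'(k := y')) m)"
    proof -
      have "(\<Sum>m\<in>L'. (x'(k := y')) m) = (\<Sum>m\<in>L'. x' m)" by (intro sum.cong) (auto simp: L'_def)
      moreover have "(\<Sum>m\<in>insert k L'. (x'(k := y')) m) = (x'(k := y')) k + (\<Sum>m\<in>L'. (x'(k := y')) m)"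
        by (rule sum.insert) (use L in \<open>auto simp: L'_def\<close>)
      ultimately show ?thesis by (simp add: y'_def)
    qed
    then show ?thesis using L x' y' ay'
      by (intro exI[of _ "insert k L'"] exI[of _ "x'(k := y')"]) (auto simp: L'_def)
  qed
qed

text \<open>\<open>spec\<close>, \<open>sp\<close> and \<open>pw\<close> repeat \<open>eigs\<close>,
  \<open>spec_proj\<close> and \<open>dens_powr\<close> on a single corner;
  \<open>corner_constants\<close> identifies them.\<close>

definition spec :: "real set" where
  "spec = {\<gamma>. eigenvalue (\<pi> a) (complex_of_real \<gamma>)}"

definition sp :: "real \<Rightarrow> 'a" where
  "sp \<gamma> = (THE p. p \<in> projections zMz \<and> a * p = scaleC (complex_of_real \<gamma>) p \<and>
             (\<forall>y\<in>zMz. a * y = scaleC (complex_of_real \<gamma>) y \<longrightarrow> p * y = y))"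

lemma spec_iff: "\<gamma> \<in> spec \<longleftrightarrow> (\<exists>y\<in>zMz. y \<noteq> 0 \<and> a * y = scaleC (complex_of_real \<gamma>) y)"
proof
  assume "\<gamma> \<in> spec"
  then obtain v where v: "v \<in> carrier_vec d" "v \<noteq> 0\<^sub>v d" "\<pi> a *\<^sub>v v = complex_of_real \<gamma> \<cdot>\<^sub>v v"
    by (auto simp: spec_def eigenvalue_def eigenvector_def rep_dims a_corner)
  \<comment> \<open>An element all of whose columns are the eigenvector; conversely, some nonzero
    column of an eigenelement is an eigenvector.\<close>
  obtain y where y: "y \<in> zMz" "\<forall>i<d. \<forall>j<d. co y i j = vec_index v i"
    using co_surj[of "\<lambda>i j. vec_index v i"] by auto
  have "y \<noteq> 0"
  proof
    assume "y = 0"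
    then have "vec_index v i = 0" if "i < d" for i
      using y(2)[rule_format, OF that d_pos] co_zero[OF that d_pos] by simp
    then have "v = 0\<^sub>v d" using v(1) by (intro eq_vecI) auto
    then show False using v by simp
  qed
  moreover have "a * y = scaleC (complex_of_real \<gamma>) y"
  proof (rule co_eqI)
    fix i j assume ij: "i < d" "j < d"
    have "co (a * y) i j = (\<Sum>k<d. co a i k * vec_index v k)"
      using y ij by (simp add: co_mult a_corner)
    also have "\<dots> = vec_index (\<pi> a *\<^sub>v v) i"
      using v(1) ij by (auto simp: scalar_prod_def rep_dims a_corner co_def atLeast0LessThan intro!: sum.cong)
    finally show "co (a * y) i j = co (scaleC (complex_of_real \<gamma>) y) i j"
      using y v ij by (simp add: co_scaleC)
  qed (use y a_corner ccl in auto)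
  ultimately show "\<exists>y\<in>zMz. y \<noteq> 0 \<and> a * y = scaleC (complex_of_real \<gamma>) y" using y by blast
next
  assume "\<exists>y\<in>zMz. y \<noteq> 0 \<and> a * y = scaleC (complex_of_real \<gamma>) y"
  then obtain y where y: "y \<in> zMz" "y \<noteq> 0" "a * y = scaleC (complex_of_real \<gamma>) y" by blast
  then obtain i0 j where j: "i0 < d" "j < d" "co y i0 j \<noteq> 0" using co_eqI[OF y(1) ccl(1)] co_zero by metis
  define v where "v = Matrix.vec d (\<lambda>i. co y i j)"
  have "vec_index v i0 \<noteq> 0" using j by (simp add: v_def)
  then have "v \<noteq> 0\<^sub>v d" using j by auto
  moreover have "\<pi> a *\<^sub>v v = complex_of_real \<gamma> \<cdot>\<^sub>v v"
  proof (rule eq_vecI)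
    fix i assume "i < dim_vec (complex_of_real \<gamma> \<cdot>\<^sub>v v)"
    then have i: "i < d" by (simp add: v_def)
    have "vec_index (\<pi> a *\<^sub>v v) i = co (a * y) i j"
      using y(1) i j by (auto simp: scalar_prod_def rep_dims a_corner co_def co_mult[unfolded co_def] v_def atLeast0LessThan intro!: sum.cong)
    then show "vec_index (\<pi> a *\<^sub>v v) i = vec_index (complex_of_real \<gamma> \<cdot>\<^sub>v v) i"
      using y i j by (simp add: co_scaleC v_def)
  qed (simp add: v_def rep_dims a_corner)
  ultimately have "eigenvector (\<pi> a) v (complex_of_real \<gamma>)"
    by (auto simp: eigenvector_def rep_dims a_corner v_def)
  then show "\<gamma> \<in> spec" by (auto simp: spec_def eigenvalue_def)
qed

text \<open>The spectral projections are the eigencomponents \<open>x l\<close> of the unit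
  \<open>z\<close>. Components with different real eigenvalues are orthogonal, so
  \<open>star (x l) = star (x l) * z\<close> collapses to \<open>star (x l) * x l\<close>, which
  makes \<open>x l\<close> self-adjoint and idempotent.\<close>

lemma spectral_resolution:
  "finite spec" "\<And>\<gamma>. sp \<gamma> \<in> zMz" "\<And>\<gamma>. sp \<gamma> * sp \<gamma> = sp \<gamma>" "\<And>\<gamma>. star (sp \<gamma>) = sp \<gamma>"
  "\<And>\<gamma>. a * sp \<gamma> = scaleC (complex_of_real \<gamma>) (sp \<gamma>)"
  "\<And>\<gamma> \<delta>. \<gamma> \<noteq> \<delta> \<Longrightarrow> sp \<gamma> * sp \<delta> = 0" "\<And>\<gamma>. \<gamma> \<notin> spec \<longleftrightarrow> sp \<gamma> = 0"
  "(\<Sum>\<gamma>\<in>spec. sp \<gamma>) = z"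
proof -
  obtain ls where "foldl (\<lambda>x l. x * (a + scaleC (- l) z)) z ls = 0"
    using linear_factors_annihilate[OF a_corner] by auto
  then obtain L x where L: "finite (L::real set)" and x: "\<And>l. l \<in> L \<Longrightarrow> x l \<in> zMz"
      "\<And>l. l \<in> L \<Longrightarrow> a * x l = scaleC (complex_of_real l) (x l)" and zx: "z = (\<Sum>l\<in>L. x l)"
    using eigen_decomposition[OF z_corner, of ls] by auto
  have xa: "star (x l) * a = scaleC (complex_of_real l) (star (x l))" if "l \<in> L" for l
    using arg_cong[OF x(2)[OF that], of star] by (simp add: star_mult a_star star_scaleC)
  have orth: "star (x l) * y = 0"
    if "l \<in> L" "l \<noteq> m" "a * y = scaleC (complex_of_real m) y" for l m y
  proof -
    have "scaleC (complex_of_real l) (star (x l) * y) = star (x l) * (a * y)"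
      using xa[OF that(1)] by (simp add: mult.assoc[symmetric] mult_scaleC_left)
    also have "\<dots> = scaleC (complex_of_real m) (star (x l) * y)"
      using that by (simp add: mult_scaleC_right)
    finally have "scaleC (complex_of_real l - complex_of_real m) (star (x l) * y) = 0"
      by (simp add: scaleC_diff_left)
    then show ?thesis using that(2) by simp
  qed
  have sa: "star (x l) = x l" and idem: "x l * x l = x l" if l: "l \<in> L" for l
  proof -
    have "star (x l) = star (x l) * z" using x(1)[OF l] ccl(4) corner_zero by auto
    also have "\<dots> = (\<Sum>m\<in>L. star (x l) * x m)" by (simp add: zx sum_distrib_left)
    also have "\<dots> = (\<Sum>m\<in>L. if m = l then star (x l) * x l else 0)"
    proof (intro sum.cong refl)
      fix m assume "m \<in> L"
      then show "star (x l) * x m = (if m = l then star (x l) * x l else 0)"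
        using orth[OF l, of m "x m"] x(2) by auto
    qed
    also have "\<dots> = star (x l) * x l" using l L by simp
    finally have e: "star (x l) = star (x l) * x l" .
    have "x l = star (star (x l))" by (simp add: star_star)
    also have "\<dots> = star (star (x l) * x l)" using e by simp
    also have "\<dots> = star (x l) * x l" by (simp add: star_mult star_star)
    finally show s: "star (x l) = x l" using e by simp
    show "x l * x l = x l" using e s by simp
  qed
  define p where "p = (\<lambda>\<gamma>. if \<gamma> \<in> L then x \<gamma> else 0)"
  have pc: "p \<gamma> \<in> zMz" for \<gamma> using x ccl by (auto simp: p_def)
  have proj: "p \<gamma> \<in> projections zMz" for \<gamma> using pc sa idem by (auto simp: projections_def p_def)
  have ap: "a * p \<gamma> = scaleC (complex_of_real \<gamma>) (p \<gamma>)" for \<gamma> using x by (auto simp: p_def)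
  have py: "p \<gamma> * y = y" if y: "y \<in> zMz" "a * y = scaleC (complex_of_real \<gamma>) y" for \<gamma> y
  proof -
    have "y = z * y" using y corner_zero by simp
    also have "\<dots> = (\<Sum>l\<in>L. x l * y)" by (simp add: zx sum_distrib_right)
    also have "\<dots> = (\<Sum>l\<in>L. if l = \<gamma> then p \<gamma> * y else 0)"
      by (intro sum.cong) (use orth[of _ \<gamma> y] sa y in \<open>auto simp: p_def\<close>)
    also have "\<dots> = p \<gamma> * y" using L by (simp add: p_def)
    finally show ?thesis by simp
  qed
  have sp: "sp \<gamma> = p \<gamma>" for \<gamma>
    unfolding sp_def
  proof (rule the_equality)
    show "p \<gamma> \<in> projections zMz \<and> a * p \<gamma> = scaleC (complex_of_real \<gamma>) (p \<gamma>) \<and>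
        (\<forall>y\<in>zMz. a * y = scaleC (complex_of_real \<gamma>) y \<longrightarrow> p \<gamma> * y = y)"
      using proj ap py by blast
    fix q assume q: "q \<in> projections zMz \<and> a * q = scaleC (complex_of_real \<gamma>) q \<and>
        (\<forall>y\<in>zMz. a * y = scaleC (complex_of_real \<gamma>) y \<longrightarrow> q * y = y)"
    then have 1: "p \<gamma> * q = q" using py by (auto simp: projections_def)
    have 2: "q * p \<gamma> = p \<gamma>" using q pc ap by auto
    \<comment> \<open>Two candidates absorb each other from the left; taking adjoints turns this
      into equality.\<close>
    have "q = star (p \<gamma> * q)" using q 1 by (simp add: projections_def)
    also have "\<dots> = q * p \<gamma>" using q proj[of \<gamma>] by (simp add: projections_def star_mult)
    finally show "q = p \<gamma>" using 2 by simp
  qed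
  show spc: "sp \<gamma> \<in> zMz" and "sp \<gamma> * sp \<gamma> = sp \<gamma>" and "star (sp \<gamma>) = sp \<gamma>"
    and ea: "a * sp \<gamma> = scaleC (complex_of_real \<gamma>) (sp \<gamma>)" for \<gamma>
    using pc proj ap by (auto simp: sp projections_def)
  show "sp \<gamma> * sp \<delta> = 0" if "\<gamma> \<noteq> \<delta>" for \<gamma> \<delta>
    using orth[of \<gamma> \<delta> "x \<delta>"] that sa x by (auto simp: sp p_def)
  show iff: "\<gamma> \<notin> spec \<longleftrightarrow> sp \<gamma> = 0" for \<gamma>
  proof
    assume "\<gamma> \<notin> spec"
    then show "sp \<gamma> = 0" using spc[of \<gamma>] ea[of \<gamma>] unfolding spec_iff by blast
  next
    assume 0: "sp \<gamma> = 0"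
    show "\<gamma> \<notin> spec"
    proof
      assume "\<gamma> \<in> spec"
      then obtain y where y: "y \<in> zMz" "y \<noteq> 0" "a * y = scaleC (complex_of_real \<gamma>) y"
        unfolding spec_iff by blast
      then show False using py[OF y(1,3)] 0 by (simp add: sp)
    qed
  qed
  have sub: "spec \<subseteq> L"
  proof
    fix \<gamma> assume "\<gamma> \<in> spec"
    then have "p \<gamma> \<noteq> 0" using iff[of \<gamma>] by (simp add: sp)
    then show "\<gamma> \<in> L" by (simp add: p_def split: if_splits)
  qed
  then show "finite spec" using L finite_subset by blast
  have "(\<Sum>\<gamma>\<in>spec. sp \<gamma>) = (\<Sum>\<gamma>\<in>L. sp \<gamma>)"
    by (rule sum.mono_neutral_left[OF L sub]) (use iff in blast)
  also have "\<dots> = (\<Sum>l\<in>L. x l)" by (intro sum.cong) (auto simp: sp p_def)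
  finally show "(\<Sum>\<gamma>\<in>spec. sp \<gamma>) = z" by (simp only: zx[symmetric])
qed

lemmas finite_spec = spectral_resolution(1)
  and sp_corner = spectral_resolution(2)
  and sp_idem = spectral_resolution(3)
  and sp_star = spectral_resolution(4)
  and a_sp = spectral_resolution(5)
  and sp_orth = spectral_resolution(6)
  and sp_zero_iff = spectral_resolution(7)
  and sp_sum = spectral_resolution(8)

lemma sp_mult: "sp \<gamma> * sp \<delta> = (if \<gamma> = \<delta> then sp \<gamma> else 0)"
  using sp_orth sp_idem by auto

text \<open>Compressing \<open>a = star b * b\<close> by the spectral projection shows that
  \<open>\<gamma>\<close> times a positive trace is a trace of the form
  \<open>tr (star y * y)\<close>; invertibility excludes 0.\<close>

lemma spec_pos:
  assumes "\<gamma> \<in> spec"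
  shows "\<gamma> > 0"
proof -
  obtain b where b: "b \<in> zMz" "a = star b * b" using a_pos by auto
  obtain r where r: "r * a = z" using a_inv by auto
  have sp0: "sp \<gamma> \<noteq> 0" using assms sp_zero_iff by auto
  have "\<gamma> \<noteq> 0"
  proof
    assume "\<gamma> = 0"
    then have "r * (a * sp \<gamma>) = 0" using a_sp[of \<gamma>] by simp
    then have "z * sp \<gamma> = 0" by (simp add: r mult.assoc[symmetric])
    then show False using sp0 corner_zero sp_corner by metis
  qed
  have "scaleC (complex_of_real \<gamma>) (sp \<gamma>) = star (b * sp \<gamma>) * (b * sp \<gamma>)"
  proof -
    have "star (b * sp \<gamma>) * (b * sp \<gamma>) = star (sp \<gamma>) * (star b * b) * sp \<gamma>"
      by (simp add: star_mult mult.assoc)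
    also have "\<dots> = sp \<gamma> * (a * sp \<gamma>)" by (simp only: b(2)[symmetric] sp_star mult.assoc)
    finally have "star (b * sp \<gamma>) * (b * sp \<gamma>) = sp \<gamma> * (a * sp \<gamma>)" .
    then show ?thesis by (simp add: a_sp mult_scaleC_right sp_idem)
  qed
  then have t: "complex_of_real \<gamma> * tr (sp \<gamma>) = tr (star (b * sp \<gamma>) * (b * sp \<gamma>))"
    using tr_scaleC[OF sp_corner] by metis
  have "0 \<le> Re (tr (star (b * sp \<gamma>) * (b * sp \<gamma>)))"
    using b sp_corner by (intro tr_star_pos ccl)
  then have 1: "0 \<le> \<gamma> * Re (tr (sp \<gamma>))" unfolding t[symmetric] by simp
  have "tr (sp \<gamma>) = tr (star (sp \<gamma>) * sp \<gamma>)" by (simp add: sp_star sp_idem)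
  then have 2: "0 \<le> Re (tr (sp \<gamma>))" "Im (tr (sp \<gamma>)) = 0" "tr (sp \<gamma>) \<noteq> 0"
    using tr_star_pos[OF sp_corner, of \<gamma>] tr_star_self_eq_0[OF sp_corner, of \<gamma>] sp0 by auto
  then have "0 < Re (tr (sp \<gamma>))" by (metis complex_eq_iff order_le_less zero_complex.sel)
  then show ?thesis using 1 \<open>\<gamma> \<noteq> 0\<close> by (simp add: zero_le_mult_iff)
qed

section \<open>Complex powers of the density\<close>

definition pw :: "complex \<Rightarrow> 'a" where
  "pw w = (\<Sum>\<gamma>\<in>spec. scaleC (exp (w * complex_of_real (ln \<gamma>))) (sp \<gamma>))"

lemma pw_corner: "pw w \<in> zMz"
  unfolding pw_def by (intro ccl sp_corner)

lemma sp_pw: "sp \<gamma> * pw w = scaleC (exp (w * complex_of_real (ln \<gamma>))) (sp \<gamma>)"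
proof -
  have "sp \<gamma> * pw w = (\<Sum>\<delta>\<in>spec. if \<delta> = \<gamma> then scaleC (exp (w * complex_of_real (ln \<gamma>))) (sp \<gamma>) else 0)"
    unfolding pw_def sum_distrib_left by (intro sum.cong) (auto simp: mult_scaleC_right sp_mult)
  also have "\<dots> = (if \<gamma> \<in> spec then scaleC (exp (w * complex_of_real (ln \<gamma>))) (sp \<gamma>) else 0)"
    using finite_spec by simp
  finally show ?thesis using sp_zero_iff[of \<gamma>] by auto
qed

lemma pw_sp: "pw w * sp \<gamma> = scaleC (exp (w * complex_of_real (ln \<gamma>))) (sp \<gamma>)"
proof -
  have "pw w * sp \<gamma> = (\<Sum>\<delta>\<in>spec. if \<delta> = \<gamma> then scaleC (exp (w * complex_of_real (ln \<gamma>))) (sp \<gamma>) else 0)"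
    unfolding pw_def sum_distrib_right by (intro sum.cong) (auto simp: mult_scaleC_left sp_mult)
  also have "\<dots> = (if \<gamma> \<in> spec then scaleC (exp (w * complex_of_real (ln \<gamma>))) (sp \<gamma>) else 0)"
    using finite_spec by simp
  finally show ?thesis using sp_zero_iff[of \<gamma>] by auto
qed

lemma pw_mult: "pw v * pw w = pw (v + w)"
  unfolding pw_def[of v] sum_distrib_right pw_def[of "v + w"]
  by (intro sum.cong) (auto simp: mult_scaleC_left sp_pw scaleC_scaleC distrib_right exp_add)

lemma pw_zero: "pw 0 = z"
  by (simp add: pw_def sp_sum)

lemma pw_star: "star (pw w) = pw (cnj w)"
  by (simp add: pw_def star_sum star_scaleC sp_star exp_cnj)

text \<open>A real power is \<open>star h * h\<close> for the power \<open>h\<close> with half the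
  exponent, which is invertible in the corner, and the trace is faithful.\<close>

lemma pw_real_tr: "Im (tr (pw (complex_of_real x))) = 0" "Re (tr (pw (complex_of_real x))) > 0"
proof -
  let ?h = "pw (complex_of_real (x / 2))"
  have e: "pw (complex_of_real x) = star ?h * ?h"
    unfolding pw_star pw_mult complex_cnj_complex_of_real of_real_add[symmetric] by simp
  have "?h \<noteq> 0"
  proof
    assume "?h = 0"
    then have "pw (complex_of_real (x/2) + complex_of_real (-x/2)) = 0"
      unfolding pw_mult[symmetric] by simp
    then show False using z0 by (simp add: pw_zero)
  qed
  then have "tr (pw (complex_of_real x)) \<noteq> 0" using tr_star_self_eq_0[OF pw_corner] e by metis
  moreover show "Im (tr (pw (complex_of_real x))) = 0" using tr_star_pos(1)[OF pw_corner] e by metis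
  moreover have "Re (tr (pw (complex_of_real x))) \<ge> 0" using tr_star_pos(2)[OF pw_corner] e by metis
  ultimately show "Re (tr (pw (complex_of_real x))) > 0"
    by (metis complex_eq_iff order_le_less zero_complex.sel)
qed

lemma pw_sandwich_expand:
  "pw v * x * pw w = (\<Sum>\<gamma>\<in>spec. \<Sum>\<delta>\<in>spec.
     scaleC (exp (v * complex_of_real (ln \<gamma>) + w * complex_of_real (ln \<delta>))) (sp \<gamma> * x * sp \<delta>))"
  unfolding pw_def sum_distrib_left sum_distrib_right
  by (subst sum.swap)
    (simp add: mult_scaleC_left mult_scaleC_right scaleC_scaleC exp_add mult.commute)

lemma sp_pw_sandwich:
  "sp \<gamma> * (pw v * x * pw w) * sp \<delta> =
     scaleC (exp (v * complex_of_real (ln \<gamma>) + w * complex_of_real (ln \<delta>))) (sp \<gamma> * x * sp \<delta>)"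
proof -
  have "sp \<gamma> * (pw v * x * pw w) * sp \<delta> = (sp \<gamma> * pw v) * x * (pw w * sp \<delta>)" by (simp add: mult.assoc)
  then show ?thesis
    by (simp add: sp_pw pw_sp mult_scaleC_left mult_scaleC_right scaleC_scaleC exp_add mult.commute)
qed

text \<open>The orbit of \<open>x\<close> is a finite sum of exponentials whose frequencies are
  differences of logarithms of eigenvalues, hence entire.\<close>

lemma pw_flow_derivative:
  "\<exists>D. ((\<lambda>w. pw (\<i> * w) * x * pw (- \<i> * w)) has_derivative (\<lambda>h. scaleC h D)) (at w)"
proof -
  define c where "c = (\<lambda>\<gamma> \<delta>. \<i> * complex_of_real (ln \<gamma>) - \<i> * complex_of_real (ln \<delta>))"
  have e: "pw (\<i> * w) * x * pw (- \<i> * w) = (\<Sum>\<gamma>\<in>spec. \<Sum>\<delta>\<in>spec. scaleC (exp (c \<gamma> \<delta> * w)) (sp \<gamma> * x * sp \<delta>))" for w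
    unfolding pw_sandwich_expand by (simp add: c_def algebra_simps)
  have 1: "((\<lambda>w. scaleC (exp (c \<gamma> \<delta> * w)) y) has_derivative
      (\<lambda>h. scaleC h (scaleC (c \<gamma> \<delta> * exp (c \<gamma> \<delta> * w)) y))) (at w)" for \<gamma> \<delta> and y :: 'a
  proof -
    have "((\<lambda>w. exp (c \<gamma> \<delta> * w)) has_field_derivative c \<gamma> \<delta> * exp (c \<gamma> \<delta> * w)) (at w)"
      by (auto intro!: derivative_eq_intros)
    then have "((\<lambda>w. exp (c \<gamma> \<delta> * w)) has_derivative (\<lambda>h. c \<gamma> \<delta> * exp (c \<gamma> \<delta> * w) * h)) (at w)"
      by (simp add: has_field_derivative_def)
    from bounded_linear.has_derivative[OF bounded_linear_scaleC_left this, of y] show ?thesis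
      by (simp add: scaleC_scaleC mult.commute)
  qed
  have "((\<lambda>w. \<Sum>\<gamma>\<in>spec. \<Sum>\<delta>\<in>spec. scaleC (exp (c \<gamma> \<delta> * w)) (sp \<gamma> * x * sp \<delta>)) has_derivative
      (\<lambda>h. \<Sum>\<gamma>\<in>spec. \<Sum>\<delta>\<in>spec. scaleC h (scaleC (c \<gamma> \<delta> * exp (c \<gamma> \<delta> * w)) (sp \<gamma> * x * sp \<delta>)))) (at w)"
    by (intro has_derivative_sum 1)
  then show ?thesis unfolding e scaleC_sum_right[symmetric] by blast
qed

text \<open>The functional \<open>x \<mapsto> f (x \<rho>\<^bsup>\<beta>\<^esup>)\<close> is tracial.\<close>

lemma corner_KMS_unique:
  fixes \<beta> :: real
  defines "b \<equiv> complex_of_real \<beta>"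
  assumes add: "\<And>x y. x \<in> zMz \<Longrightarrow> y \<in> zMz \<Longrightarrow> f (x + y) = f x + f y"
    and scale: "\<And>c x. x \<in> zMz \<Longrightarrow> f (scaleC c x) = c * (f x :: complex)"
    and kms: "\<And>x y. x \<in> zMz \<Longrightarrow> y \<in> zMz \<Longrightarrow> f (x * y) = f (y * (pw (- b) * x * pw b))"
    and x: "x \<in> zMz"
  shows "f x = f z / tr (pw (- b)) * tr (pw (- b) * x)"
proof -
  define g where "g = (\<lambda>x. f (x * pw b))"
  have inv: "pw b * pw (- b) = z" "pw (- b) * pw b = z" by (simp_all add: pw_mult pw_zero)
  have gtr: "g y = g z / of_nat d * tr y" if "y \<in> zMz" for y
  proof (rule tracial_unique[OF _ _ _ that])
    fix x y assume xy: "x \<in> zMz" "y \<in> zMz"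
    show "g (x + y) = g x + g y" using xy by (simp add: g_def distrib_right add ccl pw_corner)
    have "g (x * y) = f (x * (y * pw b))" by (simp add: g_def mult.assoc)
    also have "\<dots> = f ((y * pw b) * (pw (- b) * x * pw b))"
      using xy by (intro kms) (auto simp: ccl pw_corner)
    also have "(y * pw b) * (pw (- b) * x * pw b) = y * (pw b * pw (- b)) * x * pw b"
      by (simp add: mult.assoc)
    also have "\<dots> = y * x * pw b" using xy by (simp add: inv corner_zero)
    finally show "g (x * y) = g (y * x)" by (simp add: g_def)
  next
    fix c x assume "x \<in> zMz"
    then show "g (scaleC c x) = c * g x" by (simp add: g_def mult_scaleC_left scale ccl pw_corner)
  qed
  have fx: "f y = g z / of_nat d * tr (pw (- b) * y)" if y: "y \<in> zMz" for y
  proof -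
    have "f y = g (y * pw (- b))" using y inv corner_zero by (simp add: g_def mult.assoc)
    also have "\<dots> = g z / of_nat d * tr (y * pw (- b))" using y by (intro gtr) (auto simp: ccl pw_corner)
    finally show ?thesis using tr_comm[OF y pw_corner] by simp
  qed
  have "tr (pw (- b)) \<noteq> 0" using pw_real_tr(2)[of "- \<beta>"] by (auto simp: b_def)
  then show ?thesis using fx[OF x] fx[OF z_corner] corner_zero[OF pw_corner] by (simp add: field_simps)
qed

text \<open>By the trace property half of the power moves to the right end, and
  \<open>star (x * h) * (x * h)\<close> appears under the trace.\<close>

lemma tr_pw_positive: "positive_functional zMz (\<lambda>x. tr (pw (complex_of_real b) * x))"
  unfolding positive_functional_def
proof (intro conjI ballI allI)
  fix x assume x: "x \<in> zMz"
  let ?h = "pw (complex_of_real (b / 2))"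
  have h: "?h * ?h = pw (complex_of_real b)" unfolding pw_mult of_real_add[symmetric] by simp
  have "tr (pw (complex_of_real b) * (star x * x)) = tr (?h * (?h * (star x * x)))"
    by (simp only: mult.assoc[symmetric] h)
  also have "\<dots> = tr ((?h * (star x * x)) * ?h)"
    using x by (intro tr_comm) (auto simp: pw_corner ccl)
  also have "\<dots> = tr (star (x * ?h) * (x * ?h))" by (simp add: star_mult pw_star mult.assoc)
  finally show "Im (tr (pw (complex_of_real b) * (star x * x))) = 0"
    "0 \<le> Re (tr (pw (complex_of_real b) * (star x * x)))"
    using tr_star_pos[of "x * ?h"] x by (simp_all add: ccl pw_corner)
  show "tr (pw (complex_of_real b) * scaleC c x) = c * tr (pw (complex_of_real b) * x)" for c
    using x by (simp add: mult_scaleC_right tr_scaleC ccl pw_corner)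
  fix y assume "y \<in> zMz"
  then show "tr (pw (complex_of_real b) * (x + y)) = tr (pw (complex_of_real b) * x) + tr (pw (complex_of_real b) * y)"
    using x by (simp add: distrib_left tr_add ccl pw_corner)
qed

end

section \<open>Adjacent levels of the inductive system\<close>

context density_corner
begin

lemma sp_sum_left: "(\<Sum>\<gamma>\<in>spec. sp \<gamma> * u) = z * u"
  by (simp only: sum_distrib_right[symmetric] sp_sum)

lemma sp_sum_right: "(\<Sum>\<gamma>\<in>spec. u * sp \<gamma>) = u * z"
  by (simp only: sum_distrib_left[symmetric] sp_sum)

end

locale kms_system =
  fixes S :: "('a::cstar_algebra) flow_system"
  assumes ind: "inductive_system S" and flow: "flow_on_system S" and density: "flow_density S"
begin

lemma alg_subalgebra: "cstar_subalgebra (alg S n)"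
  using ind unfolding inductive_system_def atomic_wstar_algebra_def wstar_algebra_def by blast

lemmas alg_closed = star_closedD[OF cstar_subalgebra_star_closed[OF alg_subalgebra]]

lemma one_alg: "1 \<in> alg S n" using alg_subalgebra[of n] by (simp add: cstar_subalgebra_def)

lemma alg_Suc: "x \<in> alg S n \<Longrightarrow> x \<in> alg S (Suc n)"
  using ind unfolding inductive_system_def by blast

lemma alg_mono: "m \<le> n \<Longrightarrow> alg S m \<subseteq> alg S n"
  by (rule lift_Suc_mono_le[of "alg S"]) (use alg_Suc in auto)

lemma alg_0: "alg S 0 = range (\<lambda>c. scaleC c 1)"
  using ind unfolding inductive_system_def by blast

lemma alg_predual: "is_predual (alg S n) (predual S n)"
  using ind unfolding inductive_system_def atomic_wstar_algebra_def wstar_algebra_def by blast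

lemma predual_restr: "\<phi> \<in> predual S (Suc n) \<Longrightarrow> restr (alg S n) \<phi> \<in> predual S n"
  using ind unfolding inductive_system_def by blast

lemma predual_has_sum: "\<phi> \<in> predual S n \<Longrightarrow> (\<phi> has_sum \<phi> 1) (Zmin S n)"
  using ind unfolding inductive_system_def atomic_wstar_algebra_def Zmin_def by blast

lemma Zmin_D:
  assumes "z \<in> Zmin S n"
  shows "z \<in> alg S n" "z * z = z" "star z = z" "\<And>x. x \<in> alg S n \<Longrightarrow> x * z = z * x" "z \<noteq> 0"
  using assms by (auto simp: Zmin_def minimal_projections_def projections_def center_def)

text \<open>The product is again a central projection and lies below both factors, so minimality
  makes it 0 or equal to each of them.\<close>

lemma Zmin_orth:
  assumes z: "z \<in> Zmin S n" "w \<in> Zmin S n" "z \<noteq> w"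
  shows "z * w = 0"
proof -
  note zD = Zmin_D[OF z(1)] and wD = Zmin_D[OF z(2)]
  have c: "z * w = w * z" using zD(4) wD(1) by auto
  have qz: "z * w * z = z * w" using c by (metis mult.assoc zD(2))
  have qw: "z * w * w = z * w" by (simp add: mult.assoc wD(2))
  have "z * w * (z * w) = z * w" using qz qw by (metis mult.assoc)
  moreover have "star (z * w) = z * w" by (simp add: star_mult zD(3) wD(3) c[symmetric])
  moreover have "z * w \<in> center (alg S n)"
    unfolding center_def
  proof (intro CollectI conjI ballI)
    show "z * w \<in> alg S n" by (rule alg_closed(3)[OF zD(1) wD(1)])
    fix y assume y: "y \<in> alg S n"
    have "z * w * y = z * (y * w)" by (simp only: mult.assoc wD(4)[OF y])
    also have "\<dots> = y * (z * w)" by (simp only: mult.assoc[symmetric] zD(4)[OF y])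
    finally show "z * w * y = y * (z * w)" .
  qed
  ultimately have q: "z * w \<in> projections (center (alg S n))" by (simp add: projections_def)
  have "z * w = 0 \<or> z * w = z"
    using z(1) q qz unfolding Zmin_def minimal_projections_def by blast
  moreover have "z * w = 0 \<or> z * w = w"
    using z(2) q qw unfolding Zmin_def minimal_projections_def by blast
  ultimately show ?thesis using z(3) by auto
qed

lemma density_corner_Zmin:
  assumes z: "z \<in> Zmin S n"
  shows "density_corner (alg S n) z (hdim S n z) (rep S n z) (dens S n z)"
proof -
  note zD = Zmin_D[OF z]
  interpret matrix_corner "alg S n" z "hdim S n z" "rep S n z"
  proof
    show "matrix_representation z (alg S n) (hdim S n z) (rep S n z)"
      using ind z unfolding inductive_system_def by blast
  qed (fact alg_subalgebra zD)+
  show ?thesis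
    using density z unfolding flow_density_def by unfold_locales blast+
qed

lemma predual_corner_Zmin:
  assumes z: "z \<in> Zmin S n"
  shows "predual_corner (alg S n) z (hdim S n z) (rep S n z) (predual S n)"
proof -
  interpret density_corner "alg S n" z "hdim S n z" "rep S n z" "dens S n z"
    by (rule density_corner_Zmin[OF z])
  show ?thesis using alg_predual by unfold_locales
qed

lemma corner_constants:
  assumes z: "z \<in> Zmin S n"
  shows "spec_proj S n z = density_corner.sp (alg S n) z (dens S n z)"
    "eigs S n z = density_corner.spec (rep S n z) (dens S n z)"
    "dens_powr S n z = density_corner.pw (alg S n) z (rep S n z) (dens S n z)"
    "Tr S n z = matrix_corner.tr (rep S n z)"
proof -
  interpret Z: density_corner "alg S n" z "hdim S n z" "rep S n z" "dens S n z"
    by (rule density_corner_Zmin[OF z])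
  show sp: "spec_proj S n z = Z.sp" by (intro ext) (simp add: spec_proj_def Z.sp_def)
  show e: "eigs S n z = Z.spec" by (simp add: eigs_def Z.spec_def)
  show "dens_powr S n z = Z.pw" by (intro ext) (simp add: dens_powr_def Z.pw_def sp e)
  show "Tr S n z = Z.tr" by (intro ext) (simp add: Tr_def Z.tr_def)
qed

lemma flow_mult: "flow S t (x * y) = flow S t x * flow S t y"
  using flow by (simp add: flow_on_system_def star_automorphism_def)

lemma flow_corner:
  assumes "z \<in> Zmin S n" "x \<in> corner z (alg S n)"
  shows "flow S t x = dens_powr S n z (\<i> * complex_of_real t) * x * dens_powr S n z (- \<i> * complex_of_real t)"
  using density assms unfolding flow_density_def by blast

lemma flow_Zmin:
  assumes z: "z \<in> Zmin S n"
  shows "flow S t z = z"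
proof -
  interpret Z: density_corner "alg S n" z "hdim S n z" "rep S n z" "dens S n z"
    by (rule density_corner_Zmin[OF z])
  show ?thesis
    unfolding flow_corner[OF z Z.z_corner] corner_constants[OF z]
    using Z.corner_zero[OF Z.pw_corner] by (simp add: Z.pw_mult Z.pw_zero)
qed

end

section \<open>Two summands on adjacent levels\<close>

locale corner_pair = kms_system S for S :: "('a::cstar_algebra) flow_system" +
  fixes n :: nat and z z' :: 'a
  assumes z: "z \<in> Zmin S (Suc n)" and z': "z' \<in> Zmin S n"
begin

sublocale Z: density_corner "alg S (Suc n)" z "hdim S (Suc n) z" "rep S (Suc n) z" "dens S (Suc n) z"
  by (rule density_corner_Zmin[OF z])

sublocale Z': density_corner "alg S n" z' "hdim S n z'" "rep S n z'" "dens S n z'"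
  by (rule density_corner_Zmin[OF z'])

lemma corner'_alg: "x \<in> Z'.zMz \<Longrightarrow> x \<in> alg S n" "x \<in> Z'.zMz \<Longrightarrow> x \<in> alg S (Suc n)"
  using Z'.mem_corner alg_Suc by auto

lemma sp'_alg: "Z'.sp \<gamma> \<in> alg S (Suc n)" by (rule corner'_alg(2)[OF Z'.sp_corner])

lemma sp_absorb: "Z.sp \<gamma> * z = Z.sp \<gamma>" "z * Z.sp \<gamma> = Z.sp \<gamma>" "Z'.sp \<gamma> * z' = Z'.sp \<gamma>" "z' * Z'.sp \<gamma> = Z'.sp \<gamma>"
  using Z.corner_zero[OF Z.sp_corner] Z'.corner_zero[OF Z'.sp_corner] by auto

text \<open>Both densities implement the same flow on \<open>zz'A\<^sub>n\<close>, so that their spectral subspaces match.\<close>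

lemma intertwine_zero:
  assumes x: "x \<in> Z'.zMz" and pos: "\<gamma> > 0" "\<delta> > 0" "\<gamma>' > 0" "\<delta>' > 0" and ne: "\<gamma> * \<delta>' \<noteq> \<delta> * \<gamma>'"
  shows "Z.sp \<gamma> * (Z'.sp \<gamma>' * x * Z'.sp \<delta>') * Z.sp \<delta> = 0"
proof -
  define y where "y = Z'.sp \<gamma>' * x * Z'.sp \<delta>'"
  have yc: "y \<in> Z'.zMz" using x by (simp add: y_def Z'.ccl Z'.sp_corner)
  have yA: "y \<in> alg S (Suc n)" using corner'_alg yc by auto
  define k k' where "k = ln \<gamma> - ln \<delta>" and "k' = ln \<gamma>' - ln \<delta>'"
  have ne': "k \<noteq> k'"
  proof
    assume "k = k'"
    then have "ln (\<gamma> * \<delta>') = ln (\<delta> * \<gamma>')" using pos by (simp add: k_def k'_def ln_mult)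
    then show False using ne pos by simp
  qed
  \<comment> \<open>At this time the phases prescribed by the two densities differ by the factor
    -1.\<close>
  define t where "t = pi / (k - k')"
  have fy: "flow S t y = scaleC (exp (\<i> * t * k')) y"
  proof -
    have "flow S t y = Z'.pw (\<i> * complex_of_real t) * (Z'.sp \<gamma>' * x * Z'.sp \<delta>') * Z'.pw (- \<i> * complex_of_real t)"
      unfolding flow_corner[OF z' yc] corner_constants[OF z'] by (simp add: y_def)
    also have "\<dots> = (Z'.pw (\<i> * complex_of_real t) * Z'.sp \<gamma>') * x * (Z'.sp \<delta>' * Z'.pw (- \<i> * complex_of_real t))"
      by (simp only: mult.assoc)
    also have "\<dots> = scaleC (exp (\<i> * t * ln \<gamma>') * exp (- \<i> * t * ln \<delta>')) y"
      by (simp add: Z'.pw_sp Z'.sp_pw mult_scaleC_left mult_scaleC_right scaleC_scaleC y_def mult.commute)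
    also have "exp (\<i> * t * ln \<gamma>') * exp (- \<i> * t * ln \<delta>') = exp (\<i> * t * k')"
      unfolding exp_add[symmetric] by (simp add: k'_def algebra_simps)
    finally show ?thesis .
  qed
  have zy: "z * y \<in> Z.zMz" using yA by (rule Z.z_mult_corner)
  have "flow S t (z * y) = z * flow S t y" by (simp add: flow_mult flow_Zmin[OF z])
  then have "Z.pw (\<i> * complex_of_real t) * (z * y) * Z.pw (- \<i> * complex_of_real t) = scaleC (exp (\<i> * t * k')) (z * y)"
    using flow_corner[OF z zy, of t] fy unfolding corner_constants[OF z] by (simp add: mult_scaleC_right)
  then have "Z.sp \<gamma> * (Z.pw (\<i> * complex_of_real t) * (z * y) * Z.pw (- \<i> * complex_of_real t)) * Z.sp \<delta> =
      Z.sp \<gamma> * scaleC (exp (\<i> * t * k')) (z * y) * Z.sp \<delta>" by simp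
  then have "scaleC (exp (\<i> * t * ln \<gamma> + - \<i> * t * ln \<delta>)) (Z.sp \<gamma> * (z * y) * Z.sp \<delta>) =
      scaleC (exp (\<i> * t * k')) (Z.sp \<gamma> * (z * y) * Z.sp \<delta>)"
    unfolding Z.sp_pw_sandwich by (simp add: mult_scaleC_left mult_scaleC_right)
  moreover have "Z.sp \<gamma> * (z * y) = Z.sp \<gamma> * y" by (simp add: mult.assoc[symmetric] sp_absorb)
  ultimately have "scaleC (exp (\<i> * t * ln \<gamma> + - \<i> * t * ln \<delta>) - exp (\<i> * t * k')) (Z.sp \<gamma> * y * Z.sp \<delta>) = 0"
    by (simp add: scaleC_diff_left)
  moreover have "exp (\<i> * t * ln \<gamma> + - \<i> * t * ln \<delta>) = exp (\<i> * t * k)"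
    by (simp add: k_def algebra_simps)
  moreover have "exp (\<i> * t * k) \<noteq> exp (\<i> * t * k')"
  proof
    assume e: "exp (\<i> * t * k) = exp (\<i> * t * k')"
    have "exp (\<i> * t * k) = exp (\<i> * t * k' + \<i> * complex_of_real (t * (k - k')))" by (simp add: algebra_simps)
    also have "t * (k - k') = pi" using ne' by (simp add: t_def)
    also have "exp (\<i> * t * k' + \<i> * complex_of_real pi) = - exp (\<i> * t * k')" by (simp add: exp_add)
    finally show False using e by simp
  qed
  ultimately show ?thesis by (simp add: y_def)
qed

lemma spec_pos': "\<gamma> \<in> Z.spec \<Longrightarrow> \<gamma> > 0" "\<gamma> \<in> Z'.spec \<Longrightarrow> \<gamma> > 0"
  using Z.spec_pos Z'.spec_pos by auto

text \<open>Inserting the resolution of \<open>z\<close> on the other side of \<open>y\<close>,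
  \<open>intertwine_zero\<close> leaves only the term whose eigenvalue has the same ratio
  \<open>\<eta>\<close> to the lower one. Both one-sided products are thus the same two-sided
  one.\<close>

lemma sp_left_expand:
  assumes x: "x \<in> Z'.zMz" and pos: "\<eta> > 0" "\<gamma>' \<in> Z'.spec" "\<delta>' \<in> Z'.spec"
  defines "y \<equiv> Z'.sp \<gamma>' * x * Z'.sp \<delta>'"
  shows "Z.sp (\<eta> * \<gamma>') * y = Z.sp (\<eta> * \<gamma>') * y * Z.sp (\<eta> * \<delta>')"
    "y * Z.sp (\<eta> * \<delta>') = Z.sp (\<eta> * \<gamma>') * y * Z.sp (\<eta> * \<delta>')"
proof -
  have yA: "y \<in> alg S (Suc n)" using x unfolding y_def by (intro corner'_alg) (simp add: Z'.ccl Z'.sp_corner)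
  have g: "\<gamma>' > 0" "\<delta>' > 0" using pos spec_pos' by auto
  have "Z.sp (\<eta> * \<gamma>') * y = Z.sp (\<eta> * \<gamma>') * (z * y)"
    by (simp only: mult.assoc[symmetric] sp_absorb)
  also have "\<dots> = Z.sp (\<eta> * \<gamma>') * y * z" by (simp only: Z.zc[OF yA, symmetric] mult.assoc)
  also have "\<dots> = (\<Sum>\<delta>\<in>Z.spec. Z.sp (\<eta> * \<gamma>') * y * Z.sp \<delta>)" by (rule Z.sp_sum_right[symmetric])
  also have "\<dots> = (\<Sum>\<delta>\<in>Z.spec. if \<delta> = \<eta> * \<delta>' then Z.sp (\<eta> * \<gamma>') * y * Z.sp (\<eta> * \<delta>') else 0)"
  proof (rule sum.cong[OF refl])
    fix \<delta> assume d: "\<delta> \<in> Z.spec"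
    show "Z.sp (\<eta> * \<gamma>') * y * Z.sp \<delta> = (if \<delta> = \<eta> * \<delta>' then Z.sp (\<eta> * \<gamma>') * y * Z.sp (\<eta> * \<delta>') else 0)"
    proof (cases "\<delta> = \<eta> * \<delta>'")
      case False
      then have "\<eta> * \<gamma>' * \<delta>' \<noteq> \<delta> * \<gamma>'" using g by auto
      then show ?thesis
        using False intertwine_zero[OF x _ spec_pos'(1)[OF d] g, of "\<eta> * \<gamma>'"] pos(1) g by (simp add: y_def)
    qed simp
  qed
  also have "\<dots> = Z.sp (\<eta> * \<gamma>') * y * Z.sp (\<eta> * \<delta>')"
    using Z.finite_spec Z.sp_zero_iff[of "\<eta> * \<delta>'"] by simp
  finally show "Z.sp (\<eta> * \<gamma>') * y = Z.sp (\<eta> * \<gamma>') * y * Z.sp (\<eta> * \<delta>')" .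
  have "y * Z.sp (\<eta> * \<delta>') = y * z * Z.sp (\<eta> * \<delta>')"
    by (simp only: mult.assoc sp_absorb)
  also have "\<dots> = z * (y * Z.sp (\<eta> * \<delta>'))" by (simp only: Z.zc[OF yA] mult.assoc)
  also have "\<dots> = (\<Sum>\<gamma>\<in>Z.spec. Z.sp \<gamma> * y * Z.sp (\<eta> * \<delta>'))"
    by (simp only: Z.sp_sum_left[symmetric] mult.assoc)
  also have "\<dots> = (\<Sum>\<gamma>\<in>Z.spec. if \<gamma> = \<eta> * \<gamma>' then Z.sp (\<eta> * \<gamma>') * y * Z.sp (\<eta> * \<delta>') else 0)"
  proof (rule sum.cong[OF refl])
    fix \<gamma> assume d: "\<gamma> \<in> Z.spec"
    show "Z.sp \<gamma> * y * Z.sp (\<eta> * \<delta>') = (if \<gamma> = \<eta> * \<gamma>' then Z.sp (\<eta> * \<gamma>') * y * Z.sp (\<eta> * \<delta>') else 0)"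
    proof (cases "\<gamma> = \<eta> * \<gamma>'")
      case False
      then have "\<gamma> * \<delta>' \<noteq> \<eta> * \<delta>' * \<gamma>'" using g by auto
      then show ?thesis
        using False intertwine_zero[OF x spec_pos'(1)[OF d] _ g, of "\<eta> * \<delta>'"] pos(1) g by (simp add: y_def)
    qed simp
  qed
  also have "\<dots> = Z.sp (\<eta> * \<gamma>') * y * Z.sp (\<eta> * \<delta>')"
    using Z.finite_spec Z.sp_zero_iff[of "\<eta> * \<gamma>'"] by simp
  finally show "y * Z.sp (\<eta> * \<delta>') = Z.sp (\<eta> * \<gamma>') * y * Z.sp (\<eta> * \<delta>')" .
qed

text \<open>The case of \<open>sp_left_expand\<close> with \<open>x = z'\<close>, equal lower
  eigenvalues and ratio \<open>\<gamma> / \<gamma>'\<close>; otherwise one of the projections is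
  0.\<close>

lemma sp_commute: "Z.sp \<gamma> * Z'.sp \<gamma>' = Z'.sp \<gamma>' * Z.sp \<gamma>"
proof (cases "\<gamma>' \<in> Z'.spec \<and> \<gamma> > 0")
  case True
  then have g: "\<gamma>' > 0" using spec_pos' by auto
  have e: "Z'.sp \<gamma>' * z' * Z'.sp \<gamma>' = Z'.sp \<gamma>'" by (simp add: sp_absorb Z'.sp_idem)
  show ?thesis
    using sp_left_expand[OF Z'.z_corner, of "\<gamma> / \<gamma>'" \<gamma>' \<gamma>'] True g unfolding e by simp
next
  case False
  then have "Z'.sp \<gamma>' = 0 \<or> Z.sp \<gamma> = 0" using Z'.sp_zero_iff Z.sp_zero_iff spec_pos' by blast
  then show ?thesis by auto
qed

text \<open>Since the two families of spectral projections commute, this is the spectral projection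
  at \<open>\<eta>\<close> of the ratio of the upper density to the lower one, cut down to
  \<open>z * z'\<close>.\<close>

definition q :: "real \<Rightarrow> 'a" where
  "q \<eta> = (\<Sum>\<gamma>'\<in>Z'.spec. Z.sp (\<eta> * \<gamma>') * Z'.sp \<gamma>')"

lemma q_corner: "q \<eta> \<in> Z.zMz"
  unfolding q_def by (intro Z.ccl Z.corner_ideal Z.sp_corner sp'_alg)

lemma q_z': "q \<eta> * z' = q \<eta>"
  by (simp add: q_def sum_distrib_right mult.assoc sp_absorb)

lemma sp_sp_orth:
  "Z.sp \<gamma> * Z'.sp \<gamma>' * (Z.sp \<delta> * Z'.sp \<delta>') = (if \<gamma> = \<delta> \<and> \<gamma>' = \<delta>' then Z.sp \<gamma> * Z'.sp \<gamma>' else 0)"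
proof -
  have "Z.sp \<gamma> * Z'.sp \<gamma>' * (Z.sp \<delta> * Z'.sp \<delta>') = Z.sp \<gamma> * (Z'.sp \<gamma>' * Z.sp \<delta>) * Z'.sp \<delta>'"
    by (simp only: mult.assoc)
  also have "\<dots> = (Z.sp \<gamma> * Z.sp \<delta>) * (Z'.sp \<gamma>' * Z'.sp \<delta>')"
    by (simp only: sp_commute[symmetric]) (simp only: mult.assoc)
  finally have "Z.sp \<gamma> * Z'.sp \<gamma>' * (Z.sp \<delta> * Z'.sp \<delta>') = (Z.sp \<gamma> * Z.sp \<delta>) * (Z'.sp \<gamma>' * Z'.sp \<delta>')" .
  then show ?thesis by (simp add: Z.sp_mult Z'.sp_mult)
qed

lemma q_idem: "q \<eta> * q \<eta> = q \<eta>"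
proof -
  have "q \<eta> * q \<eta> = (\<Sum>\<gamma>'\<in>Z'.spec. \<Sum>\<delta>'\<in>Z'.spec. if \<gamma>' = \<delta>' then Z.sp (\<eta> * \<gamma>') * Z'.sp \<gamma>' else 0)"
    unfolding q_def sum_product by (intro sum.cong) (auto simp: sp_sp_orth)
  also have "\<dots> = q \<eta>" using Z'.finite_spec by (simp add: q_def)
  finally show ?thesis .
qed

lemma q_star: "star (q \<eta>) = q \<eta>"
  by (simp add: q_def star_sum star_mult Z.sp_star Z'.sp_star sp_commute)

text \<open>Crossing a block of \<open>x\<close> between two lower eigenspaces changes the lower
  eigenvalue from \<open>\<gamma>'\<close> to \<open>\<delta>'\<close> and the upper one from
  \<open>\<eta> \<gamma>'\<close> to \<open>\<eta> \<delta>'\<close>: the ratio is preserved, and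
  \<open>q\<close> collects all blocks of one ratio.\<close>

lemma q_commute:
  assumes \<eta>: "\<eta> > 0" and x: "x \<in> Z'.zMz"
  shows "q \<eta> * x = x * q \<eta>"
proof -
  define y where "y = (\<lambda>\<gamma>' \<delta>'. Z'.sp \<gamma>' * x * Z'.sp \<delta>')"
  have xz: "x * z' = x" "z' * x = x" using x Z'.corner_zero by auto
  have "q \<eta> * x = (\<Sum>\<gamma>'\<in>Z'.spec. Z.sp (\<eta> * \<gamma>') * Z'.sp \<gamma>' * x * z')"
    unfolding q_def sum_distrib_right by (intro sum.cong refl) (simp only: mult.assoc xz)
  also have "\<dots> = (\<Sum>\<gamma>'\<in>Z'.spec. \<Sum>\<delta>'\<in>Z'.spec. Z.sp (\<eta> * \<gamma>') * y \<gamma>' \<delta>')"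
    unfolding Z'.sp_sum_right[symmetric] by (intro sum.cong refl) (simp only: y_def mult.assoc)
  also have "\<dots> = (\<Sum>\<gamma>'\<in>Z'.spec. \<Sum>\<delta>'\<in>Z'.spec. y \<gamma>' \<delta>' * Z.sp (\<eta> * \<delta>'))"
  proof (intro sum.cong refl)
    fix \<gamma>' \<delta>' assume "\<gamma>' \<in> Z'.spec" "\<delta>' \<in> Z'.spec"
    from sp_left_expand[OF x \<eta> this] show "Z.sp (\<eta> * \<gamma>') * y \<gamma>' \<delta>' = y \<gamma>' \<delta>' * Z.sp (\<eta> * \<delta>')"
      by (simp add: y_def)
  qed
  also have "\<dots> = (\<Sum>\<delta>'\<in>Z'.spec. \<Sum>\<gamma>'\<in>Z'.spec. Z'.sp \<gamma>' * (x * (Z'.sp \<delta>' * Z.sp (\<eta> * \<delta>'))))"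
    by (subst sum.swap) (simp only: y_def mult.assoc)
  also have "\<dots> = (\<Sum>\<delta>'\<in>Z'.spec. x * (Z'.sp \<delta>' * Z.sp (\<eta> * \<delta>')))"
    unfolding Z'.sp_sum_left by (simp only: mult.assoc[symmetric] xz)
  also have "\<dots> = x * q \<eta>"
    unfolding q_def sum_distrib_left by (simp only: sp_commute)
  finally show ?thesis .
qed

text \<open>As \<open>q \<eta>\<close> commutes with the lower matrix algebra,
  \<open>x \<mapsto> Tr (q \<eta> x)\<close> is tracial on it and therefore a multiple of the lower
  trace.\<close>

lemma tr_q:
  assumes \<eta>: "\<eta> > 0" and x: "x \<in> Z'.zMz"
  shows "Z.tr (q \<eta> * x) = Z.tr (q \<eta>) / of_nat (hdim S n z') * Z'.tr x"
proof -
  have qx: "q \<eta> * x \<in> Z.zMz" if "x \<in> Z'.zMz" for x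
    using that by (intro Z.corner_ideal q_corner corner'_alg)
  have "Z.tr (q \<eta> * x) = Z.tr (q \<eta> * z') / of_nat (hdim S n z') * Z'.tr x"
  proof (rule Z'.tracial_unique[OF _ _ _ x])
    fix x y assume xy: "x \<in> Z'.zMz" "y \<in> Z'.zMz"
    show "Z.tr (q \<eta> * (x + y)) = Z.tr (q \<eta> * x) + Z.tr (q \<eta> * y)"
      using xy by (simp add: distrib_left Z.tr_add qx)
    have yA: "y \<in> alg S (Suc n)" using xy corner'_alg by auto
    have "q \<eta> * (x * y) = (q \<eta> * x) * (z * y)"
      by (simp only: mult.assoc[symmetric] Z.corner_zero[OF qx[OF xy(1)]])
    then have "Z.tr (q \<eta> * (x * y)) = Z.tr ((z * y) * (q \<eta> * x))"
      using Z.tr_comm[OF qx[OF xy(1)] Z.z_mult_corner[OF yA]] by simp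
    also have "(z * y) * (q \<eta> * x) = y * (q \<eta> * x)"
      unfolding Z.zc[OF yA, symmetric] by (simp only: mult.assoc[of y z] Z.corner_zero[OF qx[OF xy(1)]])
    also have "\<dots> = q \<eta> * (y * x)" by (simp only: mult.assoc[symmetric] q_commute[OF \<eta> xy(2)])
    finally show "Z.tr (q \<eta> * (x * y)) = Z.tr (q \<eta> * (y * x))" .
  next
    fix c x assume "x \<in> Z'.zMz"
    then show "Z.tr (q \<eta> * scaleC c x) = c * Z.tr (q \<eta> * x)"
      by (simp add: mult_scaleC_right Z.tr_scaleC qx)
  qed
  then show ?thesis by (simp add: q_z')
qed

text \<open>\<open>q \<eta>\<close> times a rank one projection of the lower algebra is an
  idempotent; its trace is an integer and by \<open>tr_q\<close> equals \<open>Tr (q \<eta>)\<close>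
  divided by the lower dimension.\<close>

lemma tr_q_multiple:
  assumes \<eta>: "\<eta> > 0"
  shows "\<exists>k::nat. Z.tr (q \<eta>) = of_nat (k * hdim S n z')"
proof -
  define e where "e = Z'.unit 0 0"
  have e: "e \<in> Z'.zMz" "e * e = e" "Z'.tr e = 1"
    using Z'.d_pos by (simp_all add: e_def Z'.unit Z'.unit_mult Z'.tr_unit)
  have "q \<eta> * e * (q \<eta> * e) = q \<eta> * (e * q \<eta>) * e" by (simp only: mult.assoc)
  also have "\<dots> = (q \<eta> * q \<eta>) * (e * e)"
    by (simp only: q_commute[OF \<eta> e(1), symmetric]) (simp only: mult.assoc)
  finally have "q \<eta> * e * (q \<eta> * e) = (q \<eta> * q \<eta>) * (e * e)" .
  then have "q \<eta> * e * (q \<eta> * e) = q \<eta> * e" by (simp add: q_idem e)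
  moreover have "q \<eta> * e \<in> Z.zMz" using e by (intro Z.corner_ideal q_corner corner'_alg)
  ultimately obtain k :: nat where "Z.tr (q \<eta> * e) = of_nat k" using Z.tr_idempotent by blast
  then have "Z.tr (q \<eta>) / of_nat (hdim S n z') = of_nat k" using tr_q[OF \<eta> e(1)] e by simp
  then have "Z.tr (q \<eta>) = of_nat (k * hdim S n z')" using Z'.d_pos by (simp add: field_simps)
  then show ?thesis ..
qed

section \<open>Functional calculus of the ratio of the densities\<close>

definition ratios :: "real set" where
  "ratios = (\<lambda>(\<gamma>, \<gamma>'). \<gamma> / \<gamma>') ` (Z.spec \<times> Z'.spec)"

lemma finite_ratios: "finite ratios"
  by (simp add: ratios_def Z.finite_spec Z'.finite_spec)

lemma ratios_pos: "\<eta> \<in> ratios \<Longrightarrow> \<eta> > 0"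
  using spec_pos' by (auto simp: ratios_def)

lemma q_zero: "\<eta> \<notin> ratios \<Longrightarrow> q \<eta> = 0"
proof -
  assume \<eta>: "\<eta> \<notin> ratios"
  have "Z.sp (\<eta> * \<gamma>') = 0" if "\<gamma>' \<in> Z'.spec" for \<gamma>'
  proof -
    have "\<eta> * \<gamma>' \<notin> Z.spec"
    proof
      assume "\<eta> * \<gamma>' \<in> Z.spec"
      then have "\<eta> * \<gamma>' / \<gamma>' \<in> ratios" using that by (auto simp: ratios_def image_iff intro!: bexI)
      then show False using \<eta> spec_pos'(2)[OF that] by simp
    qed
    then show ?thesis using Z.sp_zero_iff by blast
  qed
  then show "q \<eta> = 0" by (simp add: q_def)
qed

text \<open>For fixed \<open>\<gamma>'\<close> the substitution
  \<open>\<eta> = \<gamma> / \<gamma>'\<close> is injective, and the remaining ratios contribute 0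
  because \<open>\<eta> \<gamma>'\<close> is no upper eigenvalue.\<close>

lemma sum_q:
  "(\<Sum>\<eta>\<in>ratios. scaleC (f \<eta>) (q \<eta>)) =
     (\<Sum>\<gamma>'\<in>Z'.spec. \<Sum>\<gamma>\<in>Z.spec. scaleC (f (\<gamma> / \<gamma>')) (Z.sp \<gamma> * Z'.sp \<gamma>'))"
proof -
  have "(\<Sum>\<eta>\<in>ratios. scaleC (f \<eta>) (q \<eta>)) =
      (\<Sum>\<gamma>'\<in>Z'.spec. \<Sum>\<eta>\<in>ratios. scaleC (f \<eta>) (Z.sp (\<eta> * \<gamma>') * Z'.sp \<gamma>'))"
    unfolding q_def scaleC_sum_right by (rule sum.swap)
  also have "\<dots> = (\<Sum>\<gamma>'\<in>Z'.spec. \<Sum>\<gamma>\<in>Z.spec. scaleC (f (\<gamma> / \<gamma>')) (Z.sp \<gamma> * Z'.sp \<gamma>'))"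
  proof (rule sum.cong[OF refl])
    fix \<gamma>' assume g: "\<gamma>' \<in> Z'.spec"
    have g0: "\<gamma>' > 0" using spec_pos' g by auto
    have inj: "inj_on (\<lambda>\<gamma>. \<gamma> / \<gamma>') Z.spec" using g0 by (auto simp: inj_on_def)
    have "(\<Sum>\<gamma>\<in>Z.spec. scaleC (f (\<gamma> / \<gamma>')) (Z.sp \<gamma> * Z'.sp \<gamma>')) =
        (\<Sum>\<eta>\<in>(\<lambda>\<gamma>. \<gamma> / \<gamma>') ` Z.spec. scaleC (f \<eta>) (Z.sp (\<eta> * \<gamma>') * Z'.sp \<gamma>'))"
      using g0 by (simp add: sum.reindex[OF inj])
    also have "\<dots> = (\<Sum>\<eta>\<in>ratios. scaleC (f \<eta>) (Z.sp (\<eta> * \<gamma>') * Z'.sp \<gamma>'))"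
    proof (rule sum.mono_neutral_left[OF finite_ratios])
      show "(\<lambda>\<gamma>. \<gamma> / \<gamma>') ` Z.spec \<subseteq> ratios" using g by (auto simp: ratios_def)
      show "\<forall>\<eta>\<in>ratios - (\<lambda>\<gamma>. \<gamma> / \<gamma>') ` Z.spec. scaleC (f \<eta>) (Z.sp (\<eta> * \<gamma>') * Z'.sp \<gamma>') = 0"
      proof
        fix \<eta> assume "\<eta> \<in> ratios - (\<lambda>\<gamma>. \<gamma> / \<gamma>') ` Z.spec"
        then have "\<eta> * \<gamma>' \<notin> Z.spec" using g0 by (auto simp: image_iff)
        then have "Z.sp (\<eta> * \<gamma>') = 0" using Z.sp_zero_iff by blast
        then show "scaleC (f \<eta>) (Z.sp (\<eta> * \<gamma>') * Z'.sp \<gamma>') = 0" by simp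
      qed
    qed
    finally show "(\<Sum>\<eta>\<in>ratios. scaleC (f \<eta>) (Z.sp (\<eta> * \<gamma>') * Z'.sp \<gamma>')) =
      (\<Sum>\<gamma>\<in>Z.spec. scaleC (f (\<gamma> / \<gamma>')) (Z.sp \<gamma> * Z'.sp \<gamma>'))" by simp
  qed
  finally show ?thesis .
qed

lemma sum_q_one: "(\<Sum>\<eta>\<in>ratios. q \<eta>) = z * z'"
proof -
  have "(\<Sum>\<eta>\<in>ratios. q \<eta>) = (\<Sum>\<gamma>'\<in>Z'.spec. \<Sum>\<gamma>\<in>Z.spec. Z.sp \<gamma> * Z'.sp \<gamma>')"
    using sum_q[of "\<lambda>_. 1"] by simp
  also have "\<dots> = (\<Sum>\<gamma>\<in>Z.spec. Z.sp \<gamma>) * (\<Sum>\<gamma>'\<in>Z'.spec. Z'.sp \<gamma>')"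
    unfolding sum_product by (rule sum.swap)
  finally show ?thesis by (simp only: Z.sp_sum Z'.sp_sum)
qed

text \<open>The left side is the power \<open>b\<close> of the ratio of the commuting densities by
  its own spectral resolution.\<close>

lemma sum_q_pw:
  "(\<Sum>\<eta>\<in>ratios. scaleC (complex_of_real (\<eta> powr b)) (q \<eta>)) = Z.pw (complex_of_real b) * Z'.pw (- complex_of_real b)"
proof -
  have e: "complex_of_real ((\<gamma> / \<gamma>') powr b) =
      exp (complex_of_real b * complex_of_real (ln \<gamma>)) * exp (- complex_of_real b * complex_of_real (ln \<gamma>'))"
    if "\<gamma> \<in> Z.spec" "\<gamma>' \<in> Z'.spec" for \<gamma> \<gamma>'
  proof -
    have "\<gamma> > 0" "\<gamma>' > 0" using that spec_pos' by auto
    then have "(\<gamma> / \<gamma>') powr b = exp (b * ln \<gamma>) * exp (- b * ln \<gamma>')"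
      by (simp add: powr_def ln_div right_diff_distrib exp_diff exp_minus field_simps)
    then show ?thesis by (simp flip: exp_of_real)
  qed
  have "(\<Sum>\<eta>\<in>ratios. scaleC (complex_of_real (\<eta> powr b)) (q \<eta>)) =
     (\<Sum>\<gamma>'\<in>Z'.spec. \<Sum>\<gamma>\<in>Z.spec. scaleC (exp (complex_of_real b * complex_of_real (ln \<gamma>))) (Z.sp \<gamma>) *
        scaleC (exp (- complex_of_real b * complex_of_real (ln \<gamma>'))) (Z'.sp \<gamma>'))"
    unfolding sum_q by (intro sum.cong refl) (simp add: e mult_scaleC_left mult_scaleC_right scaleC_scaleC mult.commute)
  also have "\<dots> = Z.pw (complex_of_real b) * Z'.pw (- complex_of_real b)"
    unfolding Z.pw_def Z'.pw_def sum_product by (rule sum.swap)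
  finally show ?thesis .
qed

text \<open>The weight \<open>\<Sum>\<^sub>\<eta> \<eta>\<^bsup>-\<beta>\<^esup> Tr (q\<^sub>\<eta>) / dim(z')\<close> is the ratio of the two KMS functionals on \<open>z'A\<^sub>n\<close>.\<close>

lemma tr_pw_restrict:
  assumes x: "x \<in> Z'.zMz"
  shows "Z.tr (Z.pw (- complex_of_real b) * x) =
    (\<Sum>\<eta>\<in>ratios. complex_of_real (\<eta> powr (- b)) * Z.tr (q \<eta>)) / of_nat (hdim S n z') *
      Z'.tr (Z'.pw (- complex_of_real b) * x)"
proof -
  \<comment> \<open>Absorbing the lower power into \<open>y\<close> gives
    \<open>x = Z'.pw b * y\<close>, so the power of the ratio appears in front of \<open>y\<close>,
    and \<open>tr_q\<close> applies to each of its spectral projections.\<close>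
  define y where "y = Z'.pw (- complex_of_real b) * x"
  have y: "y \<in> Z'.zMz" using x by (simp add: y_def Z'.ccl Z'.pw_corner)
  have py: "Z'.pw (complex_of_real b) * y = x"
    using x by (simp add: y_def mult.assoc[symmetric] Z'.pw_mult Z'.pw_zero Z'.corner_zero)
  have "Z.pw (- complex_of_real b) * x = (\<Sum>\<eta>\<in>ratios. scaleC (complex_of_real (\<eta> powr (- b))) (q \<eta>)) * y"
    using sum_q_pw[of "- b"] py by (simp add: mult.assoc)
  also have "\<dots> = (\<Sum>\<eta>\<in>ratios. scaleC (complex_of_real (\<eta> powr (- b))) (q \<eta> * y))"
    by (simp add: sum_distrib_right mult_scaleC_left)
  finally have "Z.tr (Z.pw (- complex_of_real b) * x) =
      (\<Sum>\<eta>\<in>ratios. complex_of_real (\<eta> powr (- b)) * Z.tr (q \<eta> * y))"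
    using y by (simp add: Z.tr_sum Z.tr_scaleC Z.ccl Z.corner_ideal q_corner corner'_alg)
  also have "\<dots> = (\<Sum>\<eta>\<in>ratios. complex_of_real (\<eta> powr (- b)) * Z.tr (q \<eta>) / of_nat (hdim S n z') * Z'.tr y)"
    by (intro sum.cong refl) (simp add: tr_q[OF ratios_pos y])
  finally show ?thesis by (simp add: y_def sum_divide_distrib sum_distrib_right)
qed

end

section \<open>The extended graph and its weights\<close>

lemma restr_apply: "x \<in> M \<Longrightarrow> restr M f x = f x"
  by (simp add: restr_def)

section \<open>Countability of the vertex set\<close>

context kms_system
begin

lemma eigs_Gam: "z \<in> Zmin S n \<Longrightarrow> eigs S n z \<subseteq> Gam S"
  using Gam_eig by blast

lemma eigs_pos:
  assumes z: "z \<in> Zmin S n" and "\<gamma> \<in> eigs S n z"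
  shows "\<gamma> > 0"
  using density_corner.spec_pos[OF density_corner_Zmin[OF z]] assms(2) by (simp only: corner_constants(2)[OF z])

lemma finite_eigs:
  assumes z: "z \<in> Zmin S n"
  shows "finite (eigs S n z)"
  using density_corner.finite_spec[OF density_corner_Zmin[OF z]] by (simp only: corner_constants(2)[OF z])

lemma Gam_pos: "\<gamma> \<in> Gam S \<Longrightarrow> \<gamma> > 0"
  by (induction rule: Gam.induct) (auto simp: eigs_pos)

lemma Gam_divide: "\<gamma> \<in> Gam S \<Longrightarrow> \<delta> \<in> Gam S \<Longrightarrow> \<gamma> / \<delta> \<in> Gam S"
  by (simp add: divide_inverse Gam.intros)

lemma hdim_pos: "z \<in> Zmin S n \<Longrightarrow> hdim S n z > 0"
  using matrix_corner.d_pos[OF density_corner.axioms(1)[OF density_corner_Zmin]] .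

text \<open>A normal functional is summable over the minimal central projections, hence nonzero at
  only countably many. Some normal functional is nonzero at a given \<open>z\<close>, and a close
  member of the countable dense set still is, because \<open>norm z = 1\<close>.\<close>

lemma countable_Zmin: "countable (Zmin S n)"
proof -
  let ?M = "alg S n" and ?F = "predual S n"
  have sep: "separable_predual ?M ?F" using ind by (simp add: inductive_system_def)
  then obtain D where D: "D \<subseteq> ?F" "countable D"
    "\<And>\<phi> e. \<phi> \<in> ?F \<Longrightarrow> e > 0 \<Longrightarrow> \<exists>\<psi>\<in>D. dual_norm ?M (\<lambda>x. \<phi> x - \<psi> x) < e"
    unfolding separable_predual_def by blast
  have c: "countable {z \<in> Zmin S n. \<psi> z \<noteq> 0}" if "\<psi> \<in> D" for \<psi>
  proof -
    have "\<psi> summable_on Zmin S n" using predual_has_sum D(1) that by (auto simp: summable_on_def)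
    then have "(\<lambda>z. norm (\<psi> z)) summable_on Zmin S n" by (simp flip: summable_on_iff_abs_summable_on_complex)
    then show ?thesis by (rule Infinite_Sum.abs_summable_countable)
  qed
  have "Zmin S n \<subseteq> (\<Union>\<psi>\<in>D. {z \<in> Zmin S n. \<psi> z \<noteq> 0})"
  proof
    fix z assume z: "z \<in> Zmin S n"
    interpret predual_corner ?M z "hdim S n z" "rep S n z" ?F by (rule predual_corner_Zmin[OF z])
    have "\<exists>\<phi>\<in>?F. \<phi> z \<noteq> 0"
    proof (rule ccontr)
      assume "\<not> ?thesis"
      then have 0: "\<phi> z = 0" if "\<phi> \<in> ?F" for \<phi> using that by blast
      have "norm z = (SUP \<phi>\<in>{\<phi> \<in> ?F. dual_norm ?M \<phi> \<le> 1}. cmod (\<phi> z))" by (rule F_props(5)[OF zM])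
      also have "\<dots> = (SUP \<phi>\<in>{\<phi> \<in> ?F. dual_norm ?M \<phi> \<le> 1}. 0::real)" by (intro SUP_cong) (auto simp: 0)
      also have "\<dots> = 0"
      proof -
        have "dual_norm ?M (\<lambda>_. 0) \<le> 1" using Mcl(1) by (intro dual_norm_least) auto
        then show ?thesis using F_props(2) by (intro cSUP_const) blast
      qed
      finally show False by (simp add: norm_z)
    qed
    then obtain \<phi> where \<phi>: "\<phi> \<in> ?F" "\<phi> z \<noteq> 0" by blast
    then obtain \<psi> where \<psi>: "\<psi> \<in> D" "dual_norm ?M (\<lambda>x. \<phi> x - \<psi> x) < cmod (\<phi> z)"
      using D(3)[OF \<phi>(1), of "cmod (\<phi> z)"] by auto
    have "(\<lambda>x. (- 1) * \<psi> x + \<phi> x) \<in> ?F" using \<psi>(1) D(1) \<phi>(1) by (intro F_props(3)) auto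
    then have "(\<lambda>x. \<phi> x - \<psi> x) \<in> ?F" by simp
    from FD(3)[OF this zM] have "cmod (\<phi> z - \<psi> z) < cmod (\<phi> z)" using \<psi>(2) by (simp add: norm_z)
    then have "\<psi> z \<noteq> 0" by auto
    then show "z \<in> (\<Union>\<psi>\<in>D. {z \<in> Zmin S n. \<psi> z \<noteq> 0})" using z \<psi>(1) by blast
  qed
  then show ?thesis using c D(2) by (meson countable_UN countable_subset)
qed

text \<open>Every element is a finite word in the eigenvalues and their inverses, which form a
  countable alphabet.\<close>

lemma countable_Gam: "countable (Gam S)"
proof -
  define E where "E = (\<Union>n. \<Union>z\<in>Zmin S n. eigs S n z)"
  define E' where "E' = E \<union> inverse ` E"
  have "countable E" unfolding E_def
    by (intro countable_UN countable_Zmin) (auto intro: countable_finite finite_eigs)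
  then have "countable E'" by (simp add: E'_def)
  then have c: "countable (prod_list ` lists E')" by (intro countable_image countable_lists)
  have inv: "inverse (prod_list xs) \<in> prod_list ` lists E'" if "xs \<in> lists E'" for xs
  proof -
    have "inverse (prod_list xs) = prod_list (map inverse xs)" by (induction xs) auto
    moreover have "inverse x \<in> E'" if "x \<in> E'" for x using that by (auto simp: E'_def)
    then have "map inverse xs \<in> lists E'" using \<open>xs \<in> lists E'\<close> by auto
    ultimately show ?thesis by blast
  qed
  have mem: "\<gamma> \<in> prod_list ` lists E'" if "\<gamma> \<in> Gam S" for \<gamma>
    using that
  proof (induction rule: Gam.induct)
    case (Gam_eig z n \<gamma>)
    then have "[\<gamma>] \<in> lists E'" by (auto simp: E'_def E_def)
    then show ?case by (metis image_eqI mult.right_neutral prod_list.Cons prod_list.Nil)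
  next
    case Gam_one
    show ?case by (intro image_eqI[of _ _ "[]"]) auto
  next
    case (Gam_mult \<gamma> \<gamma>')
    then obtain xs ys where "xs \<in> lists E'" "ys \<in> lists E'" "\<gamma> = prod_list xs" "\<gamma>' = prod_list ys" by blast
    then show ?case by (intro image_eqI[of _ _ "xs @ ys"]) auto
  qed (use inv in blast)
  show ?thesis by (rule countable_subset[OF _ c]) (use mem in blast)
qed

lemma countable_Zext: "countable (Zext S n)"
  by (simp add: Zext_def countable_Zmin countable_Gam)

end

section \<open>Edge weights between two summands\<close>

context corner_pair
begin

lemma ratios_Gam: "ratios \<subseteq> Gam S"
  using eigs_Gam[OF z] eigs_Gam[OF z'] Gam_divide
  by (auto simp: ratios_def corner_constants(2)[OF z, symmetric] corner_constants(2)[OF z', symmetric])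

lemma qproj_eq: "qproj S n z z' \<eta> = q \<eta>"
proof -
  have "qproj S n z z' \<eta> = (\<Sum>\<^sub>\<infinity>\<gamma>'\<in>Gam S. Z.sp (\<eta> * \<gamma>') * Z'.sp \<gamma>')"
    by (simp add: qproj_def corner_constants(1)[OF z] corner_constants(1)[OF z'])
  also have "\<dots> = (\<Sum>\<^sub>\<infinity>\<gamma>'\<in>Z'.spec. Z.sp (\<eta> * \<gamma>') * Z'.sp \<gamma>')"
    using eigs_Gam[OF z'] Z'.sp_zero_iff unfolding corner_constants(2)[OF z']
    by (intro infsum_cong_neutral) auto
  finally show ?thesis by (simp add: q_def Z'.finite_spec)
qed

lemma tr_q_nonneg: "Re (Z.tr (q \<eta>)) \<ge> 0"
  using Z.tr_star_pos(2)[OF q_corner, of \<eta>] by (simp add: q_star q_idem)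

lemma q_eq_0: "z * z' = 0 \<Longrightarrow> q \<eta> = 0"
proof -
  assume 0: "z * z' = 0"
  have "Z.sp \<gamma> * Z'.sp \<gamma>' = 0" for \<gamma> \<gamma>'
  proof -
    have "Z.sp \<gamma> * Z'.sp \<gamma>' = Z.sp \<gamma> * z * (z' * Z'.sp \<gamma>')" by (simp only: sp_absorb)
    also have "\<dots> = Z.sp \<gamma> * (z * z') * Z'.sp \<gamma>'" by (simp only: mult.assoc)
    finally show ?thesis using 0 by simp
  qed
  then show "q \<eta> = 0" by (simp add: q_def)
qed

text \<open>The case distinction in \<open>mu\<close> disappears, because \<open>q\<close> vanishes
  when \<open>z * z' = 0\<close>.\<close>

lemma mu_eq: "mu S n (z, \<gamma>) (z', \<gamma>') = Re (Z.tr (q (inverse \<gamma> * \<gamma>'))) / real (hdim S (Suc n) z)"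
  using q_eq_0 by (simp add: mu_def qproj_eq corner_constants(4)[OF z] Z.tr_zero)

lemma tr_zz': "Re (Z.tr (z * z')) = (\<Sum>\<eta>\<in>ratios. Re (Z.tr (q \<eta>)))"
proof -
  have "Z.tr (z * z') = (\<Sum>\<eta>\<in>ratios. Z.tr (q \<eta>))"
    unfolding sum_q_one[symmetric] by (rule Z.tr_sum) (rule q_corner)
  then show ?thesis by simp
qed

text \<open>Different labels \<open>\<gamma>'\<close> belong to different ratios, and the
  projections \<open>q\<close> of all ratios add up to \<open>z * z'\<close>.\<close>

lemma sum_tr_q_le:
  assumes "finite G" "G \<subseteq> {0<..}" "\<gamma> > 0"
  shows "(\<Sum>\<gamma>'\<in>G. Re (Z.tr (q (inverse \<gamma> * \<gamma>')))) \<le> Re (Z.tr (z * z'))"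
proof -
  have "(\<Sum>\<gamma>'\<in>G. Re (Z.tr (q (inverse \<gamma> * \<gamma>')))) = (\<Sum>\<eta>\<in>(\<lambda>\<gamma>'. inverse \<gamma> * \<gamma>') ` G. Re (Z.tr (q \<eta>)))"
    using assms(3) by (subst sum.reindex) (auto simp: inj_on_def)
  also have "\<dots> = (\<Sum>\<eta>\<in>(\<lambda>\<gamma>'. inverse \<gamma> * \<gamma>') ` G \<inter> ratios. Re (Z.tr (q \<eta>)))"
    using assms(1) q_zero Z.tr_zero by (intro sum.mono_neutral_right) auto
  also have "\<dots> \<le> (\<Sum>\<eta>\<in>ratios. Re (Z.tr (q \<eta>)))"
    using tr_q_nonneg by (intro sum_mono2 finite_ratios) auto
  finally show ?thesis by (simp add: tr_zz')
qed

text \<open>Substituting \<open>\<gamma> = \<gamma>' / \<eta>\<close> turns the fibre sum into a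
  finite sum over the ratios and splits off the factor \<open>\<gamma>' powr b\<close>.\<close>

lemma nn_integral_mu_powr:
  assumes \<gamma>': "\<gamma>' \<in> Gam S"
  shows "(\<integral>\<^sup>+\<gamma>. ennreal (mu S n (z, \<gamma>) (z', \<gamma>') * \<gamma> powr b) \<partial>count_space (Gam S)) =
    ennreal (\<gamma>' powr b * (\<Sum>\<eta>\<in>ratios. \<eta> powr (- b) * Re (Z.tr (q \<eta>))) / real (hdim S (Suc n) z))"
proof -
  define A where "A = (\<lambda>\<eta>. \<gamma>' / \<eta>) ` ratios"
  have g0: "\<gamma>' > 0" using \<gamma>' Gam_pos by auto
  have A: "finite A" "A \<subseteq> Gam S"
    using finite_ratios ratios_Gam \<gamma>' Gam_divide by (auto simp: A_def)
  have zero: "mu S n (z, \<gamma>) (z', \<gamma>') = 0" if "\<gamma> \<in> Gam S" "\<gamma> \<notin> A" for \<gamma>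
  proof -
    have "inverse \<gamma> * \<gamma>' \<notin> ratios"
    proof
      assume r: "inverse \<gamma> * \<gamma>' \<in> ratios"
      have e: "\<gamma> = \<gamma>' / (inverse \<gamma> * \<gamma>')" using g0 Gam_pos[OF that(1)] by (simp add: field_simps)
      have "\<gamma> \<in> A" unfolding A_def by (rule image_eqI[where x = "inverse \<gamma> * \<gamma>'", OF _ r]) (rule e)
      then show False using that by simp
    qed
    then show ?thesis by (simp add: mu_eq q_zero Z.tr_zero)
  qed
  have "(\<integral>\<^sup>+\<gamma>. ennreal (mu S n (z, \<gamma>) (z', \<gamma>') * \<gamma> powr b) \<partial>count_space (Gam S)) =
      (\<Sum>\<gamma>\<in>A. ennreal (mu S n (z, \<gamma>) (z', \<gamma>') * \<gamma> powr b))"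
    using zero A by (intro nn_integral_count_space') auto
  also have "\<dots> = ennreal (\<Sum>\<gamma>\<in>A. mu S n (z, \<gamma>) (z', \<gamma>') * \<gamma> powr b)"
    using tr_q_nonneg by (intro sum_ennreal) (auto simp: mu_eq)
  also have "(\<Sum>\<gamma>\<in>A. mu S n (z, \<gamma>) (z', \<gamma>') * \<gamma> powr b) =
      (\<Sum>\<eta>\<in>ratios. mu S n (z, \<gamma>' / \<eta>) (z', \<gamma>') * (\<gamma>' / \<eta>) powr b)"
  proof -
    have "inj_on (\<lambda>\<eta>. \<gamma>' / \<eta>) ratios"
      using g0 ratios_pos by (auto simp: inj_on_def field_simps)
    then show ?thesis unfolding A_def by (simp add: sum.reindex)
  qed
  also have "\<dots> = (\<Sum>\<eta>\<in>ratios. \<gamma>' powr b * (\<eta> powr (- b) * Re (Z.tr (q \<eta>))) / real (hdim S (Suc n) z))"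
  proof (intro sum.cong refl)
    fix \<eta> assume "\<eta> \<in> ratios"
    then have "\<eta> > 0" by (rule ratios_pos)
    then have "(\<gamma>' / \<eta>) powr b = \<gamma>' powr b * \<eta> powr (- b)" "inverse (\<gamma>' / \<eta>) * \<gamma>' = \<eta>"
      using g0 by (simp_all add: powr_divide powr_minus_divide)
    then show "mu S n (z, \<gamma>' / \<eta>) (z', \<gamma>') * (\<gamma>' / \<eta>) powr b =
        \<gamma>' powr b * (\<eta> powr (- b) * Re (Z.tr (q \<eta>))) / real (hdim S (Suc n) z)"
      by (simp add: mu_eq)
  qed
  finally show ?thesis by (simp add: sum_divide_distrib sum_distrib_left)
qed

end

section \<open>Local finiteness and row sums of the graph\<close>

context kms_system
begin

lemma corner_pair: "z \<in> Zmin S (Suc n) \<Longrightarrow> z' \<in> Zmin S n \<Longrightarrow> corner_pair S n z z'"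
  by unfold_locales

lemma Zmin_sum_projection:
  assumes "finite J" "J \<subseteq> Zmin S n"
  shows "\<Sum>J * \<Sum>J = \<Sum>J" "star (\<Sum>J) = \<Sum>J" "\<Sum>J \<in> alg S n"
proof -
  have "\<Sum>J * \<Sum>J = (\<Sum>z\<in>J. \<Sum>w\<in>J. if z = w then z else 0)"
    unfolding sum_product
  proof (intro sum.cong refl)
    fix z w assume "z \<in> J" "w \<in> J"
    then have "z \<in> Zmin S n" "w \<in> Zmin S n" using assms by auto
    then show "z * w = (if z = w then z else 0)" using Zmin_orth[of z n w] Zmin_D(2)[of z n] by auto
  qed
  then show "\<Sum>J * \<Sum>J = \<Sum>J" using assms(1) by simp
  show "star (\<Sum>J) = \<Sum>J" using assms Zmin_D(3) by (auto simp: star_sum intro!: sum.cong)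
  show "\<Sum>J \<in> alg S n" using assms Zmin_D(1) by (intro alg_closed) auto
qed

text \<open>The part of \<open>z\<close> that the projections in \<open>J\<close> leave uncovered is
  again a projection, and its trace is nonnegative.\<close>

lemma sum_tr_zz'_le:
  assumes z: "z \<in> Zmin S (Suc n)" and J: "finite J" "J \<subseteq> Zmin S n"
  shows "(\<Sum>z'\<in>J. Re (Tr S (Suc n) z (z * z'))) \<le> real (hdim S (Suc n) z)"
proof -
  interpret Z: density_corner "alg S (Suc n)" z "hdim S (Suc n) z" "rep S (Suc n) z" "dens S (Suc n) z"
    by (rule density_corner_Zmin[OF z])
  define s where "s = \<Sum>J"
  have s: "s * s = s" "star s = s" "s \<in> alg S (Suc n)"
    using Zmin_sum_projection[OF J] alg_Suc by (auto simp: s_def)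
  have zsc: "z * s = s * z" by (rule Z.zc[OF s(3), symmetric])
  define p where "p = z - z * s"
  have p: "p \<in> Z.zMz" unfolding p_def by (intro Z.ccl Z.z_corner Z.z_mult_corner s)
  have pp: "star p * p = p"
  proof -
    have "z * s * (z * s) = (z * z) * (s * s)" using zsc by (metis mult.assoc)
    then have "z * s * (z * s) = z * s" by (simp add: Z.zz s)
    moreover have "z * s * z = z * s" using zsc by (metis mult.assoc Z.zz)
    moreover have "z * (z * s) = z * s" by (simp add: mult.assoc[symmetric] Z.zz)
    moreover have "star p = p" by (simp add: p_def star_diff star_mult s Z.zs zsc)
    ultimately show ?thesis by (simp add: p_def right_diff_distrib left_diff_distrib Z.zz)
  qed
  have "z = p + z * s" by (simp add: p_def)
  then have "Z.tr z = Z.tr p + Z.tr (z * s)" using Z.tr_add[OF p Z.z_mult_corner[OF s(3)]] by simp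
  moreover have "Z.tr (z * s) = (\<Sum>z'\<in>J. Z.tr (z * z'))"
    unfolding s_def sum_distrib_left using J Zmin_D(1) alg_Suc by (intro Z.tr_sum Z.z_mult_corner) blast
  ultimately have "real (hdim S (Suc n) z) = Re (Z.tr p) + (\<Sum>z'\<in>J. Re (Z.tr (z * z')))"
    by (simp add: Z.tr_z complex_eq_iff)
  moreover have "Re (Z.tr p) \<ge> 0" using Z.tr_star_pos(2)[OF p] pp by simp
  ultimately show ?thesis by (simp add: corner_constants(4)[OF z])
qed

text \<open>Each nonzero \<open>z * z'\<close> is an idempotent and takes up at least 1 of the trace
  of \<open>z\<close>, so there is no room for \<open>hdim + 1\<close> of them.\<close>

lemma finite_neighbours:
  assumes z: "z \<in> Zmin S (Suc n)"
  shows "finite {z' \<in> Zmin S n. z * z' \<noteq> 0}"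
proof (rule ccontr)
  assume "infinite {z' \<in> Zmin S n. z * z' \<noteq> 0}"
  then obtain J where J: "J \<subseteq> {z' \<in> Zmin S n. z * z' \<noteq> 0}" "finite J" "card J = Suc (hdim S (Suc n) z)"
    using infinite_arbitrarily_large by blast
  have ge: "1 \<le> Re (Tr S (Suc n) z (z * z'))" if z'J: "z' \<in> J" for z'
  proof -
    have w: "z' \<in> Zmin S n" "z * z' \<noteq> 0" using J z'J by auto
    interpret corner_pair S n z z' by (rule corner_pair[OF z w(1)])
    have c: "z * z' \<in> Z.zMz" using Zmin_D(1)[OF w(1)] alg_Suc by (intro Z.z_mult_corner)
    have comm: "z * z' = z' * z" using Zmin_D(1)[OF w(1)] alg_Suc Z.zc by metis
    have pp: "star (z * z') * (z * z') = z * z'"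
    proof -
      have "z' * z * (z * z') = z' * (z * z) * z'" by (simp only: mult.assoc)
      also have "\<dots> = z * (z' * z')" by (simp only: Z.zz comm[symmetric] mult.assoc)
      finally show ?thesis by (simp add: star_mult Z.zs Z'.zs Z'.zz)
    qed
    have "z * z' * (z * z') = z * z'" using pp by (simp add: star_mult Z.zs Z'.zs comm)
    then obtain k :: nat where k: "Z.tr (z * z') = of_nat k" using Z.tr_idempotent[OF c] by blast
    have "k \<noteq> 0" using Z.tr_star_self_eq_0[OF c] pp k w(2) by auto
    then show ?thesis by (simp add: corner_constants(4)[OF z] k)
  qed
  have "real (card J) \<le> (\<Sum>z'\<in>J. Re (Tr S (Suc n) z (z * z')))"
    using sum_mono[of J "\<lambda>_. 1", OF ge] by simp
  also have "\<dots> \<le> real (hdim S (Suc n) z)" using J by (intro sum_tr_zz'_le[OF z]) auto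
  finally show False using J by simp
qed

lemma Zext_iff: "(z, \<gamma>) \<in> Zext S n \<longleftrightarrow> z \<in> Zmin S n \<and> \<gamma> \<in> Gam S"
  by (auto simp: Zext_def)

lemma mu_nonneg:
  assumes "v \<in> Zext S (Suc n)" "v' \<in> Zext S n"
  shows "mu S n v v' \<ge> 0"
proof -
  obtain z \<gamma> z' \<gamma>' where v: "v = (z, \<gamma>)" "v' = (z', \<gamma>')" by (cases v; cases v')
  interpret corner_pair S n z z' using assms by (intro corner_pair) (auto simp: v Zext_iff)
  show ?thesis unfolding v mu_eq by (intro divide_nonneg_nonneg tr_q_nonneg) simp
qed

lemma mu_multiple:
  assumes "(z, \<gamma>) \<in> Zext S (Suc n)" "(z', \<gamma>') \<in> Zext S n"
  shows "\<exists>k::nat. mu S n (z, \<gamma>) (z', \<gamma>') = real (k * hdim S n z') / real (hdim S (Suc n) z)"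
proof -
  have z: "z \<in> Zmin S (Suc n)" "z' \<in> Zmin S n" and g: "inverse \<gamma> * \<gamma>' > 0"
    using assms Gam_pos by (auto simp: Zext_iff)
  interpret corner_pair S n z z' by (rule corner_pair[OF z])
  obtain k :: nat where "Z.tr (q (inverse \<gamma> * \<gamma>')) = of_nat (k * hdim S n z')"
    using tr_q_multiple[OF g] by blast
  then show ?thesis by (intro exI[of _ k]) (simp add: mu_eq)
qed

lemma mu_finite_support:
  assumes "v \<in> Zext S (Suc n)"
  shows "finite {v' \<in> Zext S n. mu S n v v' \<noteq> 0}"
proof -
  obtain z \<gamma> where v: "v = (z, \<gamma>)" by (cases v)
  have z: "z \<in> Zmin S (Suc n)" and g: "\<gamma> > 0" using assms Gam_pos by (auto simp: v Zext_iff)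
  let ?N = "{z' \<in> Zmin S n. z * z' \<noteq> 0}"
  have fin: "finite {\<gamma>'. mu S n v (z', \<gamma>') \<noteq> 0}" if z': "z' \<in> Zmin S n" for z'
  proof -
    interpret corner_pair S n z z' by (rule corner_pair[OF z z'])
    have "{\<gamma>'. mu S n v (z', \<gamma>') \<noteq> 0} \<subseteq> (\<lambda>\<eta>. \<gamma> * \<eta>) ` ratios"
    proof
      fix \<gamma>' assume "\<gamma>' \<in> {\<gamma>'. mu S n v (z', \<gamma>') \<noteq> 0}"
      then have "inverse \<gamma> * \<gamma>' \<in> ratios"
        using q_zero[of "inverse \<gamma> * \<gamma>'"] Z.tr_zero by (cases "inverse \<gamma> * \<gamma>' \<in> ratios") (auto simp: v mu_eq)
      then show "\<gamma>' \<in> (\<lambda>\<eta>. \<gamma> * \<eta>) ` ratios" using g by (intro image_eqI[of _ _ "inverse \<gamma> * \<gamma>'"]) auto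
    qed
    then show ?thesis using finite_ratios finite_subset by blast
  qed
  have "{v' \<in> Zext S n. mu S n v v' \<noteq> 0} \<subseteq> (\<Union>z'\<in>?N. Pair z' ` {\<gamma>'. mu S n v (z', \<gamma>') \<noteq> 0})"
    by (auto simp: Zext_iff v mu_def split: if_splits)
  moreover have "finite (\<Union>z'\<in>?N. Pair z' ` {\<gamma>'. mu S n v (z', \<gamma>') \<noteq> 0})"
    using finite_neighbours[OF z] fin by auto
  ultimately show ?thesis using finite_subset by blast
qed

text \<open>A dimension count: the edges at \<open>v\<close> share out the trace of
  \<open>z\<close>. This keeps the connecting maps within the bounded functions.\<close>

lemma mu_row_sum_le_1:
  assumes v: "v \<in> Zext S (Suc n)" and V: "finite V" "V \<subseteq> Zext S n"
  shows "(\<Sum>v'\<in>V. mu S n v v') \<le> 1"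
proof -
  obtain z \<gamma> where v': "v = (z, \<gamma>)" by (cases v)
  have z: "z \<in> Zmin S (Suc n)" and g: "\<gamma> > 0" using v Gam_pos by (auto simp: v' Zext_iff)
  have sub: "fst ` V \<subseteq> Zmin S n" "snd ` V \<subseteq> Gam S" using V(2) by (auto simp: Zext_def)
  \<comment> \<open>Enlarging \<open>V\<close> to a rectangle separates the sum over summands from
    the sum over labels.\<close>
  have "(\<Sum>v'\<in>V. mu S n v v') \<le> (\<Sum>v'\<in>fst ` V \<times> snd ` V. mu S n v v')"
  proof (rule sum_mono2)
    show "V \<subseteq> fst ` V \<times> snd ` V" by force
    fix v' assume "v' \<in> fst ` V \<times> snd ` V - V"
    then have "v' \<in> Zext S n" using sub by (auto simp: Zext_def)
    then show "0 \<le> mu S n v v'" by (rule mu_nonneg[OF v])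
  qed (use V in simp)
  also have "\<dots> = (\<Sum>z'\<in>fst ` V. \<Sum>\<gamma>'\<in>snd ` V. mu S n v (z', \<gamma>'))"
    by (simp add: sum.cartesian_product)
  also have "\<dots> \<le> (\<Sum>z'\<in>fst ` V. Re (Tr S (Suc n) z (z * z')) / real (hdim S (Suc n) z))"
  proof (rule sum_mono)
    fix z' assume "z' \<in> fst ` V"
    then have z': "z' \<in> Zmin S n" using sub by auto
    interpret corner_pair S n z z' by (rule corner_pair[OF z z'])
    show "(\<Sum>\<gamma>'\<in>snd ` V. mu S n v (z', \<gamma>')) \<le> Re (Tr S (Suc n) z (z * z')) / real (hdim S (Suc n) z)"
      unfolding v' mu_eq sum_divide_distrib[symmetric] corner_constants(4)[OF z]
      using V(1) sub(2) Gam_pos g by (intro divide_right_mono sum_tr_q_le) auto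
  qed
  also have "\<dots> \<le> real (hdim S (Suc n) z) / real (hdim S (Suc n) z)"
    unfolding sum_divide_distrib[symmetric]
    using V(1) sub by (intro divide_right_mono sum_tr_zz'_le[OF z]) auto
  also have "\<dots> = 1" using hdim_pos[OF z] by simp
  finally show ?thesis .
qed

lemma mu_translate:
  "mu S n (z, \<delta> * \<gamma>) (z', \<delta> * \<gamma>') = mu S n (z, \<gamma>) (z', \<gamma>')" if "\<delta> > 0"
proof -
  have "inverse (\<delta> * \<gamma>) * (\<delta> * \<gamma>') = (inverse \<delta> * \<delta>) * (inverse \<gamma> * \<gamma>')"
    by (simp only: inverse_mult_distrib mult_ac)
  also have "\<dots> = inverse \<gamma> * \<gamma>'" using that by simp
  finally show ?thesis unfolding mu_def split by (simp only:)
qed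

text \<open>The Cauchy-Schwarz inequality reduces the claim to \<open>a = 1\<close>, which is atomicity.\<close>

lemma normal_has_sum:
  assumes f: "positive_functional (alg S n) f" and normal: "restr (alg S n) f \<in> predual S n"
    and a: "a \<in> alg S n"
  shows "((\<lambda>z. f (z * a)) has_sum f a) (Zmin S n)"
proof -
  have cl: "star_closed (alg S n)" by (rule cstar_subalgebra_star_closed[OF alg_subalgebra])
  have "(restr (alg S n) f has_sum f 1) (Zmin S n)"
    using predual_has_sum[OF normal] by (simp add: restr_apply one_alg)
  then have "(f has_sum f 1) (Zmin S n)"
    by (subst (asm) has_sum_cong[where g = f]) (auto simp: restr_apply Zmin_D(1))
  then have lim: "((\<lambda>J. \<Sum>z\<in>J. f z) \<longlongrightarrow> f 1) (finite_subsets_at_top (Zmin S n))"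
    by (simp add: has_sum_def)
  define K where "K = Re (f (star a * a))"
  have bound: "cmod (f a - (\<Sum>z\<in>J. f (z * a))) \<le> sqrt (K * cmod (f 1 - (\<Sum>z\<in>J. f z)))"
    if J: "finite J" "J \<subseteq> Zmin S n" for J
  proof -
    note s = Zmin_sum_projection[OF J]
    have JA: "z \<in> alg S n" if "z \<in> J" for z using J that Zmin_D(1) by auto
    \<comment> \<open>The error of the partial sum is \<open>f (c * a)\<close>, and Cauchy-Schwarz
      bounds its square by \<open>f (star a * a) * f c\<close>, where \<open>f c\<close> tends to
      0.\<close>
    define c where "c = 1 - \<Sum>J"
    have c: "c \<in> alg S n" "star c * c = c"
      using s one_alg by (auto simp: c_def alg_closed star_diff algebra_simps)
    have "f (c * a) = f a - (\<Sum>z\<in>J. f (z * a))"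
      using a JA s by (simp add: c_def left_diff_distrib sum_distrib_right alg_closed
        positive_functional_diff[OF f cl] positive_functional_sum[OF f cl])
    moreover have "f c = f 1 - (\<Sum>z\<in>J. f z)"
      using JA s one_alg by (simp add: c_def alg_closed positive_functional_diff[OF f cl]
        positive_functional_sum[OF f cl, of J "\<lambda>z. z"])
    moreover have "(cmod (f (star c * a)))\<^sup>2 \<le> K * Re (f (star c * c))"
      unfolding K_def by (rule positive_functional_Cauchy_Schwarz[OF f cl a c(1)])
    moreover have "star c = c" using s by (simp add: c_def star_diff)
    moreover have "K * Re (f c) \<le> K * cmod (f c)"
      unfolding K_def using positive_functionalD(4)[OF f a] by (intro mult_left_mono complex_Re_le_cmod)
    ultimately have "(cmod (f a - (\<Sum>z\<in>J. f (z * a))))\<^sup>2 \<le> K * cmod (f 1 - (\<Sum>z\<in>J. f z))"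
      using c(2) by simp
    then show ?thesis by (rule real_le_rsqrt)
  qed
  have "((\<lambda>J. f a - (\<Sum>z\<in>J. f (z * a))) \<longlongrightarrow> 0) (finite_subsets_at_top (Zmin S n))"
  proof (rule Lim_null_comparison)
    show "\<forall>\<^sub>F J in finite_subsets_at_top (Zmin S n).
        norm (f a - (\<Sum>z\<in>J. f (z * a))) \<le> sqrt (K * cmod (f 1 - (\<Sum>z\<in>J. f z)))"
      by (rule eventually_finite_subsets_at_top_weakI) (rule bound)
    have "((\<lambda>J. sqrt (K * cmod (f 1 - (\<Sum>z\<in>J. f z)))) \<longlongrightarrow> sqrt (K * cmod (f 1 - f 1)))
        (finite_subsets_at_top (Zmin S n))"
      by (intro tendsto_intros lim)
    then show "((\<lambda>J. sqrt (K * cmod (f 1 - (\<Sum>z\<in>J. f z)))) \<longlongrightarrow> 0) (finite_subsets_at_top (Zmin S n))"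
      by simp
  qed
  from tendsto_diff[OF tendsto_const this, of "f a"] show ?thesis by (simp add: has_sum_def)
qed

end

section \<open>The KMS functionals of the central summands\<close>

locale kms_setting = kms_system S for S :: "('a::cstar_algebra) flow_system" +
  fixes \<beta> :: real
begin

text \<open>The unnormalized KMS functional of one summand, of total mass \<open>dim_beta\<close>.
  The factor \<open>z\<close> extends it to all of \<open>alg S n\<close>.\<close>

definition tau :: "nat \<Rightarrow> 'a \<Rightarrow> 'a \<Rightarrow> complex" where
  "tau n z a = Tr S n z (dens_powr S n z (- complex_of_real \<beta>) * z * a)"

lemma tau_positive:
  assumes z: "z \<in> Zmin S n"
  shows "positive_functional (alg S n) (tau n z)"
proof -
  interpret density_corner "alg S n" z "hdim S n z" "rep S n z" "dens S n z"
    by (rule density_corner_Zmin[OF z])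
  show ?thesis
    using positive_functional_corner[OF tr_pw_positive[of "- \<beta>"]]
    by (simp add: tau_def[abs_def] corner_constants[OF z] mult.assoc)
qed

lemma tau_normal:
  assumes z: "z \<in> Zmin S n"
  shows "restr (alg S n) (tau n z) \<in> predual S n"
proof -
  interpret predual_corner "alg S n" z "hdim S n z" "rep S n z" "predual S n"
    by (rule predual_corner_Zmin[OF z])
  interpret density_corner "alg S n" z "hdim S n z" "rep S n z" "dens S n z"
    by (rule density_corner_Zmin[OF z])
  have "restr (alg S n) (\<lambda>x. tr (pw (- complex_of_real \<beta>) * (z * x))) \<in> predual S n"
    by (rule linear_functional_in_predual)
      (auto simp: distrib_left mult_scaleC_right tr_add tr_scaleC ccl pw_corner)
  then show ?thesis by (simp add: tau_def[abs_def] corner_constants[OF z] mult.assoc)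
qed

lemma tau_z:
  assumes z: "z \<in> Zmin S n"
  shows "tau n z 1 = complex_of_real (dim_beta S \<beta> n z)" "tau n z z = complex_of_real (dim_beta S \<beta> n z)"
    "dim_beta S \<beta> n z > 0" "tau n z (z * a) = tau n z a"
    "w \<in> Zmin S n \<Longrightarrow> w \<noteq> z \<Longrightarrow> tau n z (w * a) = 0"
proof -
  interpret density_corner "alg S n" z "hdim S n z" "rep S n z" "dens S n z"
    by (rule density_corner_Zmin[OF z])
  have p: "pw (- complex_of_real \<beta>) * z = pw (- complex_of_real \<beta>)" by (rule corner_zero[OF pw_corner])
  have r: "tr (pw (- complex_of_real \<beta>)) = complex_of_real (Re (tr (pw (- complex_of_real \<beta>))))"
    "Re (tr (pw (- complex_of_real \<beta>))) > 0"
    using pw_real_tr[of "- \<beta>"] by (auto simp: complex_eq_iff)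
  show "tau n z 1 = complex_of_real (dim_beta S \<beta> n z)" "tau n z z = complex_of_real (dim_beta S \<beta> n z)"
    using r by (simp_all add: tau_def dim_beta_def corner_constants[OF z] p)
  show "dim_beta S \<beta> n z > 0" using r by (simp add: dim_beta_def corner_constants[OF z])
  show "tau n z (z * a) = tau n z a" by (simp add: tau_def mult.assoc) (simp add: mult.assoc[symmetric] zz)
  assume w: "w \<in> Zmin S n" "w \<noteq> z"
  have "z * (w * a) = 0" using Zmin_orth[OF z w(1)] w(2) by (simp add: mult.assoc[symmetric])
  then show "tau n z (w * a) = 0" by (simp add: tau_def mult.assoc corner_constants[OF z] tr_zero)
qed

text \<open>The constant of \<open>tr_pw_restrict\<close> is read off at \<open>z'\<close>, where
  the lower functional has the value \<open>dim_beta\<close>.\<close>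

lemma tau_restrict:
  assumes z: "z \<in> Zmin S (Suc n)" and z': "z' \<in> Zmin S n" and x: "x \<in> alg S n"
  shows "tau (Suc n) z (z' * x) = tau (Suc n) z z' / complex_of_real (dim_beta S \<beta> n z') * tau n z' x"
proof -
  interpret corner_pair S n z z' by (rule corner_pair[OF z z'])
  define c where "c = (\<Sum>\<eta>\<in>ratios. complex_of_real (\<eta> powr (- \<beta>)) * Z.tr (q \<eta>)) / of_nat (hdim S n z')"
  have p: "Z.pw (- complex_of_real \<beta>) * z = Z.pw (- complex_of_real \<beta>)" by (rule Z.corner_zero[OF Z.pw_corner])
  have p': "Z'.pw (- complex_of_real \<beta>) * z' = Z'.pw (- complex_of_real \<beta>)" by (rule Z'.corner_zero[OF Z'.pw_corner])
  have t: "tau (Suc n) z y = c * tau n z' y" if y: "y \<in> Z'.zMz" for y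
    using tr_pw_restrict[OF y, of \<beta>]
    by (simp add: tau_def corner_constants[OF z] corner_constants[OF z'] p p' c_def)
  have "tau (Suc n) z z' = c * dim_beta S \<beta> n z'" using t[OF Z'.z_corner] tau_z[OF z'] by simp
  then have "c = tau (Suc n) z z' / complex_of_real (dim_beta S \<beta> n z')"
    using tau_z(3)[OF z'] by (simp add: field_simps)
  then show ?thesis using t[OF Z'.z_mult_corner[OF x]] tau_z(4)[OF z'] by simp
qed

lemma tau_projection_nonneg:
  assumes z: "z \<in> Zmin S (Suc n)" and z': "z' \<in> Zmin S n"
  shows "Im (tau (Suc n) z z') = 0" "Re (tau (Suc n) z z') \<ge> 0"
  using positive_functionalD(3,4)[OF tau_positive[OF z] alg_Suc[OF Zmin_D(1)[OF z']]]
  by (simp_all only: Zmin_D(2,3)[OF z'])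

text \<open>The bridge between graph and algebra: up to dimension factors, summing the edges over a
  fibre gives the upper KMS functional at the lower central projection.\<close>

lemma nn_integral_mu:
  assumes z: "z \<in> Zmin S (Suc n)" and z': "z' \<in> Zmin S n" and \<gamma>': "\<gamma>' \<in> Gam S"
  shows "(\<integral>\<^sup>+\<gamma>. ennreal (mu S n (z, \<gamma>) (z', \<gamma>') * \<gamma> powr \<beta>) \<partial>count_space (Gam S)) =
    ennreal (\<gamma>' powr \<beta> * (Re (tau (Suc n) z z') * real (hdim S n z') / dim_beta S \<beta> n z') / real (hdim S (Suc n) z))"
proof -
  interpret corner_pair S n z z' by (rule corner_pair[OF z z'])
  define c where "c = (\<Sum>\<eta>\<in>ratios. complex_of_real (\<eta> powr (- \<beta>)) * Z.tr (q \<eta>)) / of_nat (hdim S n z')"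
  have p: "Z.pw (- complex_of_real \<beta>) * z = Z.pw (- complex_of_real \<beta>)" by (rule Z.corner_zero[OF Z.pw_corner])
  have p': "Z'.pw (- complex_of_real \<beta>) * z' = Z'.pw (- complex_of_real \<beta>)" by (rule Z'.corner_zero[OF Z'.pw_corner])
  have "tau (Suc n) z z' = c * tau n z' z'"
    using tr_pw_restrict[OF Z'.z_corner, of \<beta>]
    by (simp add: tau_def corner_constants[OF z] corner_constants[OF z'] p p' c_def)
  then have "Re (tau (Suc n) z z') = Re c * dim_beta S \<beta> n z'" using tau_z[OF z'] by simp
  moreover have "Re c * real (hdim S n z') = (\<Sum>\<eta>\<in>ratios. \<eta> powr (- \<beta>) * Re (Z.tr (q \<eta>)))"
    using Z'.d_pos by (simp add: c_def)
  ultimately have "(\<Sum>\<eta>\<in>ratios. \<eta> powr (- \<beta>) * Re (Z.tr (q \<eta>))) =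
      Re (tau (Suc n) z z') * real (hdim S n z') / dim_beta S \<beta> n z'"
    using tau_z(3)[OF z'] by (simp add: field_simps)
  then show ?thesis using nn_integral_mu_powr[OF \<gamma>', of \<beta>] by simp
qed

text \<open>Every element of level 0 is a scalar, so the only projections are 0 and 1, the matrix
  unit at \<open>(0, 0)\<close> is 1, and the trace shows that the dimension is 1.\<close>

lemma level_0: "Zmin S 0 = {1}" "hdim S 0 1 = 1" "dim_beta S \<beta> 0 1 = 1"
proof -
  have center: "center (alg S 0) = range (\<lambda>c. scaleC c 1)"
    by (auto simp: center_def alg_0 mult_scaleC_left mult_scaleC_right scaleC_scaleC mult.commute)
  have proj: "p = 0 \<or> p = 1" if p: "p \<in> projections (center (alg S 0))" for p
  proof -
    obtain c where c: "p = scaleC c 1" using p by (auto simp: projections_def center)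
    have "p * p = p" using p by (auto simp: projections_def)
    then have "scaleC (c * c - c) (1::'a) = 0" by (simp add: c mult_scaleC_left scaleC_scaleC scaleC_diff_left)
    then have "c = 0 \<or> c = 1" by auto
    then show ?thesis using c by auto
  qed
  have one: "1 \<in> projections (center (alg S 0))"
    by (auto simp: projections_def center intro!: image_eqI[of _ _ 1])
  show Z: "Zmin S 0 = {1}"
    using proj one by (auto simp: Zmin_def minimal_projections_def)
  then have z: "1 \<in> Zmin S 0" by simp
  interpret density_corner "alg S 0" 1 "hdim S 0 1" "rep S 0 1" "dens S 0 1"
    by (rule density_corner_Zmin[OF z])
  have scal: "\<exists>c. x = scaleC c 1" if "x \<in> zMz" for x using that mem_corner alg_0 by auto
  have "unit 0 0 = 1"
  proof -
    obtain c where c: "unit 0 0 = scaleC c 1" using scal unit(1) by blast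
    have "unit 0 0 * unit 0 0 = unit 0 0" using d_pos by (simp add: unit_mult)
    then have "scaleC (c * c - c) (1::'a) = 0" by (simp add: c mult_scaleC_left scaleC_scaleC scaleC_diff_left)
    then have "c = 0 \<or> c = 1" by auto
    moreover have "unit 0 0 \<noteq> 0" using tr_unit[of 0] d_pos tr_zero by auto
    ultimately show ?thesis using c by auto
  qed
  then have "(1::complex) = of_nat (hdim S 0 1)" using tr_unit[of 0] d_pos tr_z by simp
  then show d1: "hdim S 0 1 = 1" using of_nat_eq_1_iff by metis
  obtain r where r: "r \<in> zMz" "dens S 0 1 * r = 1" "Tr S 0 1 (dens S 0 1) = Tr S 0 1 r"
    using density z unfolding flow_density_def by blast
  obtain c e where c: "dens S 0 1 = scaleC c 1" and e: "r = scaleC e 1" using scal a_corner r(1) by metis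
  have tr: "tr (scaleC k 1) = k" for k using tr_scaleC[OF z_corner, of k] tr_z d1 by simp
  \<comment> \<open>On a one-dimensional corner the normalization of the density by traces says that
    the scalar \<open>c\<close> equals its inverse \<open>e\<close>; positivity of the spectrum then
    settles the sign.\<close>
  have "c = e" using r(3) by (simp add: corner_constants[OF z] c e tr)
  moreover have "scaleC (c * e - 1) (1::'a) = 0"
    using r(2) by (simp add: c e mult_scaleC_left mult_scaleC_right scaleC_scaleC scaleC_diff_left mult.commute[of c e])
  ultimately have cc: "c * c = 1" by simp
  have spec1: "\<gamma> = 1" if g: "\<gamma> \<in> spec" for \<gamma>
  proof -
    have "sp \<gamma> \<noteq> 0" using g sp_zero_iff by blast
    moreover have "scaleC (c - complex_of_real \<gamma>) (sp \<gamma>) = 0"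
      using a_sp[of \<gamma>] by (simp add: c mult_scaleC_left scaleC_diff_left)
    ultimately have "c = complex_of_real \<gamma>" by simp
    then have "\<gamma> * \<gamma> = 1" using cc by (metis of_real_eq_1_iff of_real_mult)
    then show "\<gamma> = 1" using spec_pos[OF g] by (simp add: square_eq_1_iff)
  qed
  have "pw w = (\<Sum>\<gamma>\<in>spec. sp \<gamma>)" for w
    unfolding pw_def
  proof (intro sum.cong refl)
    fix \<gamma> assume "\<gamma> \<in> spec"
    then have "\<gamma> = 1" by (rule spec1)
    then show "scaleC (exp (w * complex_of_real (ln \<gamma>))) (sp \<gamma>) = sp \<gamma>" by simp
  qed
  then have "pw w = 1" for w by (simp add: sp_sum)
  then show "dim_beta S \<beta> 0 1 = 1" by (simp add: dim_beta_def corner_constants[OF z] tr_z d1)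
qed

end

section \<open>The inductive limit group\<close>

context kms_system
begin

definition nbhd :: "nat \<Rightarrow> 'a \<times> real \<Rightarrow> ('a \<times> real) set" where
  "nbhd n v = {v' \<in> Zext S n. mu S n v v' \<noteq> 0}"

lemma finite_nbhd: "v \<in> Zext S (Suc n) \<Longrightarrow> finite (nbhd n v)"
  unfolding nbhd_def by (rule mu_finite_support)

lemma conn_eq: "conn S n f v = (if v \<in> Zext S (Suc n) then \<Sum>v'\<in>nbhd n v. mu S n v v' * f v' else 0)"
proof (cases "v \<in> Zext S (Suc n)")
  case True
  have "(\<Sum>\<^sub>\<infinity>v'\<in>Zext S n. mu S n v v' * f v') = (\<Sum>\<^sub>\<infinity>v'\<in>nbhd n v. mu S n v v' * f v')"
    by (intro infsum_cong_neutral) (auto simp: nbhd_def)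
  then show ?thesis using True finite_nbhd by (simp add: conn_def)
qed (simp add: conn_def)

lemma conn_add: "conn S n (\<lambda>v. f v + g v) = (\<lambda>v. conn S n f v + conn S n g v)"
  by (auto simp: conn_eq distrib_left sum.distrib)

lemma conn_zero: "conn S n (\<lambda>v. 0) = (\<lambda>v. 0)"
  by (auto simp: conn_eq)

lemma Grp_D:
  assumes "f \<in> Grp S n"
  shows "v \<notin> Zext S n \<Longrightarrow> f v = 0" "\<exists>K. \<forall>v. \<bar>f v\<bar> \<le> K"
    "(z, \<gamma>) \<in> Zext S n \<Longrightarrow> \<exists>k::int. f (z, \<gamma>) = of_int k / real (hdim S n z)"
  using assms unfolding Grp_def by blast+

lemma GrpI:
  assumes "\<And>v. v \<notin> Zext S n \<Longrightarrow> f v = 0" "\<And>v. \<bar>f v\<bar> \<le> K"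
    "\<And>z \<gamma>. (z, \<gamma>) \<in> Zext S n \<Longrightarrow> \<exists>k::int. f (z, \<gamma>) = of_int k / real (hdim S n z)"
  shows "f \<in> Grp S n"
  using assms unfolding Grp_def by blast

lemma Grp_add:
  assumes f: "f \<in> Grp S n" and g: "g \<in> Grp S n"
  shows "(\<lambda>v. f v + g v) \<in> Grp S n"
proof -
  obtain K L where K: "\<And>v. \<bar>f v\<bar> \<le> K" and L: "\<And>v. \<bar>g v\<bar> \<le> L" using Grp_D(2)[OF f] Grp_D(2)[OF g] by blast
  show ?thesis
  proof (rule GrpI[where K = "K + L"])
    show "\<bar>f v + g v\<bar> \<le> K + L" for v using K[of v] L[of v] by linarith
    fix z \<gamma> assume v: "(z, \<gamma>) \<in> Zext S n"
    obtain k l :: int where "f (z, \<gamma>) = of_int k / real (hdim S n z)" "g (z, \<gamma>) = of_int l / real (hdim S n z)"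
      using Grp_D(3)[OF f v] Grp_D(3)[OF g v] by blast
    then show "\<exists>k::int. f (z, \<gamma>) + g (z, \<gamma>) = of_int k / real (hdim S n z)"
      by (intro exI[of _ "k + l"]) (simp add: add_divide_distrib)
  qed (use Grp_D(1)[OF f] Grp_D(1)[OF g] in simp)
qed

lemma Grp_posD: "f \<in> Grp_pos S n \<Longrightarrow> f \<in> Grp S n" "f \<in> Grp_pos S n \<Longrightarrow> 0 \<le> f v"
  unfolding Grp_pos_def by blast+

lemma Grp_pos_add: "f \<in> Grp_pos S n \<Longrightarrow> g \<in> Grp_pos S n \<Longrightarrow> (\<lambda>v. f v + g v) \<in> Grp_pos S n"
  by (auto simp: Grp_pos_def Grp_add)

lemma Grp_pos_zero: "(\<lambda>v. 0) \<in> Grp_pos S n"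
  unfolding Grp_pos_def by (auto intro!: GrpI[where K = 0] exI[of _ 0])

text \<open>Row sums at most 1 preserve the bound \<open>K\<close>. The factor
  \<open>hdim S n z'\<close> that \<open>mu_multiple\<close> finds in an edge weight cancels the
  denominator of \<open>f\<close>, leaving the upper dimension as the only denominator.\<close>

lemma conn_Grp:
  assumes f: "f \<in> Grp S n"
  shows "conn S n f \<in> Grp S (Suc n)"
proof -
  obtain K where K: "\<And>v. \<bar>f v\<bar> \<le> K" using Grp_D(2)[OF f] by blast
  have K0: "0 \<le> K" using K[of undefined] by linarith
  show ?thesis
  proof (rule GrpI[where K = K])
    show "conn S n f v = 0" if "v \<notin> Zext S (Suc n)" for v using that by (simp add: conn_eq)
    show "\<bar>conn S n f v\<bar> \<le> K" for v
    proof (cases "v \<in> Zext S (Suc n)")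
      case True
      have sub: "nbhd n v \<subseteq> Zext S n" by (auto simp: nbhd_def)
      have "\<bar>conn S n f v\<bar> \<le> (\<Sum>v'\<in>nbhd n v. \<bar>mu S n v v' * f v'\<bar>)"
        using True by (simp add: conn_eq sum_abs)
      also have "\<dots> \<le> (\<Sum>v'\<in>nbhd n v. mu S n v v' * K)"
      proof (rule sum_mono)
        fix v' assume "v' \<in> nbhd n v"
        then have "mu S n v v' \<ge> 0" using mu_nonneg[OF True] by (auto simp: nbhd_def)
        then show "\<bar>mu S n v v' * f v'\<bar> \<le> mu S n v v' * K" using K[of v'] by (simp add: abs_mult mult_left_mono)
      qed
      also have "\<dots> = (\<Sum>v'\<in>nbhd n v. mu S n v v') * K" by (simp add: sum_distrib_right)
      also have "\<dots> \<le> 1 * K" by (intro mult_right_mono mu_row_sum_le_1[OF True finite_nbhd[OF True] sub] K0)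
      finally show ?thesis by simp
    qed (use K0 in \<open>simp add: conn_eq\<close>)
    fix z \<gamma> assume v: "(z, \<gamma>) \<in> Zext S (Suc n)"
    have "\<exists>k::int. mu S n (z, \<gamma>) v' * f v' = of_int k / real (hdim S (Suc n) z)" if v': "v' \<in> nbhd n (z, \<gamma>)" for v'
    proof -
      obtain z' \<gamma>' where e: "v' = (z', \<gamma>')" by (cases v')
      have m: "(z', \<gamma>') \<in> Zext S n" using v' by (auto simp: nbhd_def e)
      obtain k :: nat where k: "mu S n (z, \<gamma>) (z', \<gamma>') = real (k * hdim S n z') / real (hdim S (Suc n) z)"
        using mu_multiple[OF v m] by blast
      obtain l :: int where l: "f (z', \<gamma>') = of_int l / real (hdim S n z')" using Grp_D(3)[OF f m] by blast
      have "hdim S n z' > 0" using m hdim_pos by (auto simp: Zext_iff)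
      then have "mu S n (z, \<gamma>) v' * f v' = of_int (int k * l) / real (hdim S (Suc n) z)"
        by (simp add: e k l)
      then show ?thesis by blast
    qed
    then obtain k :: "'a \<times> real \<Rightarrow> int" where
      k: "\<And>v'. v' \<in> nbhd n (z, \<gamma>) \<Longrightarrow> mu S n (z, \<gamma>) v' * f v' = of_int (k v') / real (hdim S (Suc n) z)" by metis
    have "conn S n f (z, \<gamma>) = (\<Sum>v'\<in>nbhd n (z, \<gamma>). of_int (k v') / real (hdim S (Suc n) z))"
      using v k by (simp add: conn_eq)
    also have "\<dots> = of_int (\<Sum>v'\<in>nbhd n (z, \<gamma>). k v') / real (hdim S (Suc n) z)"
      by (simp add: sum_divide_distrib)
    finally show "\<exists>k::int. conn S n f (z, \<gamma>) = of_int k / real (hdim S (Suc n) z)" by blast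
  qed
qed

lemma conn_Grp_pos:
  assumes f: "f \<in> Grp_pos S n"
  shows "conn S n f \<in> Grp_pos S (Suc n)"
proof -
  have "0 \<le> conn S n f v" for v
  proof (cases "v \<in> Zext S (Suc n)")
    case True
    have "0 \<le> (\<Sum>v'\<in>nbhd n v. mu S n v v' * f v')"
      using Grp_posD(2)[OF f] mu_nonneg[OF True] by (intro sum_nonneg mult_nonneg_nonneg) (auto simp: nbhd_def)
    then show ?thesis using True by (simp add: conn_eq)
  qed (simp add: conn_eq)
  then show ?thesis using conn_Grp Grp_posD(1)[OF f] by (simp add: Grp_pos_def)
qed

lemma conn_iter_Grp: "f \<in> Grp S n \<Longrightarrow> conn_iter S n k f \<in> Grp S (n + k)"
  using conn_Grp by (induction k) auto

lemma conn_iter_Grp_pos: "f \<in> Grp_pos S n \<Longrightarrow> conn_iter S n k f \<in> Grp_pos S (n + k)"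
  using conn_Grp_pos by (induction k) auto

lemma conn_iter_add: "conn_iter S n k (\<lambda>v. f v + g v) = (\<lambda>v. conn_iter S n k f v + conn_iter S n k g v)"
  by (induction k) (auto simp: conn_add)

lemma conn_iter_zero: "conn_iter S n k (\<lambda>v. 0) = (\<lambda>v. 0)"
  by (induction k) (auto simp: conn_zero)

lemma conn_iter_append: "conn_iter S n (k + j) f = conn_iter S (n + k) j (conn_iter S n k f)"
  by (induction j) (auto simp: add.assoc)

lemma translate_Zext: "\<delta> \<in> Gam S \<Longrightarrow> (z, inverse \<delta> * \<gamma>) \<in> Zext S n \<longleftrightarrow> (z, \<gamma>) \<in> Zext S n"
proof -
  assume \<delta>: "\<delta> \<in> Gam S"
  have "\<gamma> = \<delta> * (inverse \<delta> * \<gamma>)" using Gam_pos[OF \<delta>] by simp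
  then have "inverse \<delta> * \<gamma> \<in> Gam S \<longleftrightarrow> \<gamma> \<in> Gam S" using \<delta> Gam_mult Gam_inverse by metis
  then show ?thesis by (simp add: Zext_iff)
qed

lemma translate_bij: "\<delta> \<in> Gam S \<Longrightarrow> bij_betw (\<lambda>(z, \<gamma>). (z, \<delta> * \<gamma>)) (Zext S n) (Zext S n)"
proof -
  assume \<delta>: "\<delta> \<in> Gam S"
  then have p: "\<delta> > 0" by (rule Gam_pos)
  show ?thesis
  proof (rule bij_betw_byWitness[where f' = "\<lambda>(z, \<gamma>). (z, inverse \<delta> * \<gamma>)"])
    show "(\<lambda>(z, \<gamma>). (z, \<delta> * \<gamma>)) ` Zext S n \<subseteq> Zext S n" using \<delta> by (auto simp: Zext_iff Gam_mult)
    show "(\<lambda>(z, \<gamma>). (z, inverse \<delta> * \<gamma>)) ` Zext S n \<subseteq> Zext S n" using \<delta> by (auto simp: translate_Zext)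
  qed (use p in auto)
qed

lemma translate_Grp:
  assumes \<delta>: "\<delta> \<in> Gam S" and f: "f \<in> Grp S n"
  shows "translate \<delta> f \<in> Grp S n"
proof -
  obtain K where K: "\<And>v. \<bar>f v\<bar> \<le> K" using Grp_D(2)[OF f] by blast
  show ?thesis
  proof (rule GrpI[where K = K])
    show "translate \<delta> f v = 0" if "v \<notin> Zext S n" for v
      using that Grp_D(1)[OF f] translate_Zext[OF \<delta>] by (cases v) (auto simp: translate_def)
    show "\<bar>translate \<delta> f v\<bar> \<le> K" for v using K by (cases v) (simp add: translate_def)
    show "\<exists>k::int. translate \<delta> f (z, \<gamma>) = of_int k / real (hdim S n z)" if "(z, \<gamma>) \<in> Zext S n" for z \<gamma>
      using Grp_D(3)[OF f] translate_Zext[OF \<delta>] that by (simp add: translate_def)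
  qed
qed

lemma translate_Grp_pos: "\<delta> \<in> Gam S \<Longrightarrow> f \<in> Grp_pos S n \<Longrightarrow> translate \<delta> f \<in> Grp_pos S n"
  using translate_Grp by (auto simp: Grp_pos_def translate_def)

text \<open>Edge weights see only the ratio of the labels, so a translation of the lower label can
  be traded for one of the upper label.\<close>

lemma conn_translate:
  assumes \<delta>: "\<delta> \<in> Gam S"
  shows "conn S n (translate \<delta> f) = translate \<delta> (conn S n f)"
proof
  fix v :: "'a \<times> real"
  obtain z \<gamma> where v: "v = (z, \<gamma>)" by (cases v)
  have p: "\<delta> > 0" using Gam_pos \<delta> by auto
  have g: "\<delta> * (inverse \<delta> * \<gamma>) = \<gamma>" using p by simp
  have "(\<Sum>\<^sub>\<infinity>v'\<in>Zext S n. mu S n (z, \<gamma>) v' * translate \<delta> f v') =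
      (\<Sum>\<^sub>\<infinity>v'\<in>Zext S n. mu S n (z, \<gamma>) (case v' of (z', \<gamma>') \<Rightarrow> (z', \<delta> * \<gamma>')) *
         translate \<delta> f (case v' of (z', \<gamma>') \<Rightarrow> (z', \<delta> * \<gamma>')))"
    by (rule infsum_reindex_bij_betw[OF translate_bij[OF \<delta>], symmetric])
  also have "\<dots> = (\<Sum>\<^sub>\<infinity>v'\<in>Zext S n. mu S n (z, inverse \<delta> * \<gamma>) v' * f v')"
  proof (rule infsum_cong)
    fix v' assume "v' \<in> Zext S n"
    obtain z' \<gamma>' where v': "v' = (z', \<gamma>')" by (cases v')
    have "mu S n (z, \<gamma>) (z', \<delta> * \<gamma>') = mu S n (z, inverse \<delta> * \<gamma>) (z', \<gamma>')"
      using mu_translate[OF p, of n z "inverse \<delta> * \<gamma>" z' \<gamma>'] by (simp only: g)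
    moreover have "inverse \<delta> * (\<delta> * \<gamma>') = \<gamma>'" using p by simp
    ultimately show "mu S n (z, \<gamma>) (case v' of (z', \<gamma>') \<Rightarrow> (z', \<delta> * \<gamma>')) *
         translate \<delta> f (case v' of (z', \<gamma>') \<Rightarrow> (z', \<delta> * \<gamma>')) = mu S n (z, inverse \<delta> * \<gamma>) v' * f v'"
      by (simp only: v' split translate_def)
  qed
  finally show "conn S n (translate \<delta> f) v = translate \<delta> (conn S n f) v"
    using translate_Zext[OF \<delta>, of z \<gamma> "Suc n"] by (simp add: v conn_def translate_def)
qed

lemma conn_iter_translate: "\<delta> \<in> Gam S \<Longrightarrow> conn_iter S n k (translate \<delta> f) = translate \<delta> (conn_iter S n k f)"
  by (induction k) (auto simp: conn_translate)

section \<open>Classes and representatives in the limit\<close>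

lemma limrel_iff: "((n, f), (m, g)) \<in> limrel S \<longleftrightarrow> f \<in> Grp S n \<and> g \<in> Grp S m \<and>
    (\<exists>k l. n + k = m + l \<and> conn_iter S n k f = conn_iter S m l g)"
  by (auto simp: limrel_def)

lemma limrel_sym:
  assumes "((n, f), (m, g)) \<in> limrel S"
  shows "((m, g), (n, f)) \<in> limrel S"
proof -
  obtain k l where "n + k = m + l" "conn_iter S n k f = conn_iter S m l g" and "f \<in> Grp S n" "g \<in> Grp S m"
    using assms unfolding limrel_iff by blast
  then show ?thesis unfolding limrel_iff by (intro conjI exI[of _ l] exI[of _ k]) auto
qed

lemma conn_iter_shift:
  assumes "conn_iter S n k f = conn_iter S m l g" "n + k = m + l"
  shows "conn_iter S n (k + j) f = conn_iter S m (l + j) g"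
  using assms by (simp add: conn_iter_append)

text \<open>The two identities hold at possibly different levels; pushing each forward by the
  iteration number of the other brings them to a common one.\<close>

lemma limrel_trans:
  assumes "((n, f), (m, g)) \<in> limrel S" "((m, g), (p, h)) \<in> limrel S"
  shows "((n, f), (p, h)) \<in> limrel S"
proof -
  obtain k l where 1: "n + k = m + l" "conn_iter S n k f = conn_iter S m l g" using assms(1) unfolding limrel_iff by blast
  obtain k' l' where 2: "m + k' = p + l'" "conn_iter S m k' g = conn_iter S p l' h" using assms(2) unfolding limrel_iff by blast
  have "conn_iter S n (k + k') f = conn_iter S m (l + k') g" by (rule conn_iter_shift[OF 1(2,1)])
  also have "\<dots> = conn_iter S p (l' + l) h" using conn_iter_shift[OF 2(2,1), of l] by (simp add: add.commute)
  finally have "conn_iter S n (k + k') f = conn_iter S p (l' + l) h" .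
  moreover have "n + (k + k') = p + (l' + l)" using 1 2 by simp
  ultimately show ?thesis using assms unfolding limrel_iff by blast
qed

lemma limrel_refl: "f \<in> Grp S n \<Longrightarrow> ((n, f), (n, f)) \<in> limrel S"
  unfolding limrel_iff by blast

lemma mem_iota: "(m, g) \<in> iota S n f \<longleftrightarrow> ((n, f), (m, g)) \<in> limrel S"
  by (simp add: iota_def)

lemma iota_eqI:
  assumes r: "((n, f), (m, g)) \<in> limrel S"
  shows "iota S n f = iota S m g"
proof (rule Set.set_eqI)
  fix x :: "nat \<times> ('a \<times> real \<Rightarrow> real)"
  obtain p h where x: "x = (p, h)" by (cases x)
  show "x \<in> iota S n f \<longleftrightarrow> x \<in> iota S m g"
    unfolding x mem_iota using limrel_trans[OF r, of p h] limrel_trans[OF limrel_sym[OF r], of p h] by blast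
qed

lemma iota_eq_iff:
  assumes g: "g \<in> Grp S m"
  shows "iota S n f = iota S m g \<longleftrightarrow> ((n, f), (m, g)) \<in> limrel S"
proof
  assume "iota S n f = iota S m g"
  then have "(m, g) \<in> iota S n f" using limrel_refl[OF g] by (simp add: mem_iota)
  then show "((n, f), (m, g)) \<in> limrel S" by (simp only: mem_iota)
next
  assume "((n, f), (m, g)) \<in> limrel S"
  then show "iota S n f = iota S m g" by (rule iota_eqI)
qed

lemma iota_conn_iter:
  assumes "f \<in> Grp S n"
  shows "iota S n f = iota S (n + k) (conn_iter S n k f)"
proof (rule iota_eqI)
  have "conn_iter S n k f = conn_iter S (n + k) 0 (conn_iter S n k f)" by simp
  then show "((n, f), (n + k, conn_iter S n k f)) \<in> limrel S"
    unfolding limrel_iff using assms conn_iter_Grp by (metis add_0_right)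
qed

lemma iota_conn: "f \<in> Grp S n \<Longrightarrow> iota S n f = iota S (Suc n) (conn S n f)"
  using iota_conn_iter[of f n 1] by simp

text \<open>All pairs of representatives on a common level yield one and the same class, so the
  union in \<open>Dadd\<close> is over a singleton; \<open>Dact_iota\<close> works in the same
  way.\<close>

lemma Dadd_iota:
  assumes f: "f \<in> Grp S n" and g: "g \<in> Grp S n"
  shows "Dadd S (iota S n f) (iota S n g) = iota S n (\<lambda>v. f v + g v)"
proof -
  have eq: "iota S m (\<lambda>v. f' v + g' v) = iota S n (\<lambda>v. f v + g v)"
    if h: "(m, f') \<in> iota S n f" "(m, g') \<in> iota S n g" for m f' g'
  proof -
    obtain k l where 1: "n + k = m + l" "conn_iter S n k f = conn_iter S m l f'" and f': "f' \<in> Grp S m"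
      using h(1) unfolding mem_iota limrel_iff by blast
    obtain k' l' where 2: "n + k' = m + l'" "conn_iter S n k' g = conn_iter S m l' g'" and g': "g' \<in> Grp S m"
      using h(2) unfolding mem_iota limrel_iff by blast
    have "conn_iter S n (k + k') f = conn_iter S m (l + k') f'" by (rule conn_iter_shift[OF 1(2,1)])
    moreover have "conn_iter S n (k + k') g = conn_iter S m (l' + k) g'"
      using conn_iter_shift[OF 2(2,1), of k] by (simp add: add.commute)
    moreover have "l' + k = l + k'" using 1 2 by simp
    ultimately have "conn_iter S n (k + k') (\<lambda>v. f v + g v) = conn_iter S m (l + k') (\<lambda>v. f' v + g' v)"
      by (simp add: conn_iter_add)
    moreover have "n + (k + k') = m + (l + k')" using 1 by simp
    ultimately have "((n, \<lambda>v. f v + g v), (m, \<lambda>v. f' v + g' v)) \<in> limrel S"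
      unfolding limrel_iff using Grp_add f g f' g' by blast
    then show ?thesis by (rule iota_eqI[symmetric])
  qed
  have "(n, f) \<in> iota S n f" "(n, g) \<in> iota S n g" using f g limrel_refl mem_iota by auto
  then have "{iota S m (\<lambda>v. f' v + g' v) |m f' g'. (m, f') \<in> iota S n f \<and> (m, g') \<in> iota S n g} =
      {iota S n (\<lambda>v. f v + g v)}"
    using eq by blast
  then show ?thesis by (simp add: Dadd_def)
qed

lemma Dact_iota:
  assumes \<delta>: "\<delta> \<in> Gam S" and f: "f \<in> Grp S n"
  shows "Dact S \<delta> (iota S n f) = iota S n (translate \<delta> f)"
proof -
  have eq: "iota S m (translate \<delta> f') = iota S n (translate \<delta> f)" if h: "(m, f') \<in> iota S n f" for m f'
  proof -
    obtain k l where 1: "n + k = m + l" "conn_iter S n k f = conn_iter S m l f'" and f': "f' \<in> Grp S m"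
      using h unfolding mem_iota limrel_iff by blast
    have "conn_iter S n k (translate \<delta> f) = conn_iter S m l (translate \<delta> f')"
      using 1 \<delta> by (simp add: conn_iter_translate)
    then have "((n, translate \<delta> f), (m, translate \<delta> f')) \<in> limrel S"
      unfolding limrel_iff using translate_Grp[OF \<delta>] f f' 1(1) by blast
    then show ?thesis by (rule iota_eqI[symmetric])
  qed
  have "(n, f) \<in> iota S n f" using f limrel_refl mem_iota by auto
  then have "{iota S m (translate \<delta> f') |m f'. (m, f') \<in> iota S n f} = {iota S n (translate \<delta> f)}"
    using eq by blast
  then show ?thesis by (simp add: Dact_def)
qed

lemma Dplus_E:
  assumes "X \<in> Dplus S"
  obtains n f where "f \<in> Grp_pos S n" "X = iota S n f"
  using assms by (auto simp: Dplus_def)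

lemma Dplus_iota: "f \<in> Grp_pos S n \<Longrightarrow> iota S n f \<in> Dplus S"
  by (auto simp: Dplus_def)

lemma Dplus_common:
  assumes "X \<in> Dplus S" "Y \<in> Dplus S"
  obtains n f g where "f \<in> Grp_pos S n" "X = iota S n f" "g \<in> Grp_pos S n" "Y = iota S n g"
proof -
  obtain n f where f: "f \<in> Grp_pos S n" "X = iota S n f" by (rule Dplus_E[OF assms(1)])
  obtain m g where g: "g \<in> Grp_pos S m" "Y = iota S m g" by (rule Dplus_E[OF assms(2)])
  have "X = iota S (n + m) (conn_iter S n m f)"
    unfolding f(2) by (rule iota_conn_iter[OF Grp_posD(1)[OF f(1)]])
  moreover have "Y = iota S (n + m) (conn_iter S m n g)"
    unfolding g(2) add.commute[of n m] by (rule iota_conn_iter[OF Grp_posD(1)[OF g(1)]])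
  moreover have "conn_iter S n m f \<in> Grp_pos S (n + m)" by (rule conn_iter_Grp_pos[OF f(1)])
  moreover have "conn_iter S m n g \<in> Grp_pos S (n + m)"
    unfolding add.commute[of n m] by (rule conn_iter_Grp_pos[OF g(1)])
  ultimately show ?thesis using that by blast
qed

lemma dirac_multiple_Grp_pos:
  assumes "(z, \<gamma>) \<in> Zext S n"
  shows "(\<lambda>v. if v = (z, \<gamma>) then real k / real (hdim S n z) else 0) \<in> Grp_pos S n"
proof -
  have "(\<lambda>v. if v = (z, \<gamma>) then real k / real (hdim S n z) else 0) \<in> Grp S n"
  proof (rule GrpI[where K = "real k / real (hdim S n z)"])
    fix z' \<gamma>' assume "(z', \<gamma>') \<in> Zext S n"
    show "\<exists>l::int. (if (z', \<gamma>') = (z, \<gamma>) then real k / real (hdim S n z) else 0) = of_int l / real (hdim S n z')"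
      by (intro exI[of _ "if (z', \<gamma>') = (z, \<gamma>) then int k else 0"]) auto
  qed (use assms in auto)
  then show ?thesis by (simp add: Grp_pos_def)
qed

lemma dirac_Grp_pos:
  assumes v: "v \<in> Zext S n"
  shows "dirac v \<in> Grp_pos S n"
proof -
  obtain z \<gamma> where e: "v = (z, \<gamma>)" by (cases v)
  have "hdim S n z > 0" using v hdim_pos by (auto simp: e Zext_iff)
  then have "dirac v = (\<lambda>w. if w = (z, \<gamma>) then real (hdim S n z) / real (hdim S n z) else 0)"
    by (auto simp: dirac_def e fun_eq_iff)
  then show ?thesis
    using dirac_multiple_Grp_pos[OF v[unfolded e], of "hdim S n z"] by (simp only:)
qed

lemma Grp_pos_value:
  assumes f: "f \<in> Grp_pos S n" and v: "(z, \<gamma>) \<in> Zext S n"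
  shows "\<exists>k::nat. f (z, \<gamma>) = real k / real (hdim S n z)"
proof -
  obtain k :: int where k: "f (z, \<gamma>) = of_int k / real (hdim S n z)"
    using Grp_D(3)[OF Grp_posD(1)[OF f] v] by blast
  have "hdim S n z > 0" using v hdim_pos by (auto simp: Zext_iff)
  then have "k \<ge> 0" using Grp_posD(2)[OF f, of "(z, \<gamma>)"] k by (simp add: zero_le_divide_iff)
  then have "f (z, \<gamma>) = real (nat k) / real (hdim S n z)" using k by simp
  then show ?thesis ..
qed

lemma restrict_Grp_pos:
  assumes f: "f \<in> Grp_pos S n"
  shows "(\<lambda>v. if v \<in> V then f v else 0) \<in> Grp_pos S n"
proof -
  obtain K where K: "\<And>v. \<bar>f v\<bar> \<le> K" using Grp_D(2)[OF Grp_posD(1)[OF f]] by blast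
  have K0: "0 \<le> K" using K[of undefined] by linarith
  have "(\<lambda>v. if v \<in> V then f v else 0) \<in> Grp S n"
  proof (rule GrpI[where K = K])
    fix z \<gamma> assume v: "(z, \<gamma>) \<in> Zext S n"
    show "\<exists>k::int. (if (z, \<gamma>) \<in> V then f (z, \<gamma>) else 0) = of_int k / real (hdim S n z)"
    proof (cases "(z, \<gamma>) \<in> V")
      case True
      then show ?thesis using Grp_D(3)[OF Grp_posD(1)[OF f] v] by simp
    next
      case False
      then show ?thesis by (intro exI[of _ 0]) simp
    qed
  qed (use K K0 Grp_D(1)[OF Grp_posD(1)[OF f]] in auto)
  then show ?thesis using Grp_posD(2)[OF f] by (simp add: Grp_pos_def)
qed

end

section \<open>Normal weights on the limit group\<close>

context kms_setting
begin

lemma W_lnD: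
  assumes "\<psi> \<in> W_ln S \<beta>"
  shows "\<psi> \<in> Dplus S \<rightarrow>\<^sub>E UNIV"
    "X \<in> Dplus S \<Longrightarrow> Y \<in> Dplus S \<Longrightarrow> \<psi> (Dadd S X Y) = \<psi> X + \<psi> Y"
    "\<gamma> \<in> Gam S \<Longrightarrow> X \<in> Dplus S \<Longrightarrow> \<psi> (Dact S \<gamma> X) = ennreal (\<gamma> powr \<beta>) * \<psi> X"
    "(\<And>k. F k \<in> Grp_pos S n) \<Longrightarrow> f \<in> Grp_pos S n \<Longrightarrow> incseq F \<Longrightarrow>
       (\<And>v. v \<in> Zext S n \<Longrightarrow> (\<lambda>k. F k v) \<longlonglongrightarrow> f v) \<Longrightarrow> (\<lambda>k. \<psi> (iota S n (F k))) \<longlonglongrightarrow> \<psi> (iota S n f)"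
    "\<psi> (iota S 0 (dirac (1, 1))) = 1"
proof -
  note * = assms[unfolded W_ln_def mem_Collect_eq]
  show "\<psi> \<in> Dplus S \<rightarrow>\<^sub>E UNIV" by (rule *[THEN conjunct1])
  show "X \<in> Dplus S \<Longrightarrow> Y \<in> Dplus S \<Longrightarrow> \<psi> (Dadd S X Y) = \<psi> X + \<psi> Y"
    by (rule *[THEN conjunct2, THEN conjunct1, rule_format])
  show "\<gamma> \<in> Gam S \<Longrightarrow> X \<in> Dplus S \<Longrightarrow> \<psi> (Dact S \<gamma> X) = ennreal (\<gamma> powr \<beta>) * \<psi> X"
    by (rule *[THEN conjunct2, THEN conjunct2, THEN conjunct1, rule_format])
  show "(\<lambda>k. \<psi> (iota S n (F k))) \<longlonglongrightarrow> \<psi> (iota S n f)"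
    if "\<And>k. F k \<in> Grp_pos S n" "f \<in> Grp_pos S n" "incseq F"
      "\<And>v. v \<in> Zext S n \<Longrightarrow> (\<lambda>k. F k v) \<longlonglongrightarrow> f v"
    by (rule *[THEN conjunct2, THEN conjunct2, THEN conjunct2, THEN conjunct1, rule_format, THEN conjunct2])
      (use that in simp)
  show "\<psi> (iota S 0 (dirac (1, 1))) = 1"
    by (rule *[THEN conjunct2, THEN conjunct2, THEN conjunct2, THEN conjunct2])
qed

lemma one_Zext: "(1, 1) \<in> Zext S 0"
  by (simp add: Zext_iff level_0 Gam_one)

lemma W_ln_add:
  assumes \<psi>: "\<psi> \<in> W_ln S \<beta>" and f: "f \<in> Grp_pos S n" and g: "g \<in> Grp_pos S n"
  shows "\<psi> (iota S n (\<lambda>v. f v + g v)) = \<psi> (iota S n f) + \<psi> (iota S n g)"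
  using W_lnD(2)[OF \<psi> Dplus_iota[OF f] Dplus_iota[OF g]] Dadd_iota[OF Grp_posD(1)[OF f] Grp_posD(1)[OF g]]
  by simp

text \<open>Additivity alone would allow the value infinity at 0. Cancelling against the finite
  normalization excludes it at level 0, and the zero functions of all levels represent the same
  class.\<close>

lemma W_ln_zero:
  assumes \<psi>: "\<psi> \<in> W_ln S \<beta>"
  shows "\<psi> (iota S n (\<lambda>v. 0)) = 0"
proof -
  have "iota S 0 (\<lambda>v. 0) = iota S n (\<lambda>v. 0)"
    using iota_conn_iter[OF Grp_posD(1)[OF Grp_pos_zero], of 0 n] by (simp add: conn_iter_zero)
  moreover have "1 + \<psi> (iota S 0 (\<lambda>v. 0)) = 1 + 0"
    using W_ln_add[OF \<psi> dirac_Grp_pos[OF one_Zext] Grp_pos_zero] W_lnD(5)[OF \<psi>] by simp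
  then have "\<psi> (iota S 0 (\<lambda>v. 0)) = 0" by (subst (asm) ennreal_add_left_cancel) simp
  ultimately show ?thesis by simp
qed

text \<open>The smallest positive function at a vertex is \<open>h 1\<close>, the Dirac function
  divided by the dimension. Additivity gives all its multiples, and the multiple \<open>d\<close> is
  the Dirac function itself.\<close>

lemma W_ln_dirac_multiple:
  assumes \<psi>: "\<psi> \<in> W_ln S \<beta>" and v: "(z, \<gamma>) \<in> Zext S n"
  shows "\<psi> (iota S n (\<lambda>w. if w = (z, \<gamma>) then real k / real (hdim S n z) else 0)) =
    ennreal (real k / real (hdim S n z)) * \<psi> (iota S n (dirac (z, \<gamma>)))"
proof -
  define d where "d = hdim S n z"
  have d: "d > 0" using v hdim_pos by (auto simp: d_def Zext_iff)
  define h where "h = (\<lambda>k w. if w = (z, \<gamma>) then real k / real d else 0)"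
  have hG: "h k \<in> Grp_pos S n" for k unfolding h_def d_def by (rule dirac_multiple_Grp_pos[OF v])
  have mult: "\<psi> (iota S n (h k)) = of_nat k * \<psi> (iota S n (h 1))" for k
  proof (induction k)
    case 0
    have "h 0 = (\<lambda>v. 0)" by (auto simp: h_def)
    then show ?case by (simp add: W_ln_zero[OF \<psi>])
  next
    case (Suc k)
    have "h (Suc k) = (\<lambda>v. h 1 v + h k v)" by (auto simp: h_def add_divide_distrib)
    then show ?case using W_ln_add[OF \<psi> hG hG] Suc by (simp add: distrib_right)
  qed
  have "dirac (z, \<gamma>) = h d" using d by (auto simp: h_def dirac_def)
  then have "ennreal (real k / real d) * \<psi> (iota S n (dirac (z, \<gamma>))) =
      ennreal (real k / real d) * ennreal (real d) * \<psi> (iota S n (h 1))"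
    using mult[of d] by (simp add: mult.assoc ennreal_of_nat_eq_real_of_nat)
  also have "ennreal (real k / real d) * ennreal (real d) = of_nat k"
    using d by (simp add: ennreal_mult[symmetric] ennreal_of_nat_eq_real_of_nat)
  also have "of_nat k * \<psi> (iota S n (h 1)) = \<psi> (iota S n (h k))" by (rule mult[symmetric])
  finally show ?thesis unfolding h_def d_def by (rule sym)
qed

lemma W_ln_finite_sum:
  assumes \<psi>: "\<psi> \<in> W_ln S \<beta>" and f: "f \<in> Grp_pos S n" and V: "finite V" "V \<subseteq> Zext S n"
  shows "\<psi> (iota S n (\<lambda>v. if v \<in> V then f v else 0)) = (\<Sum>v\<in>V. ennreal (f v) * \<psi> (iota S n (dirac v)))"
  using V
proof (induction V rule: finite_induct)
  case empty
  then show ?case by (simp add: W_ln_zero[OF \<psi>])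
next
  case (insert v V)
  obtain z \<gamma> where v: "v = (z, \<gamma>)" by (cases v)
  have vZ: "(z, \<gamma>) \<in> Zext S n" using insert.prems by (simp add: v)
  obtain k :: nat where k: "f (z, \<gamma>) = real k / real (hdim S n z)" using Grp_pos_value[OF f vZ] by blast
  define g where "g = (\<lambda>w. if w = (z, \<gamma>) then real k / real (hdim S n z) else 0)"
  have g: "g \<in> Grp_pos S n" unfolding g_def by (rule dirac_multiple_Grp_pos[OF vZ])
  have "(\<lambda>w. if w \<in> insert v V then f w else 0) = (\<lambda>w. g w + (if w \<in> V then f w else 0))"
    using insert.hyps by (auto simp: g_def v k)
  then have "\<psi> (iota S n (\<lambda>w. if w \<in> insert v V then f w else 0)) =
      \<psi> (iota S n g) + \<psi> (iota S n (\<lambda>w. if w \<in> V then f w else 0))"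
    using W_ln_add[OF \<psi> g restrict_Grp_pos[OF f]] by simp
  also have "\<psi> (iota S n g) = ennreal (f v) * \<psi> (iota S n (dirac v))"
    unfolding g_def by (simp add: W_ln_dirac_multiple[OF \<psi> vZ] v k)
  finally show ?case using insert by simp
qed

text \<open>An enumeration exhausts the countable vertex set by finite sets \<open>V k\<close>;
  axiom (ii) on one side and monotone convergence on the other pass to the limit. Values at Dirac
  functions thus determine the whole weight.\<close>

lemma W_ln_integral:
  assumes \<psi>: "\<psi> \<in> W_ln S \<beta>" and f: "f \<in> Grp_pos S n"
  shows "\<psi> (iota S n f) = (\<integral>\<^sup>+v. ennreal (f v) * \<psi> (iota S n (dirac v)) \<partial>count_space (Zext S n))"
proof -
  define V where "V = (\<lambda>k. {v \<in> Zext S n. to_nat_on (Zext S n) v < k})"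
  define F where "F = (\<lambda>k v. if v \<in> V k then f v else 0)"
  have finV: "finite (V k)" for k
  proof -
    have "inj_on (to_nat_on (Zext S n)) (V k)"
      by (rule inj_on_subset[OF inj_on_to_nat_on[OF countable_Zext]]) (auto simp: V_def)
    moreover have "to_nat_on (Zext S n) ` V k \<subseteq> {..<k}" by (auto simp: V_def)
    ultimately show ?thesis using finite_imageD finite_subset finite_lessThan by metis
  qed
  have VZ: "V k \<subseteq> Zext S n" for k by (auto simp: V_def)
  have incV: "V k \<subseteq> V l" if "k \<le> l" for k l using that by (auto simp: V_def)
  have incF: "incseq F"
    unfolding incseq_def le_fun_def F_def using incV Grp_posD(2)[OF f] by auto
  have ev: "\<forall>\<^sub>F k in sequentially. F k v = f v" for v
  proof (cases "v \<in> Zext S n")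
    case True
    then have "\<forall>k\<ge>Suc (to_nat_on (Zext S n) v). F k v = f v" by (auto simp: F_def V_def)
    then show ?thesis unfolding eventually_sequentially by blast
  next
    case False
    then have "F k v = f v" for k using Grp_D(1)[OF Grp_posD(1)[OF f]] by (auto simp: F_def V_def)
    then show ?thesis by simp
  qed
  have "(\<lambda>k. \<psi> (iota S n (F k))) \<longlonglongrightarrow> \<psi> (iota S n f)"
  proof (rule W_lnD(4)[OF \<psi> _ f incF])
    show "F k \<in> Grp_pos S n" for k unfolding F_def by (rule restrict_Grp_pos[OF f])
    show "(\<lambda>k. F k v) \<longlonglongrightarrow> f v" for v by (rule tendsto_eventually[OF ev])
  qed
  moreover have "\<psi> (iota S n (F k)) = (\<integral>\<^sup>+v. ennreal (F k v) * \<psi> (iota S n (dirac v)) \<partial>count_space (Zext S n))" for k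
  proof -
    have "(\<integral>\<^sup>+v. ennreal (F k v) * \<psi> (iota S n (dirac v)) \<partial>count_space (Zext S n)) =
        (\<Sum>v\<in>V k. ennreal (F k v) * \<psi> (iota S n (dirac v)))"
      by (rule nn_integral_count_space'[OF finV _ VZ]) (simp add: F_def)
    also have "\<dots> = (\<Sum>v\<in>V k. ennreal (f v) * \<psi> (iota S n (dirac v)))" by (intro sum.cong) (auto simp: F_def)
    also have "\<dots> = \<psi> (iota S n (F k))" unfolding F_def by (rule W_ln_finite_sum[OF \<psi> f finV VZ, symmetric])
    finally show ?thesis by simp
  qed
  moreover have "(\<lambda>k. \<integral>\<^sup>+v. ennreal (F k v) * \<psi> (iota S n (dirac v)) \<partial>count_space (Zext S n)) \<longlonglongrightarrow>
      (\<integral>\<^sup>+v. ennreal (f v) * \<psi> (iota S n (dirac v)) \<partial>count_space (Zext S n))"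
  proof (rule nn_integral_LIMSEQ)
    show "incseq (\<lambda>k v. ennreal (F k v) * \<psi> (iota S n (dirac v)))"
      using incF unfolding incseq_def le_fun_def by (auto intro!: mult_right_mono ennreal_leI)
    show "(\<lambda>k. ennreal (F k v) * \<psi> (iota S n (dirac v))) \<longlonglongrightarrow> ennreal (f v) * \<psi> (iota S n (dirac v))" for v
      by (rule tendsto_eventually) (rule eventually_mono[OF ev[of v]], simp)
  qed simp
  ultimately show ?thesis by (simp add: LIMSEQ_unique)
qed

section \<open>Functionals defined by harmonic weights\<close>

definition weight_integral :: "(nat \<Rightarrow> 'a \<times> real \<Rightarrow> real) \<Rightarrow> nat \<Rightarrow> ('a \<times> real \<Rightarrow> real) \<Rightarrow> ennreal" where
  "weight_integral w n f = (\<integral>\<^sup>+v. ennreal (f v * w n v) \<partial>count_space (Zext S n))"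

text \<open>That all representatives give the same value is where harmonicity enters; the
  restriction to \<open>Dplus\<close> matches the extensional functions in
  \<open>W_ln\<close>.\<close>

definition weight_functional :: "(nat \<Rightarrow> 'a \<times> real \<Rightarrow> real) \<Rightarrow> 'a limelt \<Rightarrow> ennreal" where
  "weight_functional w = (\<lambda>X\<in>Dplus S. THE c. \<exists>n f. f \<in> Grp_pos S n \<and> X = iota S n f \<and> c = weight_integral w n f)"

text \<open>Transposed to \<open>conn\<close>: the sum runs over the upper vertices, which may be
  infinitely many, hence the integral in \<open>ennreal\<close>.\<close>

definition harmonic_weight :: "(nat \<Rightarrow> 'a \<times> real \<Rightarrow> real) \<Rightarrow> bool" where
  "harmonic_weight w \<longleftrightarrow> (\<forall>n. \<forall>v\<in>Zext S n. 0 \<le> w n v) \<and>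
     (\<forall>n. \<forall>v'\<in>Zext S n. (\<integral>\<^sup>+v. ennreal (mu S n v v' * w (Suc n) v) \<partial>count_space (Zext S (Suc n))) = ennreal (w n v'))"

text \<open>Tonelli moves the edge weights from the function to the weight, where harmonicity
  absorbs them.\<close>

lemma weight_integral_conn:
  assumes w: "harmonic_weight w" and f: "f \<in> Grp_pos S n"
  shows "weight_integral w (Suc n) (conn S n f) = weight_integral w n f"
proof -
  have w0: "\<And>n v. v \<in> Zext S n \<Longrightarrow> 0 \<le> w n v" and
    harm: "\<And>n v'. v' \<in> Zext S n \<Longrightarrow>
      (\<integral>\<^sup>+v. ennreal (mu S n v v' * w (Suc n) v) \<partial>count_space (Zext S (Suc n))) = ennreal (w n v')"
    using w by (auto simp: harmonic_weight_def)
  have f0: "0 \<le> f v" for v by (rule Grp_posD(2)[OF f])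
  have "weight_integral w (Suc n) (conn S n f) =
      (\<integral>\<^sup>+v. (\<integral>\<^sup>+v'. ennreal (f v') * ennreal (mu S n v v' * w (Suc n) v) \<partial>count_space (Zext S n)) \<partial>count_space (Zext S (Suc n)))"
    unfolding weight_integral_def
  proof (rule nn_integral_cong)
    fix v assume "v \<in> space (count_space (Zext S (Suc n)))"
    then have v: "v \<in> Zext S (Suc n)" by simp
    have m0: "0 \<le> mu S n v v'" if "v' \<in> nbhd n v" for v' using mu_nonneg[OF v] that by (auto simp: nbhd_def)
    have "(\<integral>\<^sup>+v'. ennreal (f v') * ennreal (mu S n v v' * w (Suc n) v) \<partial>count_space (Zext S n)) =
        (\<Sum>v'\<in>nbhd n v. ennreal (f v') * ennreal (mu S n v v' * w (Suc n) v))"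
      by (rule nn_integral_count_space'[OF finite_nbhd[OF v]]) (auto simp: nbhd_def)
    also have "\<dots> = (\<Sum>v'\<in>nbhd n v. ennreal (mu S n v v' * f v' * w (Suc n) v))"
      using f0 m0 w0[OF v] by (intro sum.cong) (auto simp: ennreal_mult[symmetric] mult_ac)
    also have "\<dots> = ennreal (\<Sum>v'\<in>nbhd n v. mu S n v v' * f v' * w (Suc n) v)"
      using f0 m0 w0[OF v] by (intro sum_ennreal) auto
    finally show "ennreal (conn S n f v * w (Suc n) v) =
        (\<integral>\<^sup>+v'. ennreal (f v') * ennreal (mu S n v v' * w (Suc n) v) \<partial>count_space (Zext S n))"
      using v by (simp add: conn_eq sum_distrib_right)
  qed
  also have "\<dots> = (\<integral>\<^sup>+v'. (\<integral>\<^sup>+v. ennreal (f v') * ennreal (mu S n v v' * w (Suc n) v) \<partial>count_space (Zext S (Suc n))) \<partial>count_space (Zext S n))"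
    by (rule nn_integral_count_space_nn_integral[OF countable_Zext]) simp
  also have "\<dots> = weight_integral w n f"
    unfolding weight_integral_def
  proof (rule nn_integral_cong)
    fix v' assume "v' \<in> space (count_space (Zext S n))"
    then have v': "v' \<in> Zext S n" by simp
    have "(\<integral>\<^sup>+v. ennreal (f v') * ennreal (mu S n v v' * w (Suc n) v) \<partial>count_space (Zext S (Suc n))) =
        ennreal (f v') * (\<integral>\<^sup>+v. ennreal (mu S n v v' * w (Suc n) v) \<partial>count_space (Zext S (Suc n)))"
      by (rule nn_integral_cmult) simp
    also have "\<dots> = ennreal (f v' * w n v')" using f0 w0[OF v'] by (simp add: harm[OF v'] ennreal_mult)
    finally show "(\<integral>\<^sup>+v. ennreal (f v') * ennreal (mu S n v v' * w (Suc n) v) \<partial>count_space (Zext S (Suc n))) =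
        ennreal (f v' * w n v')" .
  qed
  finally show ?thesis .
qed

lemma weight_integral_conn_iter:
  assumes w: "harmonic_weight w" and f: "f \<in> Grp_pos S n"
  shows "weight_integral w (n + k) (conn_iter S n k f) = weight_integral w n f"
proof (induction k)
  case (Suc k)
  then show ?case using weight_integral_conn[OF w conn_iter_Grp_pos[OF f, of k]] by simp
qed simp

lemma weight_functional_iota:
  assumes w: "harmonic_weight w" and f: "f \<in> Grp_pos S n"
  shows "weight_functional w (iota S n f) = weight_integral w n f"
proof -
  have "(THE c. \<exists>m g. g \<in> Grp_pos S m \<and> iota S n f = iota S m g \<and> c = weight_integral w m g) = weight_integral w n f"
  proof (rule the_equality)
    fix c assume "\<exists>m g. g \<in> Grp_pos S m \<and> iota S n f = iota S m g \<and> c = weight_integral w m g"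
    then obtain m g where g: "g \<in> Grp_pos S m" "iota S n f = iota S m g" "c = weight_integral w m g" by blast
    then obtain k l where kl: "n + k = m + l" "conn_iter S n k f = conn_iter S m l g"
      using iota_eq_iff[OF Grp_posD(1)[OF g(1)]] unfolding limrel_iff by blast
    show "c = weight_integral w n f"
      using weight_integral_conn_iter[OF w f, of k] weight_integral_conn_iter[OF w g(1), of l] kl g(3) by simp
  qed (use f in blast)
  then show ?thesis using Dplus_iota[OF f] by (simp add: weight_functional_def)
qed

text \<open>The axioms become facts about integrals: linearity, reindexing along the translation,
  monotone convergence, and a one-point sum.\<close>

lemma weight_functional_W_ln:
  assumes w: "harmonic_weight w"
    and scale: "\<And>n z \<gamma> \<delta>. (z, \<gamma>) \<in> Zext S n \<Longrightarrow> \<delta> \<in> Gam S \<Longrightarrow> w n (z, \<delta> * \<gamma>) = \<delta> powr \<beta> * w n (z, \<gamma>)"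
    and norm: "w 0 (1, 1) = 1"
  shows "weight_functional w \<in> W_ln S \<beta>"
proof -
  have w0: "\<And>n v. v \<in> Zext S n \<Longrightarrow> 0 \<le> w n v" using w by (auto simp: harmonic_weight_def)
  note wf = weight_functional_iota[OF w]
  have "weight_functional w (Dadd S X Y) = weight_functional w X + weight_functional w Y"
    if XY: "X \<in> Dplus S" "Y \<in> Dplus S" for X Y
  proof -
    obtain n f g where f: "f \<in> Grp_pos S n" "X = iota S n f" and g: "g \<in> Grp_pos S n" "Y = iota S n g"
      by (rule Dplus_common[OF XY])
    have "weight_integral w n (\<lambda>v. f v + g v) =
        (\<integral>\<^sup>+v. ennreal (f v * w n v) + ennreal (g v * w n v) \<partial>count_space (Zext S n))"
      unfolding weight_integral_def using w0 Grp_posD(2)[OF f(1)] Grp_posD(2)[OF g(1)]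
      by (intro nn_integral_cong) (simp add: distrib_right ennreal_plus)
    also have "\<dots> = weight_integral w n f + weight_integral w n g"
      unfolding weight_integral_def by (rule nn_integral_add) auto
    finally show ?thesis
      using f g Dadd_iota[OF Grp_posD(1)[OF f(1)] Grp_posD(1)[OF g(1)]] Grp_pos_add[OF f(1) g(1)] by (simp add: wf)
  qed
  moreover have "weight_functional w (Dact S \<delta> X) = ennreal (\<delta> powr \<beta>) * weight_functional w X"
    if \<delta>: "\<delta> \<in> Gam S" and X: "X \<in> Dplus S" for \<delta> X
  proof -
    obtain n f where f: "f \<in> Grp_pos S n" "X = iota S n f" by (rule Dplus_E[OF X])
    have p: "\<delta> > 0" using Gam_pos \<delta> by auto
    have "weight_integral w n (translate \<delta> f) =
        (\<integral>\<^sup>+v. ennreal (translate \<delta> f (case v of (z, \<gamma>) \<Rightarrow> (z, \<delta> * \<gamma>)) * w n (case v of (z, \<gamma>) \<Rightarrow> (z, \<delta> * \<gamma>))) \<partial>count_space (Zext S n))"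
      unfolding weight_integral_def by (rule nn_integral_bij_count_space[OF translate_bij[OF \<delta>], symmetric])
    also have "\<dots> = (\<integral>\<^sup>+v. ennreal (\<delta> powr \<beta>) * ennreal (f v * w n v) \<partial>count_space (Zext S n))"
    proof (rule nn_integral_cong)
      fix v assume "v \<in> space (count_space (Zext S n))"
      then have v: "v \<in> Zext S n" by simp
      obtain z \<gamma> where e: "v = (z, \<gamma>)" by (cases v)
      have "inverse \<delta> * (\<delta> * \<gamma>) = \<gamma>" using p by simp
      then have "translate \<delta> f (z, \<delta> * \<gamma>) * w n (z, \<delta> * \<gamma>) = \<delta> powr \<beta> * (f v * w n v)"
        using scale[OF v[unfolded e] \<delta>] by (simp only: translate_def split e mult_ac)
      then show "ennreal (translate \<delta> f (case v of (z, \<gamma>) \<Rightarrow> (z, \<delta> * \<gamma>)) * w n (case v of (z, \<gamma>) \<Rightarrow> (z, \<delta> * \<gamma>))) =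
          ennreal (\<delta> powr \<beta>) * ennreal (f v * w n v)"
        using w0[OF v] Grp_posD(2)[OF f(1)] by (simp add: e ennreal_mult)
    qed
    also have "\<dots> = ennreal (\<delta> powr \<beta>) * weight_integral w n f"
      unfolding weight_integral_def by (rule nn_integral_cmult) simp
    finally show ?thesis
      using f Dact_iota[OF \<delta> Grp_posD(1)[OF f(1)]] translate_Grp_pos[OF \<delta> f(1)] by (simp add: wf)
  qed
  moreover have "incseq (\<lambda>k. weight_functional w (iota S n (F k))) \<and>
      (\<lambda>k. weight_functional w (iota S n (F k))) \<longlonglongrightarrow> weight_functional w (iota S n f)"
    if F: "\<And>k. F k \<in> Grp_pos S n" and f: "f \<in> Grp_pos S n" and inc: "incseq F"
      and lim: "\<And>v. v \<in> Zext S n \<Longrightarrow> (\<lambda>k. F k v) \<longlonglongrightarrow> f v" for n f F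
  proof
    have mono: "ennreal (F k v * w n v) \<le> ennreal (F l v * w n v)" if "k \<le> l" "v \<in> Zext S n" for k l v
      using w0[OF that(2)] le_funD[OF incseqD[OF inc that(1)]] by (intro ennreal_leI mult_right_mono) auto
    show "incseq (\<lambda>k. weight_functional w (iota S n (F k)))"
      unfolding wf[OF F] weight_integral_def incseq_def using mono by (auto intro!: nn_integral_mono)
    \<comment> \<open>The indicator confines the pointwise requirements of monotone convergence to
      vertices, where the weight is known to be nonnegative.\<close>
    have "(\<lambda>k. \<integral>\<^sup>+v. ennreal (F k v * w n v) * indicator (Zext S n) v \<partial>count_space (Zext S n)) \<longlonglongrightarrow>
        (\<integral>\<^sup>+v. ennreal (f v * w n v) * indicator (Zext S n) v \<partial>count_space (Zext S n))"
    proof (rule nn_integral_LIMSEQ)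
      show "incseq (\<lambda>k v. ennreal (F k v * w n v) * indicator (Zext S n) v)"
        using mono unfolding incseq_def le_fun_def by (auto simp: indicator_def)
      show "(\<lambda>k. ennreal (F k v * w n v) * indicator (Zext S n) v) \<longlonglongrightarrow> ennreal (f v * w n v) * indicator (Zext S n) v" for v
      proof (cases "v \<in> Zext S n")
        case True
        then show ?thesis using lim[OF True] by (auto intro!: tendsto_ennrealI tendsto_mult)
      qed simp
    qed simp
    moreover have "(\<integral>\<^sup>+v. g v * indicator (Zext S n) v \<partial>count_space (Zext S n)) = (\<integral>\<^sup>+v. g v \<partial>count_space (Zext S n))" for g
      by (rule nn_integral_cong) simp
    ultimately show "(\<lambda>k. weight_functional w (iota S n (F k))) \<longlonglongrightarrow> weight_functional w (iota S n f)"
      unfolding wf[OF F] wf[OF f] weight_integral_def by simp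
  qed
  moreover have "weight_functional w (iota S 0 (dirac (1, 1))) = 1"
  proof -
    have "weight_integral w 0 (dirac (1, 1)) = (\<Sum>v\<in>{(1, 1)}. ennreal (dirac (1, 1) v * w 0 v))"
      unfolding weight_integral_def using one_Zext by (intro nn_integral_count_space') (auto simp: dirac_def)
    also have "\<dots> = 1" by (simp add: dirac_def norm)
    finally show ?thesis by (simp only: wf[OF dirac_Grp_pos[OF one_Zext]])
  qed
  moreover have "weight_functional w \<in> Dplus S \<rightarrow>\<^sub>E UNIV" by (simp add: weight_functional_def)
  ultimately show ?thesis unfolding W_ln_def by blast
qed

lemma weight_functional_dirac:
  assumes w: "harmonic_weight w" and v: "v \<in> Zext S n"
  shows "weight_functional w (iota S n (dirac v)) = ennreal (w n v)"
proof -
  have "weight_integral w n (dirac v) = (\<Sum>u\<in>{v}. ennreal (dirac v u * w n u))"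
    unfolding weight_integral_def using v by (intro nn_integral_count_space') (auto simp: dirac_def)
  also have "\<dots> = ennreal (w n v)" by (simp add: dirac_def)
  finally show ?thesis by (simp only: weight_functional_iota[OF w dirac_Grp_pos[OF v]])
qed

end

section \<open>From KMS states to weights\<close>

lemma has_sum_of_real_complex: "(f has_sum s) A \<Longrightarrow> ((\<lambda>x. complex_of_real (f x)) has_sum complex_of_real s) A"
  unfolding has_sum_def by (drule tendsto_of_real) simp

lemma nn_integral_count_space_has_sum:
  fixes f :: "'b \<Rightarrow> real"
  assumes f: "(f has_sum s) A" and nonneg: "\<And>x. x \<in> A \<Longrightarrow> 0 \<le> f x"
  shows "(\<integral>\<^sup>+x. ennreal (f x) \<partial>count_space A) = ennreal s"
proof -
  have "(\<lambda>x. norm (f x)) summable_on A"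
    using f nonneg by (subst summable_on_cong[where g = f]) (auto simp: summable_on_def)
  then have a: "Infinite_Set_Sum.abs_summable_on f A" using abs_summable_equivalent by blast
  have "(\<integral>\<^sup>+x. ennreal (f x) \<partial>count_space A) = ennreal (infsetsum f A)"
    by (rule nn_integral_conv_infsetsum[OF a nonneg])
  then show ?thesis using infsetsum_infsum[OF a] infsumI[OF f] by simp
qed

lemma has_sum_nn_integral_count_space:
  fixes f :: "'b \<Rightarrow> real"
  assumes f: "(\<integral>\<^sup>+x. ennreal (f x) \<partial>count_space A) = ennreal s" and nonneg: "\<And>x. x \<in> A \<Longrightarrow> 0 \<le> f x"
    and s: "0 \<le> s"
  shows "(f has_sum s) A"
proof -
  have "integrable (count_space A) f"
    using f nonneg by (intro integrableI_nonneg) (auto simp: AE_count_space)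
  then have a: "Infinite_Set_Sum.abs_summable_on f A" by (simp add: Infinite_Set_Sum.abs_summable_on_def)
  then have n: "(\<lambda>x. norm (f x)) summable_on A" using abs_summable_equivalent by blast
  have summ: "f summable_on A"
    using n nonneg by (subst (asm) summable_on_cong[where g = f]) auto
  have "ennreal (infsum f A) = ennreal s"
    using nn_integral_conv_infsetsum[OF a nonneg] infsetsum_infsum[OF a] f by simp
  moreover have "infsum f A \<ge> 0" by (rule infsum_nonneg) (rule nonneg)
  ultimately have "infsum f A = s" using s by simp
  then show ?thesis using summ has_sum_infsum by blast
qed

lemma nn_integral_count_space_Times:
  assumes "countable A" "countable B"
  shows "(\<integral>\<^sup>+v. g v \<partial>count_space (A \<times> B)) = (\<integral>\<^sup>+x. (\<integral>\<^sup>+y. g (x, y) \<partial>count_space B) \<partial>count_space A)"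
proof -
  interpret sigma_finite_measure "count_space B"
    by (rule sigma_finite_measure_count_space_countable[OF assms(2)])
  have m: "g \<in> borel_measurable (count_space A \<Otimes>\<^sub>M count_space B)"
    by (simp add: pair_measure_countable[OF assms])
  show ?thesis using nn_integral_fst[OF m] by (simp add: pair_measure_countable[OF assms])
qed

lemma state_positive: "state \<omega> \<Longrightarrow> positive_functional M \<omega>"
  by (auto simp: state_def positive_functional_def)

lemma state_bound: "state \<omega> \<Longrightarrow> cmod (\<omega> x) \<le> norm x"
  using positive_functional_bound[OF state_positive[of \<omega> UNIV], of x]
  by (simp add: cstar_subalgebra_def state_def)

section \<open>The weight of a KMS state\<close>

context kms_setting
begin

lemma KMS_lnD:
  assumes "\<omega> \<in> KMS_ln S \<beta>"
  shows "state \<omega>" "restr (alg S n) \<omega> \<in> predual S n"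
    "analytic_extension S n a G \<Longrightarrow> a \<in> alg S n \<Longrightarrow> b \<in> alg S n \<Longrightarrow> \<omega> (a * b) = \<omega> (b * G (\<i> * complex_of_real \<beta>))"
  using assms by (auto simp: KMS_ln_def)

lemma KMS_Zmin:
  assumes \<omega>: "\<omega> \<in> KMS_ln S \<beta>" and z: "z \<in> Zmin S n"
  shows "complex_of_real (Re (\<omega> z)) = \<omega> z" "0 \<le> Re (\<omega> z)"
proof -
  have "star z * z = z" by (simp only: Zmin_D(2,3)[OF z])
  then have "Im (\<omega> z) = 0 \<and> 0 \<le> Re (\<omega> z)"
    using KMS_lnD(1)[OF \<omega>] unfolding state_def by metis
  then show "complex_of_real (Re (\<omega> z)) = \<omega> z" "0 \<le> Re (\<omega> z)" by (auto simp: complex_eq_iff)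
qed

text \<open>On a corner every element is analytic, its entire orbit being the sandwich by complex
  powers of the density. Since \<open>\<i> * \<i> = - 1\<close>, its value at
  \<open>\<i> * \<beta>\<close> is the sandwich required by
  \<open>corner_KMS_unique\<close>.\<close>

lemma KMS_corner:
  assumes \<omega>: "\<omega> \<in> KMS_ln S \<beta>" and z: "z \<in> Zmin S n" and a: "a \<in> alg S n"
  shows "\<omega> (z * a) = \<omega> z / complex_of_real (dim_beta S \<beta> n z) * tau n z a"
proof -
  interpret density_corner "alg S n" z "hdim S n z" "rep S n z" "dens S n z"
    by (rule density_corner_Zmin[OF z])
  let ?b = "complex_of_real \<beta>"
  note st = KMS_lnD(1)[OF \<omega>, unfolded state_def]
  have "\<omega> (z * a) = \<omega> z / tr (pw (- ?b)) * tr (pw (- ?b) * (z * a))"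
  proof (rule corner_KMS_unique)
    show "\<omega> (x + y) = \<omega> x + \<omega> y" for x y using st by blast
    show "\<omega> (scaleC c x) = c * \<omega> x" for c x using st by blast
    fix x y assume x: "x \<in> zMz" and y: "y \<in> zMz"
    define G where "G = (\<lambda>w. pw (\<i> * w) * x * pw (- \<i> * w))"
    have "analytic_extension S n x G"
      unfolding analytic_extension_def
    proof (intro conjI allI)
      show "range G \<subseteq> alg S n" using x mem_corner ccl pw_corner by (auto simp: G_def)
      show "\<exists>D. (G has_derivative (\<lambda>h. scaleC h D)) (at w)" for w
        unfolding G_def by (rule pw_flow_derivative)
      show "G (complex_of_real t) = flow S t x" for t
        unfolding flow_corner[OF z x] corner_constants[OF z] by (simp add: G_def)
    qed
    then have "\<omega> (x * y) = \<omega> (y * G (\<i> * ?b))"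
      by (rule KMS_lnD(3)[OF \<omega>]) (use x y mem_corner in auto)
    moreover have "\<i> * (\<i> * ?b) = - ?b" "- \<i> * (\<i> * ?b) = ?b" by (simp_all add: mult.assoc[symmetric])
    ultimately show "\<omega> (x * y) = \<omega> (y * (pw (- ?b) * x * pw ?b))" by (simp only: G_def)
  qed (rule z_mult_corner[OF a])
  moreover have "tr (pw (- ?b)) = complex_of_real (dim_beta S \<beta> n z)"
    using pw_real_tr(1)[of "- \<beta>"] by (simp add: dim_beta_def corner_constants[OF z] complex_eq_iff)
  ultimately show ?thesis by (simp add: tau_def corner_constants[OF z] mult.assoc)
qed

lemma KMS_expansion:
  assumes \<omega>: "\<omega> \<in> KMS_ln S \<beta>" and a: "a \<in> alg S n"
  shows "((\<lambda>z. \<omega> z / complex_of_real (dim_beta S \<beta> n z) * tau n z a) has_sum \<omega> a) (Zmin S n)"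
proof -
  have "((\<lambda>z. \<omega> (z * a)) has_sum \<omega> a) (Zmin S n)"
    by (rule normal_has_sum[OF state_positive[OF KMS_lnD(1)[OF \<omega>]] KMS_lnD(2)[OF \<omega>] a])
  then show ?thesis by (subst (asm) has_sum_cong[OF KMS_corner[OF \<omega> _ a]])
qed

definition kms_weight :: "('a \<Rightarrow> complex) \<Rightarrow> nat \<Rightarrow> 'a \<times> real \<Rightarrow> real" where
  "kms_weight \<omega> n = (\<lambda>(z, \<gamma>). real (hdim S n z) / dim_beta S \<beta> n z * Re (\<omega> z) * \<gamma> powr \<beta>)"

text \<open>Normality expands \<open>\<omega> z'\<close> over the minimal central projections of the
  next level, and \<open>nn_integral_mu\<close> recognizes each summand as a fibre of the extended
  graph.\<close>

lemma kms_weight_harmonic: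
  assumes \<omega>: "\<omega> \<in> KMS_ln S \<beta>"
  shows "harmonic_weight (kms_weight \<omega>)"
  unfolding harmonic_weight_def
proof (intro conjI allI ballI)
  show w0: "0 \<le> kms_weight \<omega> n v" if "v \<in> Zext S n" for n v
  proof -
    obtain z \<gamma> where v: "v = (z, \<gamma>)" by (cases v)
    have "z \<in> Zmin S n" using that by (simp add: v Zext_iff)
    then show ?thesis using KMS_Zmin(2)[OF \<omega>] tau_z(3) by (simp add: v kms_weight_def less_imp_le)
  qed
  fix n v' assume v': "v' \<in> Zext S n"
  obtain z' \<gamma>' where e: "v' = (z', \<gamma>')" by (cases v')
  have z': "z' \<in> Zmin S n" and g': "\<gamma>' \<in> Gam S" using v' by (auto simp: e Zext_iff)
  define K where "K = \<gamma>' powr \<beta> * (real (hdim S n z') / dim_beta S \<beta> n z')"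
  have K0: "K \<ge> 0" using tau_z(3)[OF z'] by (simp add: K_def)
  \<comment> \<open>The contribution of \<open>z\<close> to \<open>\<omega> z'\<close> in
    \<open>KMS_expansion\<close>; \<open>K\<close> collects what depends on the lower vertex
    alone.\<close>
  define r where "r = (\<lambda>z. Re (\<omega> z) / dim_beta S \<beta> (Suc n) z * Re (tau (Suc n) z z'))"
  have r0: "r z \<ge> 0" if "z \<in> Zmin S (Suc n)" for z
    using KMS_Zmin(2)[OF \<omega> that] tau_z(3)[OF that] tau_projection_nonneg(2)[OF that z'] by (simp add: r_def)
  have "(\<integral>\<^sup>+v. ennreal (mu S n v v' * kms_weight \<omega> (Suc n) v) \<partial>count_space (Zext S (Suc n))) =
    (\<integral>\<^sup>+z. (\<integral>\<^sup>+\<gamma>. ennreal (mu S n (z, \<gamma>) v' * kms_weight \<omega> (Suc n) (z, \<gamma>)) \<partial>count_space (Gam S)) \<partial>count_space (Zmin S (Suc n)))"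
    unfolding Zext_def by (rule nn_integral_count_space_Times[OF countable_Zmin countable_Gam])
  also have "\<dots> = (\<integral>\<^sup>+z. ennreal (K * r z) \<partial>count_space (Zmin S (Suc n)))"
  proof (rule nn_integral_cong)
    fix z assume "z \<in> space (count_space (Zmin S (Suc n)))"
    then have z: "z \<in> Zmin S (Suc n)" by simp
    define C where "C = real (hdim S (Suc n) z) / dim_beta S \<beta> (Suc n) z * Re (\<omega> z)"
    have C0: "C \<ge> 0" using KMS_Zmin(2)[OF \<omega> z] tau_z(3)[OF z] by (simp add: C_def)
    have "(\<integral>\<^sup>+\<gamma>. ennreal (mu S n (z, \<gamma>) v' * kms_weight \<omega> (Suc n) (z, \<gamma>)) \<partial>count_space (Gam S)) =
        (\<integral>\<^sup>+\<gamma>. ennreal C * ennreal (mu S n (z, \<gamma>) (z', \<gamma>') * \<gamma> powr \<beta>) \<partial>count_space (Gam S))"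
    proof (rule nn_integral_cong)
      fix \<gamma> assume "\<gamma> \<in> space (count_space (Gam S))"
      then have "mu S n (z, \<gamma>) (z', \<gamma>') \<ge> 0" using mu_nonneg[OF _ v'] z by (simp add: Zext_iff e)
      then show "ennreal (mu S n (z, \<gamma>) v' * kms_weight \<omega> (Suc n) (z, \<gamma>)) =
          ennreal C * ennreal (mu S n (z, \<gamma>) (z', \<gamma>') * \<gamma> powr \<beta>)"
        using C0 by (simp add: ennreal_mult[symmetric] kms_weight_def C_def e mult_ac)
    qed
    also have "\<dots> = ennreal C * ennreal (\<gamma>' powr \<beta> * (Re (tau (Suc n) z z') * real (hdim S n z') / dim_beta S \<beta> n z') / real (hdim S (Suc n) z))"
      unfolding nn_integral_mu[OF z z' g', symmetric] by (rule nn_integral_cmult) simp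
    also have "\<dots> = ennreal (C * (\<gamma>' powr \<beta> * (Re (tau (Suc n) z z') * real (hdim S n z') / dim_beta S \<beta> n z') / real (hdim S (Suc n) z)))"
    proof (rule ennreal_mult[OF C0, symmetric])
      show "0 \<le> \<gamma>' powr \<beta> * (Re (tau (Suc n) z z') * real (hdim S n z') / dim_beta S \<beta> n z') / real (hdim S (Suc n) z)"
        using tau_projection_nonneg(2)[OF z z'] tau_z(3)[OF z'] by simp
    qed
    also have "C * (\<gamma>' powr \<beta> * (Re (tau (Suc n) z z') * real (hdim S n z') / dim_beta S \<beta> n z') / real (hdim S (Suc n) z)) = K * r z"
      using hdim_pos[OF z] by (simp add: C_def K_def r_def mult_ac)
    finally show "(\<integral>\<^sup>+\<gamma>. ennreal (mu S n (z, \<gamma>) v' * kms_weight \<omega> (Suc n) (z, \<gamma>)) \<partial>count_space (Gam S)) = ennreal (K * r z)" .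
  qed
  also have "\<dots> = ennreal (K * Re (\<omega> z'))"
  proof (rule nn_integral_count_space_has_sum)
    have z'A: "z' \<in> alg S (Suc n)" by (rule alg_Suc[OF Zmin_D(1)[OF z']])
    have "((\<lambda>z. Re (\<omega> z / complex_of_real (dim_beta S \<beta> (Suc n) z) * tau (Suc n) z z')) has_sum Re (\<omega> z')) (Zmin S (Suc n))"
      by (rule has_sum_Re[OF KMS_expansion[OF \<omega> z'A]])
    moreover have "Re (\<omega> z / complex_of_real (dim_beta S \<beta> (Suc n) z) * tau (Suc n) z z') = r z"
      if z: "z \<in> Zmin S (Suc n)" for z
      using tau_projection_nonneg(1)[OF z z'] by (simp add: r_def Re_divide_of_real)
    ultimately have "(r has_sum Re (\<omega> z')) (Zmin S (Suc n))"
      by (subst (asm) has_sum_cong) auto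
    then show "((\<lambda>z. K * r z) has_sum K * Re (\<omega> z')) (Zmin S (Suc n))" by (rule has_sum_cmult_right)
  qed (use K0 r0 in simp)
  also have "K * Re (\<omega> z') = kms_weight \<omega> n v'" by (simp add: K_def kms_weight_def e)
  finally show "(\<integral>\<^sup>+v. ennreal (mu S n v v' * kms_weight \<omega> (Suc n) v) \<partial>count_space (Zext S (Suc n))) = ennreal (kms_weight \<omega> n v')" .
qed

lemma kms_weight_W_ln:
  assumes \<omega>: "\<omega> \<in> KMS_ln S \<beta>"
  shows "weight_functional (kms_weight \<omega>) \<in> W_ln S \<beta>"
proof (rule weight_functional_W_ln[OF kms_weight_harmonic[OF \<omega>]])
  fix n z \<gamma> \<delta>
  have "(\<delta> * \<gamma>) powr \<beta> = \<delta> powr \<beta> * \<gamma> powr \<beta>" by (rule powr_mult)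
  then show "kms_weight \<omega> n (z, \<delta> * \<gamma>) = \<delta> powr \<beta> * kms_weight \<omega> n (z, \<gamma>)" by (simp add: kms_weight_def)
next
  show "kms_weight \<omega> 0 (1, 1) = 1"
    using KMS_lnD(1)[OF \<omega>] by (simp add: kms_weight_def level_0 state_def)
qed

lemma kms_weight_corresponds:
  assumes \<omega>: "\<omega> \<in> KMS_ln S \<beta>"
  shows "corresponds S \<beta> \<omega> (weight_functional (kms_weight \<omega>))"
  unfolding corresponds_def
proof (intro allI ballI, clarify)
  fix n z \<gamma> assume v: "(z, \<gamma>) \<in> Zext S n"
  show "weight_functional (kms_weight \<omega>) (iota S n (dirac (z, \<gamma>))) =
      ennreal (real (hdim S n z) / dim_beta S \<beta> n z * Re (\<omega> z) * \<gamma> powr \<beta>)"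
    unfolding weight_functional_dirac[OF kms_weight_harmonic[OF \<omega>] v] by (simp add: kms_weight_def)
qed

lemma W_ln_eqI:
  assumes \<psi>: "\<psi> \<in> W_ln S \<beta>" and \<psi>': "\<psi>' \<in> W_ln S \<beta>"
    and eq: "\<And>n v. v \<in> Zext S n \<Longrightarrow> \<psi> (iota S n (dirac v)) = \<psi>' (iota S n (dirac v))"
  shows "\<psi> = \<psi>'"
proof (rule PiE_ext[OF W_lnD(1)[OF \<psi>] W_lnD(1)[OF \<psi>']])
  fix X assume "X \<in> Dplus S"
  then obtain n f where f: "f \<in> Grp_pos S n" "X = iota S n f" by (rule Dplus_E)
  show "\<psi> X = \<psi>' X"
    unfolding f(2) W_ln_integral[OF \<psi> f(1)] W_ln_integral[OF \<psi>' f(1)]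
    by (rule nn_integral_cong) (simp add: eq)
qed

lemma corresponds_unique:
  assumes "\<psi> \<in> W_ln S \<beta>" "corresponds S \<beta> \<omega> \<psi>" "\<psi>' \<in> W_ln S \<beta>" "corresponds S \<beta> \<omega> \<psi>'"
  shows "\<psi> = \<psi>'"
proof (rule W_ln_eqI[OF assms(1,3)])
  fix n v assume v: "v \<in> Zext S n"
  obtain z \<gamma> where e: "v = (z, \<gamma>)" by (cases v)
  show "\<psi> (iota S n (dirac v)) = \<psi>' (iota S n (dirac v))"
    using assms(2,4) v unfolding corresponds_def e by fastforce
qed

lemma psi_of_eq:
  assumes \<omega>: "\<omega> \<in> KMS_ln S \<beta>"
  shows "psi_of S \<beta> \<omega> = weight_functional (kms_weight \<omega>)"
  unfolding psi_of_def
  by (rule the_equality) (use kms_weight_W_ln[OF \<omega>] kms_weight_corresponds[OF \<omega>] corresponds_unique in blast)+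

lemma psi_of_trace_formula:
  assumes \<omega>: "\<omega> \<in> KMS_ln S \<beta>"
  shows "trace_formula S \<beta> (psi_of S \<beta> \<omega>) \<omega>"
  unfolding trace_formula_def
proof (intro allI ballI)
  fix n a assume a: "a \<in> alg S n"
  show "((\<lambda>z. complex_of_real (enn2real (psi_of S \<beta> \<omega> (iota S n (dirac (z, 1))))) *
      (Tr S n z (dens_powr S n z (- complex_of_real \<beta>) * z * a) / of_nat (hdim S n z))) has_sum \<omega> a) (Zmin S n)"
  proof (subst has_sum_cong)
    fix z assume z: "z \<in> Zmin S n"
    have v: "(z, 1) \<in> Zext S n" using z by (simp add: Zext_iff Gam_one)
    have "psi_of S \<beta> \<omega> (iota S n (dirac (z, 1))) = ennreal (kms_weight \<omega> n (z, 1))"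
      unfolding psi_of_eq[OF \<omega>] by (rule weight_functional_dirac[OF kms_weight_harmonic[OF \<omega>] v])
    moreover have "kms_weight \<omega> n (z, 1) \<ge> 0"
      using kms_weight_harmonic[OF \<omega>] v unfolding harmonic_weight_def by blast
    ultimately have "complex_of_real (enn2real (psi_of S \<beta> \<omega> (iota S n (dirac (z, 1))))) =
        of_nat (hdim S n z) / complex_of_real (dim_beta S \<beta> n z) * \<omega> z"
      using KMS_Zmin(1)[OF \<omega> z] by (simp add: kms_weight_def)
    then show "complex_of_real (enn2real (psi_of S \<beta> \<omega> (iota S n (dirac (z, 1))))) *
      (Tr S n z (dens_powr S n z (- complex_of_real \<beta>) * z * a) / of_nat (hdim S n z)) =
      \<omega> z / complex_of_real (dim_beta S \<beta> n z) * tau n z a"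
      using hdim_pos[OF z] by (simp add: tau_def)
  qed (rule KMS_expansion[OF \<omega> a])
qed

section \<open>Convexity and affinity\<close>

lemma KMS_convex:
  assumes \<omega>1: "\<omega>1 \<in> KMS_ln S \<beta>" and \<omega>2: "\<omega>2 \<in> KMS_ln S \<beta>" and t: "t \<in> {0..1}"
  shows "(\<lambda>a. complex_of_real t * \<omega>1 a + complex_of_real (1 - t) * \<omega>2 a) \<in> KMS_ln S \<beta>"
proof -
  define \<omega> where "\<omega> = (\<lambda>a. complex_of_real t * \<omega>1 a + complex_of_real (1 - t) * \<omega>2 a)"
  note s1 = KMS_lnD(1)[OF \<omega>1, unfolded state_def] and s2 = KMS_lnD(1)[OF \<omega>2, unfolded state_def]
  have "state \<omega>"
    unfolding state_def
  proof (intro conjI allI)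
    show "\<omega> (x + y) = \<omega> x + \<omega> y" for x y using s1 s2 by (simp add: \<omega>_def algebra_simps)
    show "\<omega> (scaleC c x) = c * \<omega> x" for c x using s1 s2 by (simp add: \<omega>_def algebra_simps)
    show "Im (\<omega> (star x * x)) = 0" for x using s1 s2 by (simp add: \<omega>_def)
    show "0 \<le> Re (\<omega> (star x * x))" for x using s1 s2 t by (simp add: \<omega>_def)
    show "\<omega> 1 = 1" using s1 s2 by (simp add: \<omega>_def)
  qed
  moreover have "restr (alg S n) \<omega> \<in> predual S n" for n
  proof -
    note p = alg_predual[of n, unfolded is_predual_def]
    have lin: "(\<lambda>x. c * \<phi> x + \<psi> x) \<in> predual S n" if "\<phi> \<in> predual S n" "\<psi> \<in> predual S n" for c \<phi> \<psi>
      using p that by blast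
    have z: "(\<lambda>_. 0) \<in> predual S n" using p by blast
    have "(\<lambda>x. complex_of_real t * restr (alg S n) \<omega>1 x + (complex_of_real (1 - t) * restr (alg S n) \<omega>2 x + 0)) \<in> predual S n"
      by (intro lin z KMS_lnD(2)[OF \<omega>1] KMS_lnD(2)[OF \<omega>2])
    moreover have "(\<lambda>x. complex_of_real t * restr (alg S n) \<omega>1 x + (complex_of_real (1 - t) * restr (alg S n) \<omega>2 x + 0)) = restr (alg S n) \<omega>"
      by (auto simp: restr_def \<omega>_def)
    ultimately show ?thesis by simp
  qed
  moreover have "\<omega> (a * b) = \<omega> (b * G (\<i> * complex_of_real \<beta>))"
    if "a \<in> alg S n" "analytic_extension S n a G" "b \<in> alg S n" for n a G b
    using KMS_lnD(3)[OF \<omega>1 that(2,1,3)] KMS_lnD(3)[OF \<omega>2 that(2,1,3)] by (simp add: \<omega>_def)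
  ultimately have "\<omega> \<in> KMS_ln S \<beta>" unfolding KMS_ln_def by blast
  then show ?thesis by (simp add: \<omega>_def)
qed

text \<open>\<open>kms_weight\<close> is affine in the state. The identity is integrated in
  \<open>ennreal\<close>, since the values at \<open>X\<close> may be infinite.\<close>

lemma psi_of_affine:
  assumes \<omega>1: "\<omega>1 \<in> KMS_ln S \<beta>" and \<omega>2: "\<omega>2 \<in> KMS_ln S \<beta>" and t: "t \<in> {0..1}" and X: "X \<in> Dplus S"
  shows "psi_of S \<beta> (\<lambda>a. complex_of_real t * \<omega>1 a + complex_of_real (1 - t) * \<omega>2 a) X =
    ennreal t * psi_of S \<beta> \<omega>1 X + ennreal (1 - t) * psi_of S \<beta> \<omega>2 X"
proof -
  define \<omega> where "\<omega> = (\<lambda>a. complex_of_real t * \<omega>1 a + complex_of_real (1 - t) * \<omega>2 a)"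
  have \<omega>: "\<omega> \<in> KMS_ln S \<beta>" unfolding \<omega>_def by (rule KMS_convex[OF \<omega>1 \<omega>2 t])
  obtain n f where f: "f \<in> Grp_pos S n" "X = iota S n f" by (rule Dplus_E[OF X])
  have w0: "0 \<le> kms_weight \<omega>1 n v" "0 \<le> kms_weight \<omega>2 n v" if "v \<in> Zext S n" for v
    using kms_weight_harmonic[OF \<omega>1] kms_weight_harmonic[OF \<omega>2] that unfolding harmonic_weight_def by blast+
  have "weight_integral (kms_weight \<omega>) n f =
      (\<integral>\<^sup>+v. ennreal t * ennreal (f v * kms_weight \<omega>1 n v) + ennreal (1 - t) * ennreal (f v * kms_weight \<omega>2 n v) \<partial>count_space (Zext S n))"
    unfolding weight_integral_def
  proof (rule nn_integral_cong)
    fix v assume "v \<in> space (count_space (Zext S n))"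
    then have v: "v \<in> Zext S n" by simp
    have "f v * kms_weight \<omega> n v = t * (f v * kms_weight \<omega>1 n v) + (1 - t) * (f v * kms_weight \<omega>2 n v)"
      by (cases v) (simp add: kms_weight_def \<omega>_def algebra_simps add_divide_distrib diff_divide_distrib)
    then show "ennreal (f v * kms_weight \<omega> n v) =
        ennreal t * ennreal (f v * kms_weight \<omega>1 n v) + ennreal (1 - t) * ennreal (f v * kms_weight \<omega>2 n v)"
      using t w0[OF v] Grp_posD(2)[OF f(1), of v] by (simp add: ennreal_plus ennreal_mult)
  qed
  also have "\<dots> = ennreal t * weight_integral (kms_weight \<omega>1) n f + ennreal (1 - t) * weight_integral (kms_weight \<omega>2) n f"
    unfolding weight_integral_def by (subst nn_integral_add) (auto simp: nn_integral_cmult)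
  finally show ?thesis
    unfolding \<omega>_def[symmetric] psi_of_eq[OF \<omega>] psi_of_eq[OF \<omega>1] psi_of_eq[OF \<omega>2] f(2)
      weight_functional_iota[OF kms_weight_harmonic[OF \<omega>] f(1)]
      weight_functional_iota[OF kms_weight_harmonic[OF \<omega>1] f(1)]
      weight_functional_iota[OF kms_weight_harmonic[OF \<omega>2] f(1)] .
qed

end

section \<open>From weights to KMS states\<close>

context density_corner
begin

text \<open>A matrix coefficient is complex linear and bounded by the norm, so it turns
  differentiability in the algebra into complex differentiability.\<close>

lemma co_has_field_derivative:
  assumes G: "range G \<subseteq> M" "(G has_derivative (\<lambda>h. scaleC h D)) (at w)" and ij: "i < d" "j < d"
  shows "((\<lambda>w. co (z * G w) i j) has_field_derivative co (z * D) i j) (at w)"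
proof -
  define L where "L = (\<lambda>x. co (z * x) i j)"
  have Ldiff: "L (x - y) = L x - L y" and Lsc: "L (scaleC c x) = c * L x" if "x \<in> M" "y \<in> M" for x y c
  proof -
    have "L (x - y) + L y = L ((x - y) + y)"
      using that ij unfolding L_def distrib_left[of z "x - y" y] by (intro co_add[symmetric] z_mult_corner Mcl)
    then show "L (x - y) = L x - L y" by (simp add: algebra_simps)
    show "L (scaleC c x) = c * L x"
      using that ij by (simp add: L_def mult_scaleC_right co_scaleC z_mult_corner)
  qed
  have GM: "G w \<in> M" for w using G(1) by auto
  have lim: "(\<lambda>h. norm (G (w + h) - G w - scaleC h D) / norm h) \<midarrow>0\<rightarrow> 0"
    using G(2) unfolding has_derivative_at by blast
  \<comment> \<open>The derivative is a limit of difference quotients in the closed set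
    \<open>M\<close>; the linearity of \<open>L\<close>, established on \<open>M\<close>, may then
    be used at \<open>D\<close>.\<close>
  have "D \<in> M"
  proof (rule Lim_in_closed_set)
    show "closed M" using M by (simp add: cstar_subalgebra_def)
    show "\<forall>\<^sub>F h in at (0::complex). scaleC (1 / h) (G (w + h) - G w) \<in> M"
      using GM Mcl by simp
    show "at (0::complex) \<noteq> bot" by simp
    show "((\<lambda>h. scaleC (1 / h) (G (w + h) - G w)) \<longlongrightarrow> D) (at 0)"
    proof (rule LIM_zero_cancel, rule tendsto_norm_zero_cancel, rule Lim_transform_eventually[OF lim])
      show "\<forall>\<^sub>F h in at 0. norm (G (w + h) - G w - scaleC h D) / norm h =
          norm (scaleC (1 / h) (G (w + h) - G w) - D)"
      proof (rule eventually_mono[OF eventually_neq_at_within[of 0]])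
        fix h :: complex assume h: "h \<noteq> 0"
        have "scaleC (1 / h) (G (w + h) - G w) - D = scaleC (1 / h) (G (w + h) - G w - scaleC h D)"
          using h by (simp add: scaleC_diff_right scaleC_scaleC)
        then show "norm (G (w + h) - G w - scaleC h D) / norm h = norm (scaleC (1 / h) (G (w + h) - G w) - D)"
          by (simp add: norm_scaleC norm_divide)
      qed
    qed
  qed
  have "(\<lambda>h. norm (L (G (w + h)) - L (G w) - L D * h) / norm h) \<midarrow>0\<rightarrow> 0"
  proof (rule Lim_null_comparison[OF _ lim])
    show "\<forall>\<^sub>F h in at 0. norm (norm (L (G (w + h)) - L (G w) - L D * h) / norm h) \<le>
        norm (G (w + h) - G w - scaleC h D) / norm h"
    proof (rule always_eventually, rule allI)
      fix h :: complex
      have "L (G (w + h)) - L (G w) - L D * h = L (G (w + h) - G w - scaleC h D)"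
        using GM \<open>D \<in> M\<close> by (simp add: Ldiff Lsc Mcl mult.commute)
      then have "norm (L (G (w + h)) - L (G w) - L D * h) \<le> norm (G (w + h) - G w - scaleC h D)"
        using co_bound[OF _ ij, of "G (w + h) - G w - scaleC h D"] GM \<open>D \<in> M\<close> by (simp add: L_def Mcl)
      then show "norm (norm (L (G (w + h)) - L (G w) - L D * h) / norm h) \<le>
          norm (G (w + h) - G w - scaleC h D) / norm h"
        by (simp add: divide_right_mono)
    qed
  qed
  then have "((\<lambda>w. L (G w)) has_derivative (\<lambda>h. L D * h)) (at w)"
    unfolding has_derivative_at by (simp add: bounded_linear_mult_right)
  then show ?thesis by (simp add: has_field_derivative_def L_def)
qed

text \<open>Each matrix coefficient of the difference is an entire function that vanishes on the
  real line.\<close>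

lemma analytic_extension_unique:
  assumes G: "range G \<subseteq> M" "\<And>w. \<exists>D. (G has_derivative (\<lambda>h. scaleC h D)) (at w)"
    and H: "range H \<subseteq> M" "\<And>w. \<exists>D. (H has_derivative (\<lambda>h. scaleC h D)) (at w)"
    and eq: "\<And>t::real. z * G (complex_of_real t) = z * H (complex_of_real t)"
  shows "z * G w = z * H w"
proof (rule co_eqI)
  show "z * G w \<in> zMz" "z * H w \<in> zMz" using G(1) H(1) by (auto intro!: z_mult_corner)
  fix i j assume ij: "i < d" "j < d"
  define f where "f = (\<lambda>w. co (z * G w) i j - co (z * H w) i j)"
  have "f holomorphic_on UNIV"
  proof (rule holomorphic_onI)
    fix w
    obtain D E where "(G has_derivative (\<lambda>h. scaleC h D)) (at w)" "(H has_derivative (\<lambda>h. scaleC h E)) (at w)"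
      using G(2) H(2) by blast
    then have "(f has_field_derivative co (z * D) i j - co (z * E) i j) (at w)"
      unfolding f_def by (intro DERIV_diff co_has_field_derivative G(1) H(1) ij)
    then show "f field_differentiable at w within UNIV" by (auto simp: field_differentiable_def)
  qed
  then have "f w = 0"
  proof (rule analytic_continuation)
    show "range complex_of_real \<subseteq> UNIV" by simp
    show "0 islimpt range complex_of_real"
      unfolding islimpt_approachable
    proof (intro allI impI)
      fix e :: real assume "0 < e"
      then show "\<exists>x'\<in>range complex_of_real. x' \<noteq> 0 \<and> dist x' 0 < e"
        by (intro bexI[of _ "complex_of_real (e / 2)"]) (auto simp: dist_norm simp del: of_real_divide)
    qed
    show "f v = 0" if "v \<in> range complex_of_real" for v using that eq by (auto simp: f_def)
  qed auto
  then show "co (z * G w) i j = co (z * H w) i j" by (simp add: f_def)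
qed

end

context kms_setting
begin

text \<open>After multiplication by \<open>z\<close>, an arbitrary extension \<open>G\<close>
  coincides with the explicit orbit \<open>H\<close>. At \<open>\<i> * \<beta>\<close> the powers of
  the density are then moved around under the trace.\<close>

lemma tau_KMS:
  assumes z: "z \<in> Zmin S n" and a: "a \<in> alg S n" and b: "b \<in> alg S n" and G: "analytic_extension S n a G"
  shows "tau n z (a * b) = tau n z (b * G (\<i> * complex_of_real \<beta>))"
proof -
  interpret density_corner "alg S n" z "hdim S n z" "rep S n z" "dens S n z"
    by (rule density_corner_Zmin[OF z])
  let ?b = "complex_of_real \<beta>"
  define H where "H = (\<lambda>w. pw (\<i> * w) * (z * a) * pw (- \<i> * w))"
  have za: "z * a \<in> zMz" and zb: "z * b \<in> zMz" using a b by (auto intro: z_mult_corner)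
  have Hc: "H w \<in> zMz" for w using za by (simp add: H_def ccl pw_corner)
  have "z * G (\<i> * ?b) = z * H (\<i> * ?b)"
  proof (rule analytic_extension_unique)
    show "range G \<subseteq> alg S n" "\<And>w. \<exists>D. (G has_derivative (\<lambda>h. scaleC h D)) (at w)"
      using G by (auto simp: analytic_extension_def)
    show "range H \<subseteq> alg S n" using Hc mem_corner by auto
    show "\<exists>D. (H has_derivative (\<lambda>h. scaleC h D)) (at w)" for w
      unfolding H_def by (rule pw_flow_derivative)
    fix t :: real
    have "z * G (complex_of_real t) = z * flow S t a" using G by (simp add: analytic_extension_def)
    also have "\<dots> = flow S t (z * a)" by (simp add: flow_mult flow_Zmin[OF z])
    also have "\<dots> = H (complex_of_real t)"
      unfolding flow_corner[OF z za] corner_constants[OF z] by (simp add: H_def)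
    also have "\<dots> = z * H (complex_of_real t)" using corner_zero(1)[OF Hc] by simp
    finally show "z * G (complex_of_real t) = z * H (complex_of_real t)" .
  qed
  then have "z * G (\<i> * ?b) = H (\<i> * ?b)" by (simp only: corner_zero(1)[OF Hc])
  moreover have "\<i> * (\<i> * ?b) = - ?b" "- \<i> * (\<i> * ?b) = ?b" by (simp_all add: mult.assoc[symmetric])
  ultimately have zG: "z * G (\<i> * ?b) = pw (- ?b) * (z * a) * pw ?b"
    by (simp only: H_def)
  have GA: "G w \<in> alg S n" for w using G by (auto simp: analytic_extension_def)
  have t: "tau n z x = tr (pw (- ?b) * (z * x))" for x by (simp add: tau_def corner_constants[OF z] mult.assoc)
  have zxy: "z * (x * y) = (z * x) * (z * y)" if "x \<in> alg S n" for x y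
  proof -
    have "(z * x) * (z * y) = z * (x * z) * y" by (simp only: mult.assoc)
    also have "\<dots> = (z * z) * x * y" by (simp only: zc[OF that] mult.assoc)
    finally show ?thesis by (simp only: zz mult.assoc)
  qed
  have "tau n z (b * G (\<i> * ?b)) = tr (pw (- ?b) * ((z * b) * (pw (- ?b) * (z * a) * pw ?b)))"
    by (simp only: t zxy[OF b] zG)
  also have "pw (- ?b) * ((z * b) * (pw (- ?b) * (z * a) * pw ?b)) = (pw (- ?b) * (z * b) * pw (- ?b) * (z * a)) * pw ?b"
    by (simp only: mult.assoc)
  also have "tr \<dots> = tr (pw ?b * (pw (- ?b) * (z * b) * pw (- ?b) * (z * a)))"
    using za zb by (intro tr_comm) (auto simp: ccl pw_corner)
  also have "pw ?b * (pw (- ?b) * (z * b) * pw (- ?b) * (z * a)) = (pw ?b * pw (- ?b)) * (z * b) * (pw (- ?b) * (z * a))"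
    by (simp only: mult.assoc)
  also have "\<dots> = (z * b) * (pw (- ?b) * (z * a))" using corner_zero(1)[OF zb] by (simp add: pw_mult pw_zero)
  also have "tr \<dots> = tr ((pw (- ?b) * (z * a)) * (z * b))"
    using za zb by (intro tr_comm) (auto simp: ccl pw_corner)
  also have "\<dots> = tau n z (a * b)" unfolding t zxy[OF a, of b] by (simp only: mult.assoc)
  finally show ?thesis by simp
qed

end

section \<open>The state defined by a weight\<close>

locale weight_setting = kms_setting S \<beta> for S :: "('a::cstar_algebra) flow_system" and \<beta> +
  fixes \<psi> :: "'a limelt \<Rightarrow> ennreal"
  assumes \<psi>: "\<psi> \<in> W_ln S \<beta>"
begin

definition val :: "nat \<Rightarrow> 'a \<Rightarrow> ennreal" where
  "val n z = \<psi> (iota S n (dirac (z, 1)))"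

lemma Zext_one: "z \<in> Zmin S n \<Longrightarrow> (z, 1) \<in> Zext S n"
  by (simp add: Zext_iff Gam_one)

text \<open>The Dirac function at \<open>(z, \<gamma>)\<close> is a translate of the one at
  \<open>(z, 1)\<close>, so covariance under \<open>\<Gamma>\<close> leaves one free value per
  summand.\<close>

lemma psi_dirac:
  assumes v: "(z, \<gamma>) \<in> Zext S n"
  shows "\<psi> (iota S n (dirac (z, \<gamma>))) = ennreal (\<gamma> powr \<beta>) * val n z"
proof -
  have g: "\<gamma> \<in> Gam S" and z: "z \<in> Zmin S n" using v by (auto simp: Zext_iff)
  have p: "\<gamma> > 0" using Gam_pos g by auto
  have "dirac (z, \<gamma>) = translate \<gamma> (dirac (z, 1))"
    using p by (auto simp: dirac_def translate_def fun_eq_iff field_simps)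
  then show ?thesis
    using W_lnD(3)[OF \<psi> g Dplus_iota[OF dirac_Grp_pos[OF Zext_one[OF z]]]]
      Dact_iota[OF g Grp_posD(1)[OF dirac_Grp_pos[OF Zext_one[OF z]]]]
    by (simp add: val_def)
qed

lemma conn_dirac:
  assumes v: "v \<in> Zext S (Suc n)" and v': "v' \<in> Zext S n"
  shows "conn S n (dirac v') v = mu S n v v'"
proof -
  have "conn S n (dirac v') v = (\<Sum>u\<in>nbhd n v. if u = v' then mu S n v v' else 0)"
    using v by (simp add: conn_eq dirac_def if_distrib cong: if_cong)
  also have "\<dots> = mu S n v v'"
    using finite_nbhd[OF v] v' by (auto simp: nbhd_def)
  finally show ?thesis .
qed

text \<open>The future coefficient of \<open>tau n z\<close> in the state, which explains the
  division by the dimension in the trace formula.\<close>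

definition ew :: "nat \<Rightarrow> 'a \<Rightarrow> ennreal" where
  "ew n z = val n z * ennreal (1 / real (hdim S n z))"

lemma val_ew: "z \<in> Zmin S n \<Longrightarrow> val n z = ew n z * ennreal (real (hdim S n z))"
  using hdim_pos[of z n] by (simp add: ew_def mult.assoc ennreal_mult[symmetric])

text \<open>The class of the Dirac function at \<open>(z', 1)\<close> is also represented one level
  up by its image under \<open>conn\<close>. Evaluating \<open>\<psi>\<close> there by
  \<open>W_ln_integral\<close> and summing out the labels with \<open>nn_integral_mu\<close> gives
  the identity.\<close>

lemma ew_harmonic:
  assumes z': "z' \<in> Zmin S n"
  shows "(\<integral>\<^sup>+z. ew (Suc n) z * ennreal (Re (tau (Suc n) z z')) \<partial>count_space (Zmin S (Suc n))) =
    ew n z' * ennreal (dim_beta S \<beta> n z')"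
proof -
  let ?Z = "Zmin S (Suc n)"
  define D where "D = real (hdim S n z') / dim_beta S \<beta> n z'"
  have D: "D > 0" using hdim_pos[OF z'] tau_z(3)[OF z'] by (simp add: D_def)
  have v': "(z', 1) \<in> Zext S n" by (rule Zext_one[OF z'])
  have "val n z' = \<psi> (iota S (Suc n) (conn S n (dirac (z', 1))))"
    unfolding val_def using iota_conn[OF Grp_posD(1)[OF dirac_Grp_pos[OF v']]] by simp
  also have "\<dots> = (\<integral>\<^sup>+v. ennreal (conn S n (dirac (z', 1)) v) * \<psi> (iota S (Suc n) (dirac v)) \<partial>count_space (Zext S (Suc n)))"
    by (rule W_ln_integral[OF \<psi> conn_Grp_pos[OF dirac_Grp_pos[OF v']]])
  also have "\<dots> = (\<integral>\<^sup>+z. (\<integral>\<^sup>+\<gamma>. ennreal (conn S n (dirac (z', 1)) (z, \<gamma>)) * \<psi> (iota S (Suc n) (dirac (z, \<gamma>))) \<partial>count_space (Gam S)) \<partial>count_space ?Z)"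
    unfolding Zext_def by (rule nn_integral_count_space_Times[OF countable_Zmin countable_Gam])
  also have "\<dots> = (\<integral>\<^sup>+z. ennreal D * (ew (Suc n) z * ennreal (Re (tau (Suc n) z z'))) \<partial>count_space ?Z)"
  proof (rule nn_integral_cong)
    fix z assume "z \<in> space (count_space ?Z)"
    then have z: "z \<in> ?Z" by simp
    have "(\<integral>\<^sup>+\<gamma>. ennreal (conn S n (dirac (z', 1)) (z, \<gamma>)) * \<psi> (iota S (Suc n) (dirac (z, \<gamma>))) \<partial>count_space (Gam S)) =
        (\<integral>\<^sup>+\<gamma>. val (Suc n) z * ennreal (mu S n (z, \<gamma>) (z', 1) * \<gamma> powr \<beta>) \<partial>count_space (Gam S))"
    proof (rule nn_integral_cong)
      fix \<gamma> assume "\<gamma> \<in> space (count_space (Gam S))"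
      then have v: "(z, \<gamma>) \<in> Zext S (Suc n)" using z by (simp add: Zext_iff)
      show "ennreal (conn S n (dirac (z', 1)) (z, \<gamma>)) * \<psi> (iota S (Suc n) (dirac (z, \<gamma>))) =
          val (Suc n) z * ennreal (mu S n (z, \<gamma>) (z', 1) * \<gamma> powr \<beta>)"
        using mu_nonneg[OF v v'] by (simp add: conn_dirac[OF v v'] psi_dirac[OF v] ennreal_mult mult_ac)
    qed
    also have "\<dots> = val (Suc n) z * ennreal (1 powr \<beta> * (Re (tau (Suc n) z z') * real (hdim S n z') / dim_beta S \<beta> n z') / real (hdim S (Suc n) z))"
      unfolding nn_integral_mu[OF z z' Gam_one, symmetric] by (rule nn_integral_cmult) simp
    also have "1 powr \<beta> * (Re (tau (Suc n) z z') * real (hdim S n z') / dim_beta S \<beta> n z') / real (hdim S (Suc n) z) =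
        D * (1 / real (hdim S (Suc n) z)) * Re (tau (Suc n) z z')" by (simp add: D_def mult_ac)
    also have "ennreal \<dots> = ennreal D * ennreal (1 / real (hdim S (Suc n) z)) * ennreal (Re (tau (Suc n) z z'))"
      using D tau_projection_nonneg(2)[OF z z'] by (simp add: ennreal_mult[symmetric])
    finally show "(\<integral>\<^sup>+\<gamma>. ennreal (conn S n (dirac (z', 1)) (z, \<gamma>)) * \<psi> (iota S (Suc n) (dirac (z, \<gamma>))) \<partial>count_space (Gam S)) =
        ennreal D * (ew (Suc n) z * ennreal (Re (tau (Suc n) z z')))"
      by (simp add: ew_def mult_ac)
  qed
  also have "\<dots> = ennreal D * (\<integral>\<^sup>+z. ew (Suc n) z * ennreal (Re (tau (Suc n) z z')) \<partial>count_space ?Z)"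
    by (rule nn_integral_cmult) simp
  finally have e: "val n z' = ennreal D * (\<integral>\<^sup>+z. ew (Suc n) z * ennreal (Re (tau (Suc n) z z')) \<partial>count_space ?Z)" .
  have "ennreal (1 / D) * val n z' = (\<integral>\<^sup>+z. ew (Suc n) z * ennreal (Re (tau (Suc n) z z')) \<partial>count_space ?Z)"
    unfolding e using D by (simp add: mult.assoc[symmetric] ennreal_mult[symmetric])
  moreover have "ennreal (1 / D) * val n z' = ew n z' * ennreal (dim_beta S \<beta> n z')"
  proof -
    have "1 / D = 1 / real (hdim S n z') * dim_beta S \<beta> n z'" by (simp add: D_def)
    then have "ennreal (1 / D) = ennreal (1 / real (hdim S n z')) * ennreal (dim_beta S \<beta> n z')"
      using tau_z(3)[OF z'] by (simp add: ennreal_mult[symmetric])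
    then show ?thesis by (simp add: ew_def mult_ac)
  qed
  ultimately show ?thesis by simp
qed

lemma tau_normal_restrict: "z \<in> Zmin S (Suc n) \<Longrightarrow> restr (alg S n) (tau (Suc n) z) \<in> predual S n"
proof -
  assume z: "z \<in> Zmin S (Suc n)"
  have "restr (alg S n) (restr (alg S (Suc n)) (tau (Suc n) z)) = restr (alg S n) (tau (Suc n) z)"
    using alg_Suc by (auto simp: restr_def fun_eq_iff)
  then show ?thesis using predual_restr[OF tau_normal[OF z]] by simp
qed

lemma positive_functional_alg_Suc: "positive_functional (alg S (Suc n)) f \<Longrightarrow> positive_functional (alg S n) f"
  using alg_Suc unfolding positive_functional_def by blast

text \<open>The mass 1 at level 0 propagates: normality of \<open>tau\<close> on the lower algebra
  splits \<open>dim_beta\<close> of an upper summand over the lower projections, and after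
  exchanging the integrals \<open>ew_harmonic\<close> returns to the lower level.\<close>

lemma ew_sum: "(\<integral>\<^sup>+z. ew n z * ennreal (dim_beta S \<beta> n z) \<partial>count_space (Zmin S n)) = 1"
proof (induction n)
  case 0
  have "val 0 1 = 1" using W_lnD(5)[OF \<psi>] by (simp add: val_def)
  then show ?case by (simp add: level_0 ew_def nn_integral_count_space_finite)
next
  case (Suc n)
  let ?Z = "Zmin S (Suc n)"
  have "(\<integral>\<^sup>+z. ew (Suc n) z * ennreal (dim_beta S \<beta> (Suc n) z) \<partial>count_space ?Z) =
      (\<integral>\<^sup>+z. (\<integral>\<^sup>+z'. ew (Suc n) z * ennreal (Re (tau (Suc n) z z')) \<partial>count_space (Zmin S n)) \<partial>count_space ?Z)"
  proof (rule nn_integral_cong)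
    fix z assume "z \<in> space (count_space ?Z)"
    then have z: "z \<in> ?Z" by simp
    have "((\<lambda>z'. tau (Suc n) z (z' * 1)) has_sum tau (Suc n) z 1) (Zmin S n)"
      by (rule normal_has_sum[OF positive_functional_alg_Suc[OF tau_positive[OF z]] tau_normal_restrict[OF z] one_alg])
    then have "((\<lambda>z'. Re (tau (Suc n) z z')) has_sum dim_beta S \<beta> (Suc n) z) (Zmin S n)"
      using has_sum_Re tau_z(1)[OF z] by fastforce
    then have "(\<integral>\<^sup>+z'. ennreal (Re (tau (Suc n) z z')) \<partial>count_space (Zmin S n)) = ennreal (dim_beta S \<beta> (Suc n) z)"
      by (rule nn_integral_count_space_has_sum) (rule tau_projection_nonneg(2)[OF z])
    then show "ew (Suc n) z * ennreal (dim_beta S \<beta> (Suc n) z) =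
        (\<integral>\<^sup>+z'. ew (Suc n) z * ennreal (Re (tau (Suc n) z z')) \<partial>count_space (Zmin S n))"
      by (subst nn_integral_cmult) auto
  qed
  also have "\<dots> = (\<integral>\<^sup>+z'. (\<integral>\<^sup>+z. ew (Suc n) z * ennreal (Re (tau (Suc n) z z')) \<partial>count_space ?Z) \<partial>count_space (Zmin S n))"
    by (rule nn_integral_count_space_nn_integral[OF countable_Zmin]) simp
  also have "\<dots> = (\<integral>\<^sup>+z'. ew n z' * ennreal (dim_beta S \<beta> n z') \<partial>count_space (Zmin S n))"
    by (rule nn_integral_cong) (simp add: ew_harmonic)
  finally show ?case using Suc by simp
qed

definition er :: "nat \<Rightarrow> 'a \<Rightarrow> real" where
  "er n z = enn2real (ew n z)"

lemma er_nonneg: "er n z \<ge> 0" by (simp add: er_def)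

text \<open>No single term exceeds the total mass 1, and \<open>dim_beta\<close> is positive; hence
  the coefficients are finite and real arithmetic is lossless from here on.\<close>

lemma ennreal_er:
  assumes z: "z \<in> Zmin S n"
  shows "ennreal (er n z) = ew n z"
proof -
  have "ew n z * ennreal (dim_beta S \<beta> n z) \<le>
      (\<integral>\<^sup>+z. ew n z * ennreal (dim_beta S \<beta> n z) \<partial>count_space (Zmin S n))"
    by (rule nn_integral_ge_point[OF z])
  then have "ew n z * ennreal (dim_beta S \<beta> n z) \<le> 1" by (simp only: ew_sum)
  then have "ew n z \<noteq> top_class.top" using tau_z(3)[OF z] by (auto simp: ennreal_top_mult top_unique)
  then show ?thesis by (simp add: er_def less_top)
qed

lemma er_sum: "((\<lambda>z. er n z * dim_beta S \<beta> n z) has_sum 1) (Zmin S n)"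
proof (rule has_sum_nn_integral_count_space)
  have "(\<integral>\<^sup>+z. ennreal (er n z * dim_beta S \<beta> n z) \<partial>count_space (Zmin S n)) =
      (\<integral>\<^sup>+z. ew n z * ennreal (dim_beta S \<beta> n z) \<partial>count_space (Zmin S n))"
    using er_nonneg tau_z(3) by (intro nn_integral_cong) (simp add: ennreal_er[symmetric] ennreal_mult less_imp_le)
  then show "(\<integral>\<^sup>+z. ennreal (er n z * dim_beta S \<beta> n z) \<partial>count_space (Zmin S n)) = ennreal 1"
    by (simp add: ew_sum)
qed (use er_nonneg tau_z(3) in \<open>auto simp: less_imp_le\<close>)

lemma er_harmonic:
  assumes z': "z' \<in> Zmin S n"
  shows "((\<lambda>z. er (Suc n) z * Re (tau (Suc n) z z')) has_sum er n z' * dim_beta S \<beta> n z') (Zmin S (Suc n))"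
proof (rule has_sum_nn_integral_count_space)
  have "(\<integral>\<^sup>+z. ennreal (er (Suc n) z * Re (tau (Suc n) z z')) \<partial>count_space (Zmin S (Suc n))) =
      (\<integral>\<^sup>+z. ew (Suc n) z * ennreal (Re (tau (Suc n) z z')) \<partial>count_space (Zmin S (Suc n)))"
    using er_nonneg tau_projection_nonneg(2)[OF _ z'] by (intro nn_integral_cong) (simp add: ennreal_er[symmetric] ennreal_mult)
  also have "\<dots> = ennreal (er n z' * dim_beta S \<beta> n z')"
    unfolding ew_harmonic[OF z'] using er_nonneg tau_z(3)[OF z'] by (simp add: ennreal_er[OF z', symmetric] ennreal_mult)
  finally show "(\<integral>\<^sup>+z. ennreal (er (Suc n) z * Re (tau (Suc n) z z')) \<partial>count_space (Zmin S (Suc n))) =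
      ennreal (er n z' * dim_beta S \<beta> n z')" .
qed (use er_nonneg tau_z(3)[OF z'] tau_projection_nonneg(2)[OF _ z'] in \<open>auto simp: less_imp_le\<close>)

text \<open>The norm of \<open>tau n z\<close> is its value \<open>dim_beta\<close> at 1, so the
  total mass dominates the series.\<close>

lemma er_tau_summable:
  assumes a: "a \<in> alg S n" and B: "B \<subseteq> Zmin S n"
  shows "(\<lambda>z. complex_of_real (er n z) * tau n z a) summable_on B"
proof -
  have "(\<lambda>z. norm (complex_of_real (er n z) * tau n z a)) summable_on Zmin S n"
  proof (rule Infinite_Sum.abs_summable_on_comparison_test)
    have "(\<lambda>z. er n z * dim_beta S \<beta> n z * norm a) summable_on Zmin S n"
      by (rule summable_on_cmult_left) (use er_sum in \<open>auto simp: summable_on_def\<close>)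
    then show "(\<lambda>z. norm (er n z * dim_beta S \<beta> n z * norm a)) summable_on Zmin S n"
      by (subst summable_on_cong[where g = "\<lambda>z. er n z * dim_beta S \<beta> n z * norm a"])
        (auto simp: er_nonneg tau_z(3) less_imp_le abs_mult)
    fix z assume z: "z \<in> Zmin S n"
    have "cmod (tau n z a) \<le> dim_beta S \<beta> n z * norm a"
      using positive_functional_bound[OF tau_positive[OF z] alg_subalgebra a] tau_z(1)[OF z] by simp
    then have "er n z * cmod (tau n z a) \<le> er n z * (dim_beta S \<beta> n z * norm a)"
      by (rule mult_left_mono) (rule er_nonneg)
    then show "norm (complex_of_real (er n z) * tau n z a) \<le> norm (er n z * dim_beta S \<beta> n z * norm a)"
      using er_nonneg tau_z(3)[OF z] by (simp add: norm_mult abs_mult mult.assoc)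
  qed
  then have "(\<lambda>z. complex_of_real (er n z) * tau n z a) summable_on Zmin S n" by (rule Infinite_Sum.abs_summable_summable)
  then show ?thesis by (rule summable_on_subset_banach[OF _ B])
qed

text \<open>The set \<open>B\<close> of summands is a parameter, so that one definition serves the
  candidate state on a level and its tails.\<close>

definition om :: "nat \<Rightarrow> 'a set \<Rightarrow> 'a \<Rightarrow> complex" where
  "om n B a = (\<Sum>\<^sub>\<infinity>z\<in>B. complex_of_real (er n z) * tau n z a)"

lemma om_has_sum:
  assumes "a \<in> alg S n" "B \<subseteq> Zmin S n"
  shows "((\<lambda>z. complex_of_real (er n z) * tau n z a) has_sum om n B a) B"
  unfolding om_def by (rule has_sum_infsum[OF er_tau_summable[OF assms]])

lemma om_positive:
  assumes B: "B \<subseteq> Zmin S n"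
  shows "positive_functional (alg S n) (om n B)"
  unfolding positive_functional_def
proof (intro conjI ballI allI)
  fix x assume x: "x \<in> alg S n"
  have sx: "star x * x \<in> alg S n" using x by (simp add: alg_closed)
  note hs = om_has_sum[OF sx B]
  have t: "Im (tau n z (star x * x)) = 0" "0 \<le> Re (tau n z (star x * x))" if "z \<in> B" for z
    using positive_functionalD(3,4)[OF tau_positive x] B that by auto
  have "((\<lambda>z. Im (complex_of_real (er n z) * tau n z (star x * x))) has_sum Im (om n B (star x * x))) B"
    by (rule has_sum_Im[OF hs])
  moreover have "((\<lambda>z. Im (complex_of_real (er n z) * tau n z (star x * x))) has_sum 0) B"
    by (rule has_sum_0) (simp add: t)
  ultimately show "Im (om n B (star x * x)) = 0" by (rule has_sum_unique)
  show "0 \<le> Re (om n B (star x * x))"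
    by (rule has_sum_nonneg[OF has_sum_Re[OF hs]]) (simp add: t er_nonneg)
  show "om n B (scaleC c x) = c * om n B x" for c
  proof -
    have "((\<lambda>z. c * (complex_of_real (er n z) * tau n z x)) has_sum c * om n B x) B"
      by (rule has_sum_cmult_right[OF om_has_sum[OF x B]])
    moreover have "((\<lambda>z. complex_of_real (er n z) * tau n z (scaleC c x)) has_sum om n B (scaleC c x)) B"
      using x by (intro om_has_sum B) (simp add: alg_closed)
    then have "((\<lambda>z. c * (complex_of_real (er n z) * tau n z x)) has_sum om n B (scaleC c x)) B"
      using positive_functionalD(2)[OF tau_positive x] B
      by (subst (asm) has_sum_cong[where g = "\<lambda>z. c * (complex_of_real (er n z) * tau n z x)"]) auto
    ultimately show ?thesis using has_sum_unique by blast
  qed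
  fix y assume y: "y \<in> alg S n"
  have "((\<lambda>z. complex_of_real (er n z) * tau n z x + complex_of_real (er n z) * tau n z y) has_sum (om n B x + om n B y)) B"
    by (rule has_sum_add[OF om_has_sum[OF x B] om_has_sum[OF y B]])
  moreover have "((\<lambda>z. complex_of_real (er n z) * tau n z (x + y)) has_sum om n B (x + y)) B"
    using x y by (intro om_has_sum B) (simp add: alg_closed)
  then have "((\<lambda>z. complex_of_real (er n z) * tau n z x + complex_of_real (er n z) * tau n z y) has_sum om n B (x + y)) B"
    using positive_functionalD(1)[OF tau_positive x y] B
    by (subst (asm) has_sum_cong[where g = "\<lambda>z. complex_of_real (er n z) * tau n z x + complex_of_real (er n z) * tau n z y"])
      (auto simp: distrib_left)
  ultimately show "om n B (x + y) = om n B x + om n B y" using has_sum_unique by blast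
qed

lemma om_one:
  assumes B: "B \<subseteq> Zmin S n"
  shows "((\<lambda>z. er n z * dim_beta S \<beta> n z) has_sum Re (om n B 1)) B"
proof -
  have "((\<lambda>z. Re (complex_of_real (er n z) * tau n z 1)) has_sum Re (om n B 1)) B"
    by (rule has_sum_Re[OF om_has_sum[OF one_alg B]])
  then show ?thesis using tau_z(1) B by (subst (asm) has_sum_cong[where g = "\<lambda>z. er n z * dim_beta S \<beta> n z"]) auto
qed

lemma om_total: "om n (Zmin S n) 1 = 1"
proof -
  have "Re (om n (Zmin S n) 1) = 1" by (rule has_sum_unique[OF om_one[OF order_refl] er_sum])
  moreover have "Im (om n (Zmin S n) 1) = 0"
    using positive_functionalD(3)[OF om_positive[OF order_refl] one_alg] by simp
  ultimately show ?thesis by (simp add: complex_eq_iff)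
qed

lemma om_bound: "a \<in> alg S n \<Longrightarrow> cmod (om n (Zmin S n) a) \<le> norm a"
  using positive_functional_bound[OF om_positive[OF order_refl] alg_subalgebra, of a n] by (simp add: om_total)

lemma om_split:
  assumes a: "a \<in> alg S n" and J: "finite J" "J \<subseteq> Zmin S n"
  shows "om n (Zmin S n) a = (\<Sum>z\<in>J. complex_of_real (er n z) * tau n z a) + om n (Zmin S n - J) a"
proof -
  have "((\<lambda>z. complex_of_real (er n z) * tau n z a) has_sum (\<Sum>z\<in>J. complex_of_real (er n z) * tau n z a) + om n (Zmin S n - J) a) (J \<union> (Zmin S n - J))"
    by (rule has_sum_Un_disjoint[OF has_sum_finite[OF J(1)] om_has_sum[OF a]]) auto
  moreover have "J \<union> (Zmin S n - J) = Zmin S n" using J by auto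
  ultimately have "((\<lambda>z. complex_of_real (er n z) * tau n z a) has_sum (\<Sum>z\<in>J. complex_of_real (er n z) * tau n z a) + om n (Zmin S n - J) a) (Zmin S n)"
    by (simp only:)
  then show ?thesis by (rule has_sum_unique[OF om_has_sum[OF a order_refl]])
qed

text \<open>Finite partial sums are normal. A tail is a positive functional, so its norm is
  controlled by its value at 1, which is small by \<open>er_sum\<close>; the predual is norm
  closed.\<close>

lemma om_normal: "restr (alg S n) (om n (Zmin S n)) \<in> predual S n"
proof -
  let ?M = "alg S n" and ?F = "predual S n" and ?Z = "Zmin S n"
  note p = alg_predual[of n, unfolded is_predual_def]
  have lin: "(\<lambda>x. c * \<phi> x + \<theta> x) \<in> ?F" if "\<phi> \<in> ?F" "\<theta> \<in> ?F" for c \<phi> \<theta> using p that by blast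
  have zero: "(\<lambda>_. 0) \<in> ?F" using p by blast
  have closedF: "\<phi> \<in> ?F" if "\<phi> \<in> dual_space ?M" "\<And>e. e > 0 \<Longrightarrow> \<exists>\<theta>\<in>?F. dual_norm ?M (\<lambda>x. \<phi> x - \<theta> x) < e" for \<phi>
    using p that by blast
  have fin: "restr ?M (\<lambda>a. \<Sum>z\<in>J. complex_of_real (er n z) * tau n z a) \<in> ?F" if "finite J" "J \<subseteq> ?Z" for J
    using that
  proof (induction J rule: finite_induct)
    case empty
    then show ?case using zero by (simp add: restr_def cong: if_cong)
  next
    case (insert z J)
    have "(\<lambda>x. complex_of_real (er n z) * restr ?M (tau n z) x + restr ?M (\<lambda>a. \<Sum>z\<in>J. complex_of_real (er n z) * tau n z a) x) \<in> ?F"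
      using insert by (intro lin tau_normal) auto
    moreover have "(\<lambda>x. complex_of_real (er n z) * restr ?M (tau n z) x + restr ?M (\<lambda>a. \<Sum>z\<in>J. complex_of_real (er n z) * tau n z a) x) =
        restr ?M (\<lambda>a. \<Sum>z\<in>insert z J. complex_of_real (er n z) * tau n z a)"
      using insert.hyps by (auto simp: restr_def fun_eq_iff)
    ultimately show ?case by simp
  qed
  show ?thesis
  proof (rule closedF)
    note D = positive_functionalD[OF om_positive[OF order_refl, of n]]
    have "\<forall>x\<in>?M. cmod (restr ?M (om n ?Z) x) \<le> 1 * norm x" using om_bound by (simp add: restr_def)
    then have "\<exists>K. \<forall>x\<in>?M. cmod (restr ?M (om n ?Z) x) \<le> K * norm x" by blast
    then show "restr ?M (om n ?Z) \<in> dual_space ?M"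
      unfolding dual_space_def using D(1,2) alg_closed(2,5) by (simp add: restr_def)
    fix e :: real assume e: "e > 0"
    obtain J where J: "finite J" "J \<subseteq> ?Z" "dist (\<Sum>z\<in>J. er n z * dim_beta S \<beta> n z) 1 \<le> e / 2"
      using has_sum_finite_approximation[OF er_sum, of "e / 2" n] e by auto
    define \<theta> where "\<theta> = restr ?M (\<lambda>a. \<Sum>z\<in>J. complex_of_real (er n z) * tau n z a)"
    have c1: "Re (om n (?Z - J) 1) \<le> e / 2"
    proof -
      have "om n ?Z 1 = (\<Sum>z\<in>J. complex_of_real (er n z) * tau n z 1) + om n (?Z - J) 1"
        by (rule om_split[OF one_alg J(1,2)])
      then have "1 = (\<Sum>z\<in>J. Re (complex_of_real (er n z) * tau n z 1)) + Re (om n (?Z - J) 1)"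
        by (simp add: om_total complex_eq_iff)
      also have "(\<Sum>z\<in>J. Re (complex_of_real (er n z) * tau n z 1)) = (\<Sum>z\<in>J. er n z * dim_beta S \<beta> n z)"
        using J(2) tau_z(1) by (intro sum.cong) auto
      finally show ?thesis using J(3) unfolding dist_real_def by linarith
    qed
    have "dual_norm ?M (\<lambda>x. restr ?M (om n ?Z) x - \<theta> x) \<le> e / 2"
    proof (rule dual_norm_least)
      show "0 \<in> ?M" by (rule alg_closed)
      fix x assume x: "x \<in> ?M" "norm x \<le> 1"
      have "restr ?M (om n ?Z) x - \<theta> x = om n (?Z - J) x"
        using x om_split[OF x(1) J(1,2)] by (simp add: \<theta>_def restr_def)
      moreover have "cmod (om n (?Z - J) x) \<le> Re (om n (?Z - J) 1) * norm x"
        by (rule positive_functional_bound[OF om_positive alg_subalgebra x(1)]) auto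
      moreover have "Re (om n (?Z - J) 1) * norm x \<le> e / 2 * 1"
        using c1 x(2) e by (intro mult_mono) auto
      ultimately show "cmod (restr ?M (om n ?Z) x - \<theta> x) \<le> e / 2" by simp
    qed
    then have "dual_norm ?M (\<lambda>x. restr ?M (om n ?Z) x - \<theta> x) < e" using e by simp
    then show "\<exists>\<theta>\<in>?F. dual_norm ?M (\<lambda>x. restr ?M (om n ?Z) x - \<theta> x) < e"
      using fin[OF J(1,2)] unfolding \<theta>_def by blast
  qed
qed

text \<open>Normality of the embedding lets the upper functional be expanded over the lower central
  projections. On each lower corner \<open>tau_restrict\<close> reduces every term to the value at
  \<open>z'\<close>, and \<open>er_harmonic\<close> sums these values.\<close>

lemma om_Suc:
  assumes a: "a \<in> alg S n"
  shows "om (Suc n) (Zmin S (Suc n)) a = om n (Zmin S n) a"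
proof -
  let ?o = "om (Suc n) (Zmin S (Suc n))"
  have "restr (alg S n) (restr (alg S (Suc n)) ?o) = restr (alg S n) ?o"
    using alg_Suc by (auto simp: restr_def fun_eq_iff)
  then have normal: "restr (alg S n) ?o \<in> predual S n" using predual_restr[OF om_normal[of "Suc n"]] by simp
  have 1: "((\<lambda>z'. ?o (z' * a)) has_sum ?o a) (Zmin S n)"
    by (rule normal_has_sum[OF positive_functional_alg_Suc[OF om_positive[OF order_refl]] normal a])
  have "?o (z' * a) = complex_of_real (er n z') * tau n z' a" if z': "z' \<in> Zmin S n" for z'
  proof -
    have z'a: "z' * a \<in> alg S (Suc n)" using z' a Zmin_D(1) by (intro alg_Suc alg_closed) auto
    have "((\<lambda>z. complex_of_real (er (Suc n) z * Re (tau (Suc n) z z'))) has_sum complex_of_real (er n z' * dim_beta S \<beta> n z')) (Zmin S (Suc n))"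
      by (rule has_sum_of_real_complex[OF er_harmonic[OF z']])
    from has_sum_cmult_right[OF this, of "tau n z' a / complex_of_real (dim_beta S \<beta> n z')"]
    have "((\<lambda>z. tau n z' a / complex_of_real (dim_beta S \<beta> n z') * complex_of_real (er (Suc n) z * Re (tau (Suc n) z z'))) has_sum
        complex_of_real (er n z') * tau n z' a) (Zmin S (Suc n))"
      using tau_z(3)[OF z'] by (simp add: mult_ac)
    moreover have "complex_of_real (er (Suc n) z) * tau (Suc n) z (z' * a) =
        tau n z' a / complex_of_real (dim_beta S \<beta> n z') * complex_of_real (er (Suc n) z * Re (tau (Suc n) z z'))"
      if z: "z \<in> Zmin S (Suc n)" for z
    proof -
      have "complex_of_real (Re (tau (Suc n) z z')) = tau (Suc n) z z'"
        using tau_projection_nonneg(1)[OF z z'] by (simp add: complex_eq_iff)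
      then show ?thesis using tau_restrict[OF z z' a] by simp
    qed
    ultimately have "((\<lambda>z. complex_of_real (er (Suc n) z) * tau (Suc n) z (z' * a)) has_sum
        complex_of_real (er n z') * tau n z' a) (Zmin S (Suc n))"
      by (subst has_sum_cong)
    then show ?thesis using om_has_sum[OF z'a order_refl] has_sum_unique by blast
  qed
  then have "((\<lambda>z'. complex_of_real (er n z') * tau n z' a) has_sum ?o a) (Zmin S n)"
    using 1 by (subst (asm) has_sum_cong) auto
  then show ?thesis using om_has_sum[OF a order_refl] has_sum_unique by blast
qed

lemma om_mono: "a \<in> alg S m \<Longrightarrow> om (m + k) (Zmin S (m + k)) a = om m (Zmin S m) a"
proof (induction k)
  case (Suc k)
  then have "a \<in> alg S (m + k)" using alg_mono[of m "m + k"] by auto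
  then show ?case using om_Suc[of a "m + k"] Suc by simp
qed simp

text \<open>The least level is a mere choice; by \<open>om_mono\<close> every level containing
  \<open>a\<close> gives the same value.\<close>

definition u :: "'a \<Rightarrow> complex" where
  "u a = om (LEAST n. a \<in> alg S n) (Zmin S (LEAST n. a \<in> alg S n)) a"

lemma u_eq:
  assumes a: "a \<in> alg S n"
  shows "u a = om n (Zmin S n) a"
proof -
  define m where "m = (LEAST n. a \<in> alg S n)"
  have "a \<in> alg S m" unfolding m_def by (rule LeastI[of _ n]) (rule a)
  moreover have "m \<le> n" unfolding m_def by (rule Least_le) (rule a)
  ultimately show ?thesis using om_mono[of a m "n - m"] by (simp add: u_def m_def)
qed

text \<open>The functionals of all levels agree and are contractive, so they extend uniformly
  continuously from the dense union. Linearity and positivity pass to limits, while normality and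
  the KMS condition concern single levels.\<close>

lemma exists_KMS_state: "\<exists>\<omega>. \<omega> \<in> KMS_ln S \<beta> \<and> trace_formula S \<beta> \<psi> \<omega>"
proof -
  let ?U = "\<Union>n. alg S n"
  have dense: "closure ?U = UNIV" using ind by (simp add: inductive_system_def)
  have common: "\<exists>n. x \<in> alg S n \<and> y \<in> alg S n" if xy: "x \<in> ?U" "y \<in> ?U" for x y
  proof -
    obtain i j where "x \<in> alg S i" "y \<in> alg S j" using xy by blast
    then show ?thesis using alg_mono[of i "max i j"] alg_mono[of j "max i j"] by (intro exI[of _ "max i j"]) auto
  qed
  have udiff: "u (x - y) = u x - u y" if x: "x \<in> ?U" and y: "y \<in> ?U" for x y
  proof -
    obtain n where n: "x \<in> alg S n" "y \<in> alg S n" using common[OF x y] by blast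
    then show ?thesis
      using positive_functional_diff[OF om_positive[OF order_refl] cstar_subalgebra_star_closed[OF alg_subalgebra] n]
        u_eq alg_closed(7)[OF n] by simp
  qed
  have ubound: "cmod (u x) \<le> norm x" if "x \<in> ?U" for x using that om_bound u_eq by auto
  have uc: "uniformly_continuous_on ?U u"
    unfolding uniformly_continuous_on_def
  proof (intro allI impI)
    fix e :: real assume e: "e > 0"
    have "dist (u x') (u x) < e" if x: "x \<in> ?U" "x' \<in> ?U" and d: "dist x' x < e" for x x'
    proof -
      obtain n where n: "x' \<in> alg S n" "x \<in> alg S n" using common[OF x(2,1)] by blast
      have "x' - x \<in> ?U" using alg_closed(7)[OF n] by blast
      then have "cmod (u x' - u x) \<le> norm (x' - x)" using ubound udiff[OF x(2,1)] by metis
      then show ?thesis using d by (simp add: dist_norm)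
    qed
    then show "\<exists>d>0. \<forall>x\<in>?U. \<forall>x'\<in>?U. dist x' x < d \<longrightarrow> dist (u x') (u x) < e" using e by blast
  qed
  obtain \<omega> where cont: "uniformly_continuous_on (closure ?U) \<omega>" and ext: "\<And>x. x \<in> ?U \<Longrightarrow> u x = \<omega> x"
  proof (rule uniformly_continuous_on_extension_on_closure[OF uc])
    fix g assume "uniformly_continuous_on (closure ?U) g" "\<And>x. x \<in> ?U \<Longrightarrow> u x = g x"
    then show thesis by (rule that)
  qed
  have cont\<omega>: "continuous_on UNIV \<omega>" using uniformly_continuous_imp_continuous[OF cont] dense by simp
  have lim\<omega>: "(\<lambda>k. \<omega> (s k)) \<longlonglongrightarrow> \<omega> x" if "s \<longlonglongrightarrow> x" for s x
    using continuous_on_tendsto_compose[OF cont\<omega> that] by simp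
  have approx: "\<exists>s. (\<forall>k. s k \<in> ?U) \<and> s \<longlonglongrightarrow> x" for x using dense closure_sequential[of x ?U] by auto
  have eq: "\<omega> a = om n (Zmin S n) a" if "a \<in> alg S n" for a n
  proof -
    have "a \<in> ?U" using that by blast
    then show ?thesis using ext[of a] u_eq[OF that] by simp
  qed
  have add: "\<omega> (x + y) = \<omega> x + \<omega> y" for x y
  proof -
    obtain s t where s: "\<And>k. s k \<in> ?U" "s \<longlonglongrightarrow> x" and t: "\<And>k. t k \<in> ?U" "t \<longlonglongrightarrow> y"
      using approx[of x] approx[of y] by blast
    have "\<omega> (s k + t k) = \<omega> (s k) + \<omega> (t k)" for k
    proof -
      obtain n where n: "s k \<in> alg S n" "t k \<in> alg S n" using common[OF s(1) t(1)] by blast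
      then show ?thesis
        using positive_functionalD(1)[OF om_positive[OF order_refl] n] eq alg_closed(2)[OF n] by simp
    qed
    then have "(\<lambda>k. \<omega> (s k + t k)) \<longlonglongrightarrow> \<omega> x + \<omega> y" using tendsto_add[OF lim\<omega>[OF s(2)] lim\<omega>[OF t(2)]] by simp
    moreover have "(\<lambda>k. \<omega> (s k + t k)) \<longlonglongrightarrow> \<omega> (x + y)" by (rule lim\<omega>[OF tendsto_add[OF s(2) t(2)]])
    ultimately show ?thesis by (rule LIMSEQ_unique[symmetric])
  qed
  have scale: "\<omega> (scaleC c x) = c * \<omega> x" for c x
  proof -
    obtain s where s: "\<And>k. s k \<in> ?U" "s \<longlonglongrightarrow> x" using approx[of x] by blast
    have "\<omega> (scaleC c (s k)) = c * \<omega> (s k)" for k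
    proof -
      obtain n where n: "s k \<in> alg S n" using s(1)[of k] by blast
      then show ?thesis using positive_functionalD(2)[OF om_positive[OF order_refl] n] eq[OF n] eq[OF alg_closed(5)[OF n, of c]] by simp
    qed
    then have "(\<lambda>k. \<omega> (scaleC c (s k))) \<longlonglongrightarrow> c * \<omega> x" using tendsto_mult[OF tendsto_const lim\<omega>[OF s(2)]] by simp
    moreover have "(\<lambda>k. scaleC c (s k)) \<longlonglongrightarrow> scaleC c x"
    proof (rule LIM_zero_cancel, rule tendsto_norm_zero_cancel)
      have "(\<lambda>k. cmod c * norm (s k - x)) \<longlonglongrightarrow> cmod c * 0"
        using s(2) by (intro tendsto_intros) (simp add: LIM_zero_iff tendsto_norm_zero_iff)
      then show "(\<lambda>k. norm (scaleC c (s k) - scaleC c x)) \<longlonglongrightarrow> 0"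
        by (simp add: norm_scaleC flip: scaleC_diff_right)
    qed
    then have "(\<lambda>k. \<omega> (scaleC c (s k))) \<longlonglongrightarrow> \<omega> (scaleC c x)" by (rule lim\<omega>)
    ultimately show ?thesis using LIMSEQ_unique by blast
  qed
  have pos: "Im (\<omega> (star x * x)) = 0 \<and> 0 \<le> Re (\<omega> (star x * x))" for x
  proof -
    obtain s where s: "\<And>k. s k \<in> ?U" "s \<longlonglongrightarrow> x" using approx[of x] by blast
    have k: "Im (\<omega> (star (s k) * s k)) = 0" "0 \<le> Re (\<omega> (star (s k) * s k))" for k
    proof -
      obtain n where n: "s k \<in> alg S n" using s(1)[of k] by blast
      then show "Im (\<omega> (star (s k) * s k)) = 0" "0 \<le> Re (\<omega> (star (s k) * s k))"
        using positive_functionalD(3,4)[OF om_positive[OF order_refl] n] eq[of "star (s k) * s k" n] alg_closed by auto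
    qed
    have "(\<lambda>k. star (s k) * s k) \<longlonglongrightarrow> star x * x"
      by (intro tendsto_mult bounded_linear.tendsto[OF bounded_linear_star] s(2))
    then have l: "(\<lambda>k. \<omega> (star (s k) * s k)) \<longlonglongrightarrow> \<omega> (star x * x)" by (rule lim\<omega>)
    have "(\<lambda>k. Im (\<omega> (star (s k) * s k))) \<longlonglongrightarrow> Im (\<omega> (star x * x))" by (rule tendsto_Im[OF l])
    then have "Im (\<omega> (star x * x)) = 0" by (simp add: k LIMSEQ_const_iff)
    moreover have "0 \<le> Re (\<omega> (star x * x))"
      by (rule LIMSEQ_le_const[OF tendsto_Re[OF l]]) (use k in auto)
    ultimately show ?thesis by simp
  qed
  have "state \<omega>"
    unfolding state_def using add scale pos eq[OF one_alg, of 0] om_total[of 0] by simp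
  moreover have "restr (alg S n) \<omega> \<in> predual S n" for n
  proof -
    have "restr (alg S n) \<omega> = restr (alg S n) (om n (Zmin S n))" using eq by (auto simp: restr_def fun_eq_iff)
    then show ?thesis using om_normal by simp
  qed
  moreover have "\<omega> (a * b) = \<omega> (b * G (\<i> * complex_of_real \<beta>))"
    if a: "a \<in> alg S n" and G: "analytic_extension S n a G" and b: "b \<in> alg S n" for n a G b
  proof -
    have "G (\<i> * complex_of_real \<beta>) \<in> alg S n" using G by (auto simp: analytic_extension_def)
    then have "\<omega> (a * b) = om n (Zmin S n) (a * b)"
      "\<omega> (b * G (\<i> * complex_of_real \<beta>)) = om n (Zmin S n) (b * G (\<i> * complex_of_real \<beta>))"
      using a b by (auto intro!: eq alg_closed)
    moreover have "om n (Zmin S n) (a * b) = om n (Zmin S n) (b * G (\<i> * complex_of_real \<beta>))"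
      unfolding om_def by (rule infsum_cong) (simp only: tau_KMS[OF _ a b G])
    ultimately show ?thesis by simp
  qed
  ultimately have "\<omega> \<in> KMS_ln S \<beta>" unfolding KMS_ln_def by blast
  moreover have "trace_formula S \<beta> \<psi> \<omega>"
    unfolding trace_formula_def
  proof (intro allI ballI)
    fix n a assume a: "a \<in> alg S n"
    show "((\<lambda>z. complex_of_real (enn2real (\<psi> (iota S n (dirac (z, 1))))) *
      (Tr S n z (dens_powr S n z (- complex_of_real \<beta>) * z * a) / of_nat (hdim S n z))) has_sum \<omega> a) (Zmin S n)"
    proof (subst has_sum_cong)
      fix z assume "z \<in> Zmin S n"
      show "complex_of_real (enn2real (\<psi> (iota S n (dirac (z, 1))))) *
          (Tr S n z (dens_powr S n z (- complex_of_real \<beta>) * z * a) / of_nat (hdim S n z)) =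
          complex_of_real (er n z) * tau n z a"
        by (simp add: er_def ew_def val_def enn2real_mult tau_def)
    next
      show "((\<lambda>z. complex_of_real (er n z) * tau n z a) has_sum \<omega> a) (Zmin S n)"
        unfolding eq[OF a] by (rule om_has_sum[OF a order_refl])
    qed
  qed
  ultimately show ?thesis by blast
qed

text \<open>In the trace formula at \<open>a = z\<close> only the summand \<open>z\<close>
  contributes, so \<open>\<omega> z\<close> determines the coefficient at \<open>z\<close>, and
  \<open>psi_dirac\<close> supplies the other labels.\<close>

lemma trace_formula_corresponds:
  assumes \<omega>: "\<omega> \<in> KMS_ln S \<beta>" and tf: "trace_formula S \<beta> \<psi> \<omega>"
  shows "corresponds S \<beta> \<omega> \<psi>"
  unfolding corresponds_def
proof (intro allI ballI, clarify)
  fix n z \<gamma> assume v: "(z, \<gamma>) \<in> Zext S n"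
  have z: "z \<in> Zmin S n" and g: "\<gamma> \<in> Gam S" using v by (auto simp: Zext_iff)
  have e: "complex_of_real (enn2real (\<psi> (iota S n (dirac (w, 1))))) *
        (Tr S n w (dens_powr S n w (- complex_of_real \<beta>) * w * a) / of_nat (hdim S n w)) =
      complex_of_real (er n w) * tau n w a" for w a
    by (simp add: er_def ew_def val_def enn2real_mult tau_def)
  have "((\<lambda>w. complex_of_real (enn2real (\<psi> (iota S n (dirac (w, 1))))) *
        (Tr S n w (dens_powr S n w (- complex_of_real \<beta>) * w * z) / of_nat (hdim S n w))) has_sum \<omega> z) (Zmin S n)"
    using tf Zmin_D(1)[OF z] unfolding trace_formula_def by blast
  then have "((\<lambda>w. complex_of_real (er n w) * tau n w z) has_sum \<omega> z) (Zmin S n)" by (simp only: e)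
  moreover have "((\<lambda>w. complex_of_real (er n w) * tau n w z) has_sum complex_of_real (er n z) * tau n z z) (Zmin S n)"
  proof -
    have "((\<lambda>w. complex_of_real (er n w) * tau n w z) has_sum (\<Sum>w\<in>{z}. complex_of_real (er n w) * tau n w z)) {z}"
      by (rule has_sum_finite) simp
    then have "((\<lambda>w. complex_of_real (er n w) * tau n w z) has_sum complex_of_real (er n z) * tau n z z) {z}"
      by simp
    then show ?thesis
    proof (subst has_sum_cong_neutral[where T = "{z}" and g = "\<lambda>w. complex_of_real (er n w) * tau n w z"])
      fix w assume w: "w \<in> Zmin S n - {z}"
      then have "tau n w (z * 1) = 0" using tau_z(5)[of w n z 1] z by auto
      then show "complex_of_real (er n w) * tau n w z = 0" by simp
    qed (use z in auto)
  qed
  ultimately have "\<omega> z = complex_of_real (er n z) * tau n z z" by (rule has_sum_unique)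
  then have wz: "Re (\<omega> z) = er n z * dim_beta S \<beta> n z" by (simp add: tau_z(2)[OF z])
  have "\<psi> (iota S n (dirac (z, \<gamma>))) = ennreal (\<gamma> powr \<beta>) * (ennreal (er n z) * ennreal (real (hdim S n z)))"
    unfolding psi_dirac[OF v] val_ew[OF z] ennreal_er[OF z] ..
  also have "\<dots> = ennreal (\<gamma> powr \<beta> * (er n z * real (hdim S n z)))"
    using er_nonneg by (simp add: ennreal_mult)
  also have "\<gamma> powr \<beta> * (er n z * real (hdim S n z)) = real (hdim S n z) / dim_beta S \<beta> n z * Re (\<omega> z) * \<gamma> powr \<beta>"
    using tau_z(3)[OF z] by (simp add: wz)
  finally show "\<psi> (iota S n (dirac (z, \<gamma>))) = ennreal (real (hdim S n z) / dim_beta S \<beta> n z * Re (\<omega> z) * \<gamma> powr \<beta>)" .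
qed

end

section \<open>Uniqueness of the state and the conclusion\<close>

context kms_setting
begin

text \<open>The formula fixes the values on the dense union, and states are contractive.\<close>

lemma trace_formula_unique:
  assumes \<omega>1: "state \<omega>1" "trace_formula S \<beta> \<psi> \<omega>1" and \<omega>2: "state \<omega>2" "trace_formula S \<beta> \<psi> \<omega>2"
  shows "\<omega>1 = \<omega>2"
proof
  fix x
  have eq: "\<omega>1 a = \<omega>2 a" if "a \<in> alg S n" for a n
    using \<omega>1(2) \<omega>2(2) that unfolding trace_formula_def using has_sum_unique by blast
  have "x \<in> closure (\<Union>n. alg S n)" using ind by (simp add: inductive_system_def)
  then obtain s where s: "\<And>k. s k \<in> (\<Union>n. alg S n)" "s \<longlonglongrightarrow> x" unfolding closure_sequential by blast
  have lim: "(\<lambda>k. \<omega> (s k)) \<longlonglongrightarrow> \<omega> x" if st: "state \<omega>" for \<omega>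
  proof (rule LIM_zero_cancel, rule Lim_null_comparison)
    show "\<forall>\<^sub>F k in sequentially. norm (\<omega> (s k) - \<omega> x) \<le> norm (s k - x)"
    proof (rule always_eventually, rule allI)
      fix k
      have "\<omega> (s k - x) = \<omega> (s k) - \<omega> x"
        by (rule positive_functional_diff[OF state_positive[OF st] star_closed_UNIV]) auto
      then show "norm (\<omega> (s k) - \<omega> x) \<le> norm (s k - x)" using state_bound[OF st, of "s k - x"] by simp
    qed
    show "(\<lambda>k. norm (s k - x)) \<longlonglongrightarrow> 0" using s(2) by (simp add: LIM_zero_iff tendsto_norm_zero_iff)
  qed
  have "\<omega>1 (s k) = \<omega>2 (s k)" for k using s(1)[of k] eq by blast
  then have "(\<lambda>k. \<omega>1 (s k)) = (\<lambda>k. \<omega>2 (s k))" by simp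
  then show "\<omega>1 x = \<omega>2 x" using lim[OF \<omega>1(1)] lim[OF \<omega>2(1)] LIMSEQ_unique by metis
qed

end

theorem theorem5p5:
  fixes S :: "('a::cstar_algebra) flow_system" and \<beta> :: real
  assumes "inductive_system S" and "flow_on_system S" and "flow_density S"
  shows "(\<forall>\<omega>\<in>KMS_ln S \<beta>. \<exists>!\<psi>. \<psi> \<in> W_ln S \<beta> \<and> corresponds S \<beta> \<omega> \<psi>) \<and>
         bij_betw (psi_of S \<beta>) (KMS_ln S \<beta>) (W_ln S \<beta>) \<and>
         (\<forall>\<omega>\<^sub>1\<in>KMS_ln S \<beta>. \<forall>\<omega>\<^sub>2\<in>KMS_ln S \<beta>. \<forall>t\<in>{0..1}.
            (\<lambda>a. complex_of_real t * \<omega>\<^sub>1 a + complex_of_real (1 - t) * \<omega>\<^sub>2 a) \<in> KMS_ln S \<beta> \<and>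
            (\<forall>X\<in>Dplus S.
               psi_of S \<beta> (\<lambda>a. complex_of_real t * \<omega>\<^sub>1 a + complex_of_real (1 - t) * \<omega>\<^sub>2 a) X =
               ennreal t * psi_of S \<beta> \<omega>\<^sub>1 X + ennreal (1 - t) * psi_of S \<beta> \<omega>\<^sub>2 X)) \<and>
         (\<forall>\<psi>\<in>W_ln S \<beta>. \<exists>!\<omega>. \<omega> \<in> KMS_ln S \<beta> \<and> trace_formula S \<beta> \<psi> \<omega>) \<and>
         (\<forall>\<omega>\<in>KMS_ln S \<beta>. trace_formula S \<beta> (psi_of S \<beta> \<omega>) \<omega>)"
proof -
  interpret kms_setting S \<beta> using assms by unfold_locales
  have ex1: "\<exists>!\<psi>. \<psi> \<in> W_ln S \<beta> \<and> corresponds S \<beta> \<omega> \<psi>" if "\<omega> \<in> KMS_ln S \<beta>" for \<omega>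
    using kms_weight_W_ln[OF that] kms_weight_corresponds[OF that] corresponds_unique by blast
  have psi_W: "psi_of S \<beta> \<omega> \<in> W_ln S \<beta>" if "\<omega> \<in> KMS_ln S \<beta>" for \<omega>
    using kms_weight_W_ln[OF that] psi_of_eq[OF that] by simp
  have exists: "\<exists>\<omega>. \<omega> \<in> KMS_ln S \<beta> \<and> trace_formula S \<beta> \<psi> \<omega>" if "\<psi> \<in> W_ln S \<beta>" for \<psi>
  proof -
    interpret weight_setting S \<beta> \<psi> using that by unfold_locales
    show ?thesis by (rule exists_KMS_state)
  qed
  have uniq: "\<omega> = \<omega>'" if "\<omega> \<in> KMS_ln S \<beta>" "trace_formula S \<beta> \<psi> \<omega>" "\<omega>' \<in> KMS_ln S \<beta>" "trace_formula S \<beta> \<psi> \<omega>'" for \<omega> \<omega>' \<psi>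
    using trace_formula_unique[OF KMS_lnD(1)[OF that(1)] that(2) KMS_lnD(1)[OF that(3)] that(4)] .
  have surj: "\<psi> \<in> psi_of S \<beta> ` KMS_ln S \<beta>" if \<psi>: "\<psi> \<in> W_ln S \<beta>" for \<psi>
  proof -
    interpret weight_setting S \<beta> \<psi> using \<psi> by unfold_locales
    obtain \<omega> where \<omega>: "\<omega> \<in> KMS_ln S \<beta>" "trace_formula S \<beta> \<psi> \<omega>" using exists_KMS_state by blast
    have "\<psi> = psi_of S \<beta> \<omega>"
      unfolding psi_of_eq[OF \<omega>(1)]
      by (rule corresponds_unique[OF \<psi> trace_formula_corresponds[OF \<omega>] kms_weight_W_ln[OF \<omega>(1)] kms_weight_corresponds[OF \<omega>(1)]])
    then show ?thesis using \<omega>(1) by blast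
  qed
  \<comment> \<open>A state satisfies the trace formula for its own weight, so equal weights force
    equal states.\<close>
  have inj: "inj_on (psi_of S \<beta>) (KMS_ln S \<beta>)"
  proof (rule inj_onI)
    fix \<omega> \<omega>' assume w: "\<omega> \<in> KMS_ln S \<beta>" "\<omega>' \<in> KMS_ln S \<beta>" "psi_of S \<beta> \<omega> = psi_of S \<beta> \<omega>'"
    show "\<omega> = \<omega>'"
      using uniq[OF w(1) psi_of_trace_formula[OF w(1)] w(2)] psi_of_trace_formula[OF w(2)] w(3) by simp
  qed
  have "bij_betw (psi_of S \<beta>) (KMS_ln S \<beta>) (W_ln S \<beta>)"
    unfolding bij_betw_def using inj psi_W surj by blast
  then show ?thesis
    using ex1 KMS_convex psi_of_affine exists uniq psi_of_trace_formula by blast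
qed

end
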